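(* Let $n\ge3$ and let $D$ be a three-row diagram given by column multiplicities $m_C\ge0$ ($C$ ranging over nonempty subsets of $\{1,2,3\}$). Then the character of the Schur module $S_D$ of $GL(n,\mathbb C)$, evaluated at $x=\mathrm{diag}(x_1,\dots,x_n)$, is $$\mathrm{char}_{S_D}=\sum_{\tau}\mathcal C(\tau),$$ the sum over all standard column tabloids $\tau$, where: (i) if $\tau$ is not singular, $\mathcal C(\tau)=\dfrac{x^{\mathrm{wt}(\tau)}}{\prod_{a\ne b}(1-x_a^{-1}x_b)^{d_{ab}(\tau)}}$; (ii) if $\tau=\tau_{ijk}$ is singular, $\mathcal C(\tau)=\dfrac{x^{\mathrm{wt}(\tau)}}{(1-x_j/x_i)^3\,(1-x_k/x_j)^3\,\Delta_{ijk}}$, where $\Delta_{ijk}=\prod_{l\in[1,n]\setminus\{i,j,k\}}(1-x_l/x_i)(1-x_l/x_j)(1-x_l/x_k)$.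
   Context: Schur module: a diagram $D$ is a finite set of squares arranged in rows and columns; for three-row $D$ there are $m_C$ columns whose set of occupied rows is $C$. $GL(n)$ acts diagonally on $(\mathbb C^n)^{\otimes D}$ (one factor per square), the symmetric group on squares acts on the right by permuting factors; with $\alpha_D$ the average over row-preserving permutations and $\beta_D$ the signed average over column-preserving permutations, $S_D=(\mathbb C^n)^{\otimes D}\alpha_D\beta_D$. A standard column tabloid $\tau$ (for $GL(n)$) assigns to each of the seven nonempty subsets $C\subseteq\{1,2,3\}$ a subset $\tau(C)\subseteq[1,n]$ with $|\tau(C)|=|C|$, such that $C\subset C'$ implies $\tau(C)\subset\tau(C')$ (there are $11n(n-1)(n-2)$ of them). Its weight monomial is $x^{\mathrm{wt}(\tau)}=\prod_C\prod_{a\in\tau(C)}x_a^{m_C}$. For $a\ne b$ in $[1,n]$, $d_{ab}(\tau)$ is the number of connected components of the graph whose vertices are the subsets $C$ with $a\in\tau(C)$, $b\notin\tau(C)$, and whose edges join $C,C'$ when $C\subset C'$ or $C'\subset C$. For distinct $i,j,k\in[1,n]$, the singular tabloid $\tau_{ijk}$ is given by $\tau(\{1\})=\tau(\{2\})=\tau(\{3\})=\{i\}$, $\tau(\{1,2\})=\tau(\{1,3\})=\tau(\{2,3\})=\{i,j\}$, $\tau(\{1,2,3\})=\{i,j,k\}$; all other tabloids are called non-singular. *)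

theory Defs
  imports "HOL-Combinatorics.Combinatorics" Complex_Main
begin

text \<open>Three-row diagrams. A square is a triple (C, t, r): it lies in the t-th copy
  (t < m C) of the column type C (a nonempty subset of {1,2,3}) and in row r, r \<in> C.\<close>

type_synonym square = "nat set \<times> nat \<times> nat"
type_synonym labeling = "square \<Rightarrow> nat"

definition Subs :: "nat set set" where
  "Subs = {C. C \<subseteq> {1,2,3} \<and> C \<noteq> {}}"

definition squares :: "(nat set \<Rightarrow> nat) \<Rightarrow> square set" where
  "squares m = {(C,t,r). C \<in> Subs \<and> t < m C \<and> r \<in> C}"

definition sq_row :: "square \<Rightarrow> nat" where
  "sq_row s = snd (snd s)"

definition sq_col :: "square \<Rightarrow> nat set \<times> nat" where
  "sq_col s = (fst s, fst (snd s))"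

text \<open>Basis of (C^n)^{\<otimes>D}: e_f for labelings f : D \<rightarrow> [1,n] (extended by 0).
  Vectors are coefficient functions supported on labelings.\<close>

definition labelings :: "nat \<Rightarrow> (nat set \<Rightarrow> nat) \<Rightarrow> labeling set" where
  "labelings n m = {f. (\<forall>s\<in>squares m. f s \<in> {1..n}) \<and> (\<forall>s. s \<notin> squares m \<longrightarrow> f s = 0)}"

definition tensor_space :: "nat \<Rightarrow> (nat set \<Rightarrow> nat) \<Rightarrow> (labeling \<Rightarrow> complex) set" where
  "tensor_space n m = {v. \<forall>f. f \<notin> labelings n m \<longrightarrow> v f = 0}"

text \<open>Right action of a permutation of squares: e_f \<cdot> \<sigma> = e_{f \<circ> \<sigma>}.\<close>
definition perm_act :: "(square \<Rightarrow> square) \<Rightarrow> (labeling \<Rightarrow> complex) \<Rightarrow> (labeling \<Rightarrow> complex)" where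
  "perm_act \<sigma> v = (\<lambda>f. v (f \<circ> inv \<sigma>))"

definition row_group :: "(nat set \<Rightarrow> nat) \<Rightarrow> (square \<Rightarrow> square) set" where
  "row_group m = {\<sigma>. \<sigma> permutes squares m \<and> (\<forall>s. sq_row (\<sigma> s) = sq_row s)}"

definition col_group :: "(nat set \<Rightarrow> nat) \<Rightarrow> (square \<Rightarrow> square) set" where
  "col_group m = {\<sigma>. \<sigma> permutes squares m \<and> (\<forall>s. sq_col (\<sigma> s) = sq_col s)}"

definition alpha_D :: "(nat set \<Rightarrow> nat) \<Rightarrow> (labeling \<Rightarrow> complex) \<Rightarrow> (labeling \<Rightarrow> complex)" where
  "alpha_D m v = (\<lambda>f. (\<Sum>\<sigma>\<in>row_group m. perm_act \<sigma> v f) / of_nat (card (row_group m)))"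

definition beta_D :: "(nat set \<Rightarrow> nat) \<Rightarrow> (labeling \<Rightarrow> complex) \<Rightarrow> (labeling \<Rightarrow> complex)" where
  "beta_D m v = (\<lambda>f. (\<Sum>\<sigma>\<in>col_group m. of_int (sign \<sigma>) * perm_act \<sigma> v f)
                      / of_nat (card (col_group m)))"

text \<open>S_D = (C^n)^{\<otimes>D} \<alpha>_D \<beta>_D.\<close>
definition schur_module :: "nat \<Rightarrow> (nat set \<Rightarrow> nat) \<Rightarrow> (labeling \<Rightarrow> complex) set" where
  "schur_module n m = (\<lambda>v. beta_D m (alpha_D m v)) ` tensor_space n m"

text \<open>Linear operators on the tensor space given by kernels (matrices indexed by labelings).\<close>
definition kernel_apply :: "nat \<Rightarrow> (nat set \<Rightarrow> nat) \<Rightarrow> (labeling \<Rightarrow> labeling \<Rightarrow> complex)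
    \<Rightarrow> (labeling \<Rightarrow> complex) \<Rightarrow> (labeling \<Rightarrow> complex)" where
  "kernel_apply n m P v = (\<lambda>f. if f \<in> labelings n m then (\<Sum>g\<in>labelings n m. P f g * v g) else 0)"

definition is_projection_onto :: "nat \<Rightarrow> (nat set \<Rightarrow> nat) \<Rightarrow> (labeling \<Rightarrow> labeling \<Rightarrow> complex)
    \<Rightarrow> (labeling \<Rightarrow> complex) set \<Rightarrow> bool" where
  "is_projection_onto n m P W \<longleftrightarrow>
     (\<forall>v. kernel_apply n m P (kernel_apply n m P v) = kernel_apply n m P v) \<and>
     range (kernel_apply n m P) = W"

text \<open>diag(x) acts on e_f by the scalar prod_s x_{f(s)}.\<close>
definition diag_eigen :: "(nat \<Rightarrow> complex) \<Rightarrow> (nat set \<Rightarrow> nat) \<Rightarrow> labeling \<Rightarrow> complex" where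
  "diag_eigen x m f = (\<Prod>s\<in>squares m. x (f s))"

text \<open>Character: trace of diag(x) restricted to the (invariant) subspace S_D, computed as
  trace(X P) for a projection P onto S_D (independent of the choice of P).\<close>
definition schur_char :: "nat \<Rightarrow> (nat set \<Rightarrow> nat) \<Rightarrow> (nat \<Rightarrow> complex) \<Rightarrow> complex" where
  "schur_char n m x =
     (let P = (SOME P. is_projection_onto n m P (schur_module n m))
      in \<Sum>f\<in>labelings n m. diag_eigen x m f * P f f)"

text \<open>Standard column tabloids (extended by {} outside the seven subsets).\<close>
definition std_tabloids :: "nat \<Rightarrow> (nat set \<Rightarrow> nat set) set" where
  "std_tabloids n = {\<tau>. (\<forall>C\<in>Subs. \<tau> C \<subseteq> {1..n} \<and> card (\<tau> C) = card C) \<and>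
       (\<forall>C\<in>Subs. \<forall>C'\<in>Subs. C \<subset> C' \<longrightarrow> \<tau> C \<subset> \<tau> C') \<and>
       (\<forall>C. C \<notin> Subs \<longrightarrow> \<tau> C = {})}"

definition wt_mono :: "(nat set \<Rightarrow> nat) \<Rightarrow> (nat \<Rightarrow> complex) \<Rightarrow> (nat set \<Rightarrow> nat set) \<Rightarrow> complex" where
  "wt_mono m x \<tau> = (\<Prod>C\<in>Subs. \<Prod>a\<in>\<tau> C. x a ^ m C)"

definition d_verts :: "(nat set \<Rightarrow> nat set) \<Rightarrow> nat \<Rightarrow> nat \<Rightarrow> nat set set" where
  "d_verts \<tau> a b = {C\<in>Subs. a \<in> \<tau> C \<and> b \<notin> \<tau> C}"

definition d_edges :: "(nat set \<Rightarrow> nat set) \<Rightarrow> nat \<Rightarrow> nat \<Rightarrow> (nat set \<times> nat set) set" where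
  "d_edges \<tau> a b = {(C,C'). C \<in> d_verts \<tau> a b \<and> C' \<in> d_verts \<tau> a b \<and> (C \<subset> C' \<or> C' \<subset> C)}"

text \<open>Number of connected components.\<close>
definition d_ab :: "(nat set \<Rightarrow> nat set) \<Rightarrow> nat \<Rightarrow> nat \<Rightarrow> nat" where
  "d_ab \<tau> a b = card (d_verts \<tau> a b // ((d_edges \<tau> a b)\<^sup>*))"

definition sing_tabloid :: "nat \<Rightarrow> nat \<Rightarrow> nat \<Rightarrow> nat set \<Rightarrow> nat set" where
  "sing_tabloid i j k = (\<lambda>C. if C \<in> Subs then
      (if card C = 1 then {i} else if card C = 2 then {i,j} else {i,j,k}) else {})"

definition sing_triple :: "nat \<Rightarrow> (nat set \<Rightarrow> nat set) \<Rightarrow> nat \<times> nat \<times> nat \<Rightarrow> bool" where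
  "sing_triple n \<tau> t \<longleftrightarrow> (case t of (i,j,k) \<Rightarrow>
      i \<in> {1..n} \<and> j \<in> {1..n} \<and> k \<in> {1..n} \<and> distinct [i,j,k] \<and> \<tau> = sing_tabloid i j k)"

definition is_singular :: "nat \<Rightarrow> (nat set \<Rightarrow> nat set) \<Rightarrow> bool" where
  "is_singular n \<tau> \<longleftrightarrow> (\<exists>t. sing_triple n \<tau> t)"

definition contrib :: "nat \<Rightarrow> (nat set \<Rightarrow> nat) \<Rightarrow> (nat \<Rightarrow> complex) \<Rightarrow> (nat set \<Rightarrow> nat set) \<Rightarrow> complex" where
  "contrib n m x \<tau> =
    (if is_singular n \<tau> then
       (case (THE t. sing_triple n \<tau> t) of (i,j,k) \<Rightarrow>
          wt_mono m x \<tau> /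
          ((1 - x j / x i) ^ 3 * (1 - x k / x j) ^ 3 *
           (\<Prod>l\<in>{1..n} - {i,j,k}. (1 - x l / x i) * (1 - x l / x j) * (1 - x l / x k))))
     else
       wt_mono m x \<tau> / (\<Prod>a\<in>{1..n}. \<Prod>b\<in>{1..n} - {a}. (1 - x b / x a) ^ d_ab \<tau> a b))"

end

theory Submission
  imports Defs
    "HOL-Computational_Algebra.Polynomial"
    "HOL-Library.Poly_Mapping"
    "HOL-Library.Product_Lexorder"
    "HOL-Library.FuncSet"
begin

text \<open>
  The symmetrizer \<open>u = \<beta>\<alpha>\<close> is von Neumann regular in the group algebra, so the projection onto \<open>S\<^sub>D\<close>
  can be taken in the group algebra and its trace makes sense for every set \<open>U\<close> of letters. Adjoining
  one odd letter \<open>t\<close> gives a polynomial in \<open>t\<close> of degree at most 3 (an odd letter occurs at most once in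
  each of the three rows) whose value at \<open>x\<^sub>i\<close> is the character for \<open>U - {i}\<close> and whose value at \<open>0\<close> is
  the character for \<open>U\<close>. Lagrange interpolation therefore expresses the character by those of the three-element
  subsets \<open>V\<close> of \<open>[1,n]\<close>, with the tangent weights of the Grassmannian as denominators.

  For three letters, \<open>S\<^sub>D\<close> is dual to a graded piece of the ring generated by three vectors, the
  three cross products of pairs of them, and their determinant. The six vectors, placed on a hexagon with each cross
  product between its two factors, satisfy six bilinear relations \<open>p \<cdot> q = 0\<close>, one per edge, whose leading monomials
  can be made pairwise coprime; hence the monomials avoiding these six products span. They are independent
  because the kernel of the presentation is torsion with respect to the coordinates of the cross products,
  while for suitable weights such a coordinate has a leading monomial coprime to those of the
  relations, hence is not a zero divisor. Summing the weights of the standard monomials gives a sum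
  over the fixed points of a product of projective planes, in which the factors \<open>1 - x\<^sub>c/x\<^sub>a\<close> of the
  relations kill all but the column tabloids. The exponent of \<open>1/(1 - x\<^sub>c/x\<^sub>a)\<close> is the Euler characteristic
  of an induced subgraph of the hexagon: the number of components, unless the subgraph is the whole
  hexagon, which is the singular case.
\<close>

section \<open>Operators of the group algebra on tensors\<close>

text \<open>Interpolation in \<open>t\<close> needs more letters than the degree, at most 3, of the
  polynomial; this is why letters can be deleted down to three. Deleting a letter changes the tensor
  space but must not change the operator, so the coefficients of the projection are fixed once in
  the group algebra, for all alphabets simultaneously. For three letters a plane is determined by
  the letter that it misses: every vertex of the hexagon then carries a single letter, and a
  coordinate line lies in a coordinate plane exactly if their two letters differ. The obstacle is
  linear independence, because six relations need not generate the whole kernel of a presentation.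
  Only a weaker fact is visible directly: modulo the relations, the variables at an odd vertex are
  proportional to the coordinates of the cross product. Turning this into independence means
  cancelling one coordinate of each of the three cross products, hence a weight adapted to each of
  them. The colours chosen for the leading monomials leave no trace in the end: on a monomial of a
  relation the product of the two torus weights is the same for every colour.\<close>

definition labs :: "nat set \<Rightarrow> (nat set \<Rightarrow> nat) \<Rightarrow> labeling set" where
  "labs U m = {f. (\<forall>s\<in>squares m. f s \<in> U) \<and> (\<forall>s. s \<notin> squares m \<longrightarrow> f s = 0)}"

lemma labelings_eq_labs: "labelings n m = labs {1..n} m"
  by (simp add: labelings_def labs_def)

lemma finite_Subs: "finite Subs"
  by (rule finite_subset[of _ "Pow {1,2,3}"]) (auto simp: Subs_def)

lemma finite_squares: "finite (squares m)"
proof -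
  have "squares m \<subseteq> (\<Union>C\<in>Subs. \<Union>t\<in>{..<m C}. (\<lambda>r. (C,t,r)) ` {1,2,3})"
    by (auto simp: squares_def Subs_def)
  then show ?thesis by (rule finite_subset) (auto simp: finite_Subs)
qed

lemma finite_labs: "finite U \<Longrightarrow> finite (labs U m)"
proof -
  assume "finite U"
  have "labs U m \<subseteq> {f. \<forall>s. (s \<in> squares m \<longrightarrow> f s \<in> U) \<and> (s \<notin> squares m \<longrightarrow> f s = 0)}"
    by (auto simp: labs_def)
  then show "finite (labs U m)"
    by (rule finite_subset) (rule finite_set_of_finite_funs[OF finite_squares \<open>finite U\<close>])
qed

lemma labs_comp: "\<sigma> permutes squares m \<Longrightarrow> f \<in> labs U m \<Longrightarrow> f \<circ> \<sigma> \<in> labs U m"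
  by (auto simp: labs_def permutes_in_image permutes_not_in)

lemma labs_comp_iff: "\<sigma> permutes squares m \<Longrightarrow> f \<circ> \<sigma> \<in> labs U m \<longleftrightarrow> f \<in> labs U m"
  using labs_comp[of \<sigma> m f U] labs_comp[of "inv \<sigma>" m "f \<circ> \<sigma>" U]
  by (auto simp: permutes_inv comp_assoc permutes_inv_o)

lemma finite_permuters: "finite {\<sigma>. \<sigma> permutes squares m}"
  by (rule finite_permutations[OF finite_squares])

text \<open>Composing with \<open>\<sigma>\<close> itself, and not with its inverse as in
  \<open>perm_act\<close>, makes the coefficients multiply by convolution in the order of
  composition. The difference is invisible for \<alpha> and \<beta>, whose coefficients are
  invariant under inversion.\<close>

definition gop :: "(nat set \<Rightarrow> nat) \<Rightarrow> ((square \<Rightarrow> square) \<Rightarrow> complex)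
    \<Rightarrow> (labeling \<Rightarrow> complex) \<Rightarrow> labeling \<Rightarrow> complex" where
  "gop m p v = (\<lambda>f. \<Sum>\<sigma> | \<sigma> permutes squares m. p \<sigma> * v (f \<circ> \<sigma>))"

lemma gop_sum: "gop m p (\<lambda>f. \<Sum>i\<in>I. c i * v i f) = (\<lambda>f. \<Sum>i\<in>I. c i * gop m p (v i) f)"
proof
  fix f
  have "gop m p (\<lambda>f. \<Sum>i\<in>I. c i * v i f) f
      = (\<Sum>\<sigma> | \<sigma> permutes squares m. \<Sum>i\<in>I. c i * (p \<sigma> * v i (f \<circ> \<sigma>)))"
    by (simp add: gop_def sum_distrib_left mult.left_commute)
  also have "\<dots> = (\<Sum>i\<in>I. c i * gop m p (v i) f)"
    by (subst sum.swap) (simp add: gop_def sum_distrib_left)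
  finally show "gop m p (\<lambda>f. \<Sum>i\<in>I. c i * v i f) f = (\<Sum>i\<in>I. c i * gop m p (v i) f)" .
qed

lemma gop_cong_labs:
  assumes "\<And>f. f \<in> labs U m \<Longrightarrow> v f = w f" "f \<in> labs U m"
  shows "gop m p v f = gop m p w f"
  unfolding gop_def by (rule sum.cong) (auto intro!: assms labs_comp)

lemma sum_permuters_inv:
  "(\<Sum>\<sigma> | \<sigma> permutes S. F (inv \<sigma>)) = (\<Sum>\<sigma> | \<sigma> permutes S. F \<sigma>)"
  by (rule sum.reindex_bij_witness[of _ inv inv]) (auto simp: permutes_inv permutes_inv_inv)

lemma gop_gop:
  "gop m p (gop m q v) = gop m (\<lambda>\<pi>. \<Sum>\<sigma> | \<sigma> permutes squares m. p \<sigma> * q (inv \<sigma> \<circ> \<pi>)) v"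
proof
  fix f
  let ?G = "{\<sigma>. \<sigma> permutes squares m}"
  have "gop m p (gop m q v) f = (\<Sum>\<sigma>\<in>?G. \<Sum>\<tau>\<in>?G. p \<sigma> * q \<tau> * v (f \<circ> \<sigma> \<circ> \<tau>))"
    by (simp add: gop_def sum_distrib_left mult.assoc)
  also have "\<dots> = (\<Sum>\<sigma>\<in>?G. \<Sum>\<pi>\<in>?G. p \<sigma> * q (inv \<sigma> \<circ> \<pi>) * v (f \<circ> \<pi>))"
  proof (rule sum.cong[OF refl])
    fix \<sigma> assume s: "\<sigma> \<in> ?G"
    show "(\<Sum>\<tau>\<in>?G. p \<sigma> * q \<tau> * v (f \<circ> \<sigma> \<circ> \<tau>)) = (\<Sum>\<pi>\<in>?G. p \<sigma> * q (inv \<sigma> \<circ> \<pi>) * v (f \<circ> \<pi>))"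
      using s
      by (intro sum.reindex_bij_witness[of _ "\<lambda>\<pi>. inv \<sigma> \<circ> \<pi>" "\<lambda>\<tau>. \<sigma> \<circ> \<tau>"])
         (auto simp: permutes_compose permutes_inv comp_assoc[symmetric] permutes_inv_o)
  qed
  also have "\<dots> = gop m (\<lambda>\<pi>. \<Sum>\<sigma>\<in>?G. p \<sigma> * q (inv \<sigma> \<circ> \<pi>)) v f"
    unfolding gop_def by (subst sum.swap) (simp add: sum_distrib_right)
  finally show "gop m p (gop m q v) f = gop m (\<lambda>\<pi>. \<Sum>\<sigma>\<in>?G. p \<sigma> * q (inv \<sigma> \<circ> \<pi>)) v f" .
qed

lemma gop_id: "gop m (\<lambda>\<sigma>. if \<sigma> = id then 1 else 0) v = v"
proof
  fix f
  have "gop m (\<lambda>\<sigma>. if \<sigma> = id then 1 else 0) v f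
      = (\<Sum>\<sigma> | \<sigma> permutes squares m. if \<sigma> = id then v (f \<circ> \<sigma>) else 0)"
    unfolding gop_def by (intro sum.cong) auto
  then show "gop m (\<lambda>\<sigma>. if \<sigma> = id then 1 else 0) v f = v f"
    by (simp add: sum.delta[OF finite_permuters] permutes_id)
qed

lemma gop_funpow: "\<exists>q. \<forall>v. (gop m p ^^ i) v = gop m q v"
proof (induction i)
  case 0
  show ?case using gop_id[of m] by (intro exI[of _ "\<lambda>\<sigma>. if \<sigma> = id then 1 else 0"]) simp
next
  case (Suc i)
  then obtain q where "\<And>v. (gop m p ^^ i) v = gop m q v" by blast
  then have "\<forall>v. (gop m p ^^ Suc i) v = gop m (\<lambda>\<pi>. \<Sum>\<sigma> | \<sigma> permutes squares m. p \<sigma> * q (inv \<sigma> \<circ> \<pi>)) v"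
    by (simp add: gop_gop)
  then show ?case by blast
qed

lemma gop_add_coeff:
  "gop m (\<lambda>\<sigma>. \<Sum>i\<in>I. c i * p i \<sigma>) v f = (\<Sum>i\<in>I. c i * gop m (p i) v f)"
proof -
  have "gop m (\<lambda>\<sigma>. \<Sum>i\<in>I. c i * p i \<sigma>) v f
      = (\<Sum>\<sigma> | \<sigma> permutes squares m. \<Sum>i\<in>I. c i * (p i \<sigma> * v (f \<circ> \<sigma>)))"
    by (simp add: gop_def sum_distrib_right mult.assoc)
  also have "\<dots> = (\<Sum>i\<in>I. c i * gop m (p i) v f)"
    by (subst sum.swap) (simp add: gop_def sum_distrib_left)
  finally show ?thesis .
qed

section \<open>Adjoints and the regularity of the symmetrizer\<close>

definition lab_inner :: "nat set \<Rightarrow> (nat set \<Rightarrow> nat) \<Rightarrow> (labeling \<Rightarrow> complex) \<Rightarrow> (labeling \<Rightarrow> complex) \<Rightarrow> complex" where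
  "lab_inner U m v w = (\<Sum>f\<in>labs U m. v f * cnj (w f))"

lemma sum_labs_comp:
  assumes "\<sigma> permutes squares m"
  shows "(\<Sum>f\<in>labs U m. F (f \<circ> \<sigma>)) = (\<Sum>f\<in>labs U m. F f)"
  using assms
  by (intro sum.reindex_bij_witness[of _ "\<lambda>f. f \<circ> inv \<sigma>" "\<lambda>f. f \<circ> \<sigma>"])
     (auto intro!: labs_comp simp: permutes_inv comp_assoc permutes_inv_o)

lemma gop_adjoint:
  assumes "\<And>\<sigma>. \<sigma> permutes squares m \<Longrightarrow> p (inv \<sigma>) = cnj (p \<sigma>)"
  shows "lab_inner U m (gop m p v) w = lab_inner U m v (gop m p w)"
proof -
  let ?G = "{\<sigma>. \<sigma> permutes squares m}"
  have "lab_inner U m (gop m p v) w = (\<Sum>\<sigma>\<in>?G. \<Sum>f\<in>labs U m. p \<sigma> * v (f \<circ> \<sigma>) * cnj (w f))"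
    unfolding lab_inner_def gop_def by (subst sum.swap) (simp add: sum_distrib_right)
  also have "\<dots> = (\<Sum>\<sigma>\<in>?G. \<Sum>f\<in>labs U m. p \<sigma> * v f * cnj (w (f \<circ> inv \<sigma>)))"
  proof (rule sum.cong[OF refl])
    fix \<sigma> assume "\<sigma> \<in> ?G"
    then have s: "\<sigma> permutes squares m" by simp
    show "(\<Sum>f\<in>labs U m. p \<sigma> * v (f \<circ> \<sigma>) * cnj (w f))
        = (\<Sum>f\<in>labs U m. p \<sigma> * v f * cnj (w (f \<circ> inv \<sigma>)))"
      using sum_labs_comp[OF s, of "\<lambda>f. p \<sigma> * v f * cnj (w (f \<circ> inv \<sigma>))" U]
      by (simp add: comp_assoc permutes_inv_o[OF s])
  qed
  also have "\<dots> = (\<Sum>\<sigma>\<in>?G. \<Sum>f\<in>labs U m. cnj (p (inv \<sigma>)) * v f * cnj (w (f \<circ> inv \<sigma>)))"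
    by (intro sum.cong) (auto simp: assms)
  also have "\<dots> = (\<Sum>\<sigma>\<in>?G. \<Sum>f\<in>labs U m. cnj (p \<sigma>) * v f * cnj (w (f \<circ> \<sigma>)))"
    by (rule sum_permuters_inv)
  also have "\<dots> = lab_inner U m v (gop m p w)"
    unfolding lab_inner_def gop_def
    by (subst sum.swap) (simp add: sum_distrib_left mult.assoc mult.left_commute)
  finally show ?thesis .
qed

lemma lab_inner_self_zero:
  assumes "finite U" "lab_inner U m v v = 0" "f \<in> labs U m"
  shows "v f = 0"
proof -
  have "lab_inner U m v v = complex_of_real (\<Sum>f\<in>labs U m. (cmod (v f))\<^sup>2)"
    by (simp only: lab_inner_def complex_norm_square of_real_sum)
  then have "(\<Sum>f\<in>labs U m. (cmod (v f))\<^sup>2) = 0"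
    using assms(2) by (metis of_real_eq_0_iff)
  then show ?thesis
    using assms(1,3) by (simp add: sum_nonneg_eq_0_iff finite_labs)
qed

text \<open>Gaussian elimination, one coordinate \<open>s\<close> at a time: an index
  \<open>j\<close> with \<open>F j s\<close> nonzero is the pivot, the other vectors are corrected
  by multiples of \<open>F j\<close>, and the coefficient of \<open>j\<close> is chosen last so that
  the coordinate \<open>s\<close> vanishes too.\<close>

lemma exists_linear_dependence:
  fixes F :: "'i \<Rightarrow> 'a \<Rightarrow> complex"
  assumes "finite S" "finite I" "card S < card I"
  shows "\<exists>c. (\<exists>i\<in>I. c i \<noteq> 0) \<and> (\<forall>s\<in>S. (\<Sum>i\<in>I. c i * F i s) = 0)"
  using assms
proof (induction S arbitrary: I F rule: finite_induct)
  case empty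
  then obtain i where "i \<in> I" by fastforce
  then show ?case by (intro exI[of _ "\<lambda>_. 1"]) auto
next
  case (insert s S)
  show ?case
  proof (cases "\<forall>i\<in>I. F i s = 0")
    case True
    obtain c where "\<exists>i\<in>I. c i \<noteq> 0" "\<forall>t\<in>S. (\<Sum>i\<in>I. c i * F i t) = 0"
      using insert.IH[of I F] insert.hyps insert.prems by (metis Suc_lessD card_insert_disjoint)
    with True show ?thesis by (intro exI[of _ c]) auto
  next
    case False
    then obtain j where j: "j \<in> I" "F j s \<noteq> 0" by blast
    have card: "card S < card (I - {j})"
      using insert.hyps insert.prems j by simp
    obtain c where c: "\<exists>i\<in>I-{j}. c i \<noteq> 0"
        "\<forall>t\<in>S. (\<Sum>i\<in>I-{j}. c i * (F i t - F i s / F j s * F j t)) = 0"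
      using insert.IH[of "I - {j}" "\<lambda>i t. F i t - F i s / F j s * F j t"] card insert.prems by auto
    define d where "d = c(j := - (\<Sum>i\<in>I-{j}. c i * F i s) / F j s)"
    have split: "(\<Sum>i\<in>I. d i * F i t) = (\<Sum>i\<in>I-{j}. c i * F i t) - (\<Sum>i\<in>I-{j}. c i * F i s) / F j s * F j t" for t
      using insert.prems j by (subst sum.remove[of I j]) (auto simp: d_def)
    have "(\<Sum>i\<in>I. d i * F i t) = (\<Sum>i\<in>I-{j}. c i * (F i t - F i s / F j s * F j t))" for t
      by (simp add: split right_diff_distrib sum_subtractf sum_distrib_right sum_divide_distrib mult.assoc)
    moreover have "(\<Sum>i\<in>I. d i * F i s) = 0"
      using j by (simp add: split)
    ultimately have "\<forall>t\<in>insert s S. (\<Sum>i\<in>I. d i * F i t) = 0" using c by auto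
    moreover have "\<exists>i\<in>I. d i \<noteq> 0" using c(1) by (auto simp: d_def)
    ultimately show ?thesis by blast
  qed
qed

abbreviation BA :: "(nat set \<Rightarrow> nat) \<Rightarrow> (labeling \<Rightarrow> complex) \<Rightarrow> labeling \<Rightarrow> complex" where
  "BA m v \<equiv> beta_D m (alpha_D m v)"

definition row_coeff :: "(nat set \<Rightarrow> nat) \<Rightarrow> (square \<Rightarrow> square) \<Rightarrow> complex" where
  "row_coeff m \<sigma> = (if \<sigma> \<in> row_group m then 1 / of_nat (card (row_group m)) else 0)"

definition col_coeff :: "(nat set \<Rightarrow> nat) \<Rightarrow> (square \<Rightarrow> square) \<Rightarrow> complex" where
  "col_coeff m \<sigma> = (if \<sigma> \<in> col_group m then of_int (sign \<sigma>) / of_nat (card (col_group m)) else 0)"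

lemma finite_row_group: "finite (row_group m)"
  by (rule finite_subset[OF _ finite_permuters]) (auto simp: row_group_def)

lemma finite_col_group: "finite (col_group m)"
  by (rule finite_subset[OF _ finite_permuters]) (auto simp: col_group_def)

lemma inv_in_row_group:
  assumes "\<sigma> \<in> row_group m" shows "inv \<sigma> \<in> row_group m"
proof -
  from assms have s: "\<sigma> permutes squares m" "\<And>s. sq_row (\<sigma> s) = sq_row s" by (auto simp: row_group_def)
  have "sq_row (inv \<sigma> s) = sq_row s" for s
    using s(2)[of "inv \<sigma> s"] permutes_inverses(1)[OF s(1), of s] by simp
  with s(1) show ?thesis by (simp add: row_group_def permutes_inv)
qed

lemma inv_in_col_group:
  assumes "\<sigma> \<in> col_group m" shows "inv \<sigma> \<in> col_group m"
proof -
  from assms have s: "\<sigma> permutes squares m" "\<And>s. sq_col (\<sigma> s) = sq_col s" by (auto simp: col_group_def)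
  have "sq_col (inv \<sigma> s) = sq_col s" for s
    using s(2)[of "inv \<sigma> s"] permutes_inverses(1)[OF s(1), of s] by simp
  with s(1) show ?thesis by (simp add: col_group_def permutes_inv)
qed

lemma inv_in_row_group_iff: "\<sigma> permutes squares m \<Longrightarrow> inv \<sigma> \<in> row_group m \<longleftrightarrow> \<sigma> \<in> row_group m"
  using inv_in_row_group[of \<sigma> m] inv_in_row_group[of "inv \<sigma>" m] by (auto simp: permutes_inv_inv)

lemma inv_in_col_group_iff: "\<sigma> permutes squares m \<Longrightarrow> inv \<sigma> \<in> col_group m \<longleftrightarrow> \<sigma> \<in> col_group m"
  using inv_in_col_group[of \<sigma> m] inv_in_col_group[of "inv \<sigma>" m] by (auto simp: permutes_inv_inv)

lemma permuter_permutation: "\<sigma> permutes squares m \<Longrightarrow> permutation \<sigma>"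
  using finite_squares permutation_permutes by blast

lemma row_coeff_inv: "\<sigma> permutes squares m \<Longrightarrow> row_coeff m (inv \<sigma>) = row_coeff m \<sigma>"
  by (simp add: row_coeff_def inv_in_row_group_iff)

lemma col_coeff_inv: "\<sigma> permutes squares m \<Longrightarrow> col_coeff m (inv \<sigma>) = col_coeff m \<sigma>"
  by (simp add: col_coeff_def inv_in_col_group_iff sign_inverse permuter_permutation)

lemma alpha_eq_gop: "alpha_D m = gop m (row_coeff m)"
proof (intro ext)
  fix v f
  have "gop m (row_coeff m) v f = (\<Sum>\<sigma> | \<sigma> permutes squares m. row_coeff m (inv \<sigma>) * v (f \<circ> inv \<sigma>))"
    unfolding gop_def by (rule sum_permuters_inv[symmetric])
  also have "\<dots> = (\<Sum>\<sigma> | \<sigma> permutes squares m.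
      if \<sigma> \<in> row_group m then v (f \<circ> inv \<sigma>) / of_nat (card (row_group m)) else 0)"
    by (intro sum.cong refl) (simp only: mem_Collect_eq row_coeff_inv, simp add: row_coeff_def)
  also have "\<dots> = (\<Sum>\<sigma>\<in>row_group m. v (f \<circ> inv \<sigma>) / of_nat (card (row_group m)))"
    by (subst sum.inter_restrict[OF finite_permuters, symmetric]) (intro sum.cong, auto simp: row_group_def)
  finally show "alpha_D m v f = gop m (row_coeff m) v f"
    by (simp add: alpha_D_def perm_act_def sum_divide_distrib)
qed

lemma beta_eq_gop: "beta_D m = gop m (col_coeff m)"
proof (intro ext)
  fix v f
  have "gop m (col_coeff m) v f = (\<Sum>\<sigma> | \<sigma> permutes squares m. col_coeff m (inv \<sigma>) * v (f \<circ> inv \<sigma>))"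
    unfolding gop_def by (rule sum_permuters_inv[symmetric])
  also have "\<dots> = (\<Sum>\<sigma> | \<sigma> permutes squares m.
      if \<sigma> \<in> col_group m then of_int (sign \<sigma>) * v (f \<circ> inv \<sigma>) / of_nat (card (col_group m)) else 0)"
    by (intro sum.cong refl) (simp only: mem_Collect_eq col_coeff_inv, simp add: col_coeff_def)
  also have "\<dots> = (\<Sum>\<sigma>\<in>col_group m. of_int (sign \<sigma>) * v (f \<circ> inv \<sigma>) / of_nat (card (col_group m)))"
    by (subst sum.inter_restrict[OF finite_permuters, symmetric]) (intro sum.cong, auto simp: col_group_def)
  finally show "beta_D m v f = gop m (col_coeff m) v f"
    by (simp add: beta_D_def perm_act_def sum_divide_distrib)
qed

lemma alpha_adjoint: "lab_inner U m (alpha_D m v) w = lab_inner U m v (alpha_D m w)"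
  unfolding alpha_eq_gop by (rule gop_adjoint) (simp add: row_coeff_inv, simp add: row_coeff_def)

lemma beta_adjoint: "lab_inner U m (beta_D m v) w = lab_inner U m v (beta_D m w)"
  unfolding beta_eq_gop by (rule gop_adjoint) (simp add: col_coeff_inv, simp add: col_coeff_def)

text \<open>Von Neumann regularity of \<open>u = \<beta>\<alpha>\<close> in the group algebra: with \<open>H = u\<^sup>* u\<close> self-adjoint, a
  linear dependence among the powers of \<open>H\<close> can be cancelled down to \<open>u = u r(H) H\<close>.\<close>
lemma BA_regular:
  obtains p where "\<And>U v f. finite U \<Longrightarrow> f \<in> labs U m \<Longrightarrow> BA m (gop m p (BA m v)) f = BA m v f"
proof -
  let ?G = "{\<sigma>. \<sigma> permutes squares m}"
  define H where "H v = alpha_D m (beta_D m (BA m v))" for v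
  have "\<exists>h. \<forall>v. H v = gop m h v"
    by (simp add: H_def alpha_eq_gop beta_eq_gop gop_gop) blast
  then obtain h where h: "H = gop m h" by blast
  have lin: "H (\<lambda>f. \<Sum>i\<in>I. c i * v i f) = (\<lambda>f. \<Sum>i\<in>I. c i * H (v i) f)" for I and c :: "nat \<Rightarrow> complex" and v
    unfolding h by (rule gop_sum)
  have BAlin: "BA m (\<lambda>f. \<Sum>i\<in>I. c i * v i f) = (\<lambda>f. \<Sum>i\<in>I. c i * BA m (v i) f)" for I and c :: "nat \<Rightarrow> complex" and v
    unfolding alpha_eq_gop beta_eq_gop by (simp add: gop_sum)
  obtain q where q: "\<And>i v. (H ^^ i) v = gop m (q i) v"
    using gop_funpow[where m=m and p=h] unfolding h by metis
  \<comment> \<open>The group algebra has dimension \<open>N\<close>, so \<open>N + 1\<close> powers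
    are dependent in it. A dependence of coefficients, rather than of operators on one tensor space,
    is valid for every \<open>U\<close> at once.\<close>
  define N where "N = card ?G"
  obtain c where c: "\<exists>i\<in>{..N}. c i \<noteq> 0" "\<forall>\<sigma>\<in>?G. (\<Sum>i\<in>{..N}. c i * q i \<sigma>) = 0"
    using exists_linear_dependence[of ?G "{..N}" q] finite_permuters by (auto simp: N_def)
  have rel: "(\<Sum>i\<le>N. c i * (H ^^ i) v f) = 0" for v f
  proof -
    have "(\<Sum>i\<le>N. c i * (H ^^ i) v f) = gop m (\<lambda>\<sigma>. \<Sum>i\<le>N. c i * q i \<sigma>) v f"
      by (simp add: q gop_add_coeff)
    also have "\<dots> = 0" using c(2) by (simp add: gop_def)
    finally show ?thesis .
  qed
  \<comment> \<open>The lowest nonzero coefficient: once \<open>H ^^ k\<close> is factored out, the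
    remaining polynomial in \<open>H\<close> has the invertible constant term
    \<open>c k\<close>.\<close>
  define k where "k = (LEAST i. c i \<noteq> 0)"
  have ck: "c k \<noteq> 0"
    using c(1) LeastI_ex[of "\<lambda>i. c i \<noteq> 0"] unfolding k_def by blast
  have below: "c i = 0" if "i < k" for i
    using not_less_Least[of i "\<lambda>i. c i \<noteq> 0"] that unfolding k_def by blast
  have kN: "k \<le> N" using c(1) unfolding k_def by (auto intro: Least_le order_trans)
  define R where "R v = (\<lambda>f. \<Sum>j\<le>N-k. c (k+j) * (H ^^ j) v f)" for v
  have Hlin: "(H ^^ k) (\<lambda>f. \<Sum>i\<in>I. d i * v i f) = (\<lambda>f. \<Sum>i\<in>I. d i * (H ^^ k) (v i) f)" for k I and d :: "nat \<Rightarrow> complex" and v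
    unfolding q by (rule gop_sum)
  have HkR: "(H ^^ k) (R v) = (\<lambda>f. 0)" for v
  proof
    fix f
    have "(H ^^ k) (R v) f = (\<Sum>j\<le>N-k. c (k+j) * (H ^^ (k+j)) v f)"
      by (simp add: R_def Hlin funpow_add)
    also have "\<dots> = (\<Sum>i\<in>{k..N}. c i * (H ^^ i) v f)"
      using kN by (intro sum.reindex_bij_witness[of _ "\<lambda>i. i - k" "\<lambda>j. k + j"]) auto
    also have "\<dots> = (\<Sum>i\<le>N. c i * (H ^^ i) v f)"
      by (rule sum.mono_neutral_left) (auto simp: below not_le)
    finally show "(H ^^ k) (R v) f = 0" using rel by simp
  qed
  have H_adj: "lab_inner U m (H v) w = lab_inner U m v (H w)" for U v w
    by (simp add: H_def alpha_adjoint beta_adjoint)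
  have zero_gop: "gop m p w f = 0" if "\<forall>f\<in>labs U m. w f = 0" "f \<in> labs U m" for p w U f
    using that gop_cong_labs[of U m w "\<lambda>_. 0" f p] by (simp add: gop_def)
  have cancel: "\<forall>f\<in>labs U m. H w f = 0" if "finite U" "i \<ge> 1" "\<forall>f\<in>labs U m. (H ^^ i) w f = 0" for i w U
    using that(2,3)
  proof (induction i rule: less_induct)
    case (less i)
    show ?case
    proof (cases "i = 1")
      case False
      then obtain j where j: "i = Suc (Suc j)" using less.prems(1) by (metis One_nat_def Suc_le_D not0_implies_Suc)
      let ?y = "(H ^^ j) w"
      have "lab_inner U m (H ?y) (H ?y) = lab_inner U m ((H ^^ i) w) ?y"
        by (simp add: j H_adj)
      also have "\<dots> = 0" using less.prems(2) by (simp add: lab_inner_def)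
      finally have "\<forall>f\<in>labs U m. H ?y f = 0" using lab_inner_self_zero[OF that(1)] by blast
      then show ?thesis using less.IH[of "Suc j"] j by simp
    qed (use less in simp)
  qed
  have BAR: "BA m (R v) f = 0" if U: "finite U" "f \<in> labs U m" for U v f
  proof -
    have HR: "\<forall>f\<in>labs U m. H (R v) f = 0"
    proof (cases "k = 0")
      case True
      then have "\<forall>f\<in>labs U m. R v f = 0" using HkR[of v] by simp
      then show ?thesis unfolding h using zero_gop by blast
    next
      case False
      then show ?thesis using cancel[OF U(1), of k "R v"] HkR[of v] by simp
    qed
    have "lab_inner U m (BA m (R v)) (BA m (R v)) = lab_inner U m (H (R v)) (R v)"
      by (simp add: H_def alpha_adjoint beta_adjoint)
    also have "\<dots> = 0" using HR by (simp add: lab_inner_def)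
    finally show ?thesis using lab_inner_self_zero U by blast
  qed
  \<comment> \<open>The relation \<open>BA m (R v) = 0\<close> is solved for its constant term.
    Every other term contains \<open>H v = alpha_D m (beta_D m (BA m v))\<close>, from which the
    inner \<open>BA m v\<close> is split off as the argument of \<open>C\<close>.\<close>
  define C where "C w = (\<lambda>f. \<Sum>j<N-k. (- c (k + Suc j) / c k) * (H ^^ j) (alpha_D m (beta_D m w)) f)" for w
  have "\<exists>p. \<forall>w. C w = gop m p w"
  proof -
    have "\<exists>p0. \<forall>w. alpha_D m (beta_D m w) = gop m p0 w"
      by (simp add: alpha_eq_gop beta_eq_gop gop_gop) blast
    then obtain p0 where p0: "\<And>w. alpha_D m (beta_D m w) = gop m p0 w" by blast
    define r where "r j = (\<lambda>\<pi>. \<Sum>\<sigma> | \<sigma> permutes squares m. q j \<sigma> * p0 (inv \<sigma> \<circ> \<pi>))" for j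
    have "C w f = gop m (\<lambda>\<sigma>. \<Sum>j<N-k. (- c (k + Suc j) / c k) * r j \<sigma>) w f" for w f
      unfolding gop_add_coeff by (simp add: C_def q p0 gop_gop r_def)
    then show ?thesis by blast
  qed
  then obtain p where p: "\<And>w. C w = gop m p w" by blast
  have "BA m (gop m p (BA m v)) f = BA m v f" if "finite U" "f \<in> labs U m" for U v f
  proof -
    have "0 = BA m (R v) f" using BAR[OF that] by simp
    also have "\<dots> = (\<Sum>j\<le>N-k. c (k+j) * BA m ((H ^^ j) v) f)"
      by (simp add: R_def BAlin)
    also have "\<dots> = c k * BA m v f + (\<Sum>j<N-k. c (k + Suc j) * BA m ((H ^^ Suc j) v) f)"
      by (subst sum.atMost_shift) simp
    finally have "c k * BA m v f = - (\<Sum>j<N-k. c (k + Suc j) * BA m ((H ^^ Suc j) v) f)"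
      by (simp add: eq_neg_iff_add_eq_0)
    then have "BA m v f = - (\<Sum>j<N-k. c (k + Suc j) * BA m ((H ^^ Suc j) v) f) / c k"
      using ck by (simp add: field_simps)
    also have "\<dots> = (\<Sum>j<N-k. (- c (k + Suc j) / c k) * BA m ((H ^^ j) (alpha_D m (beta_D m (BA m v)))) f)"
      by (simp add: sum_divide_distrib sum_negf[symmetric] H_def[symmetric] funpow_swap1)
    also have "\<dots> = BA m (C (BA m v)) f" unfolding C_def by (simp only: BAlin)
    finally show ?thesis by (simp add: p)
  qed
  then show ?thesis using that by blast
qed

definition delta :: "labeling \<Rightarrow> labeling \<Rightarrow> complex" where
  "delta f = (\<lambda>g. if g = f then 1 else 0)"

definition BAk :: "(nat set \<Rightarrow> nat) \<Rightarrow> labeling \<Rightarrow> labeling \<Rightarrow> complex" where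
  "BAk m g f = BA m (delta f) g"

lemma gop_kernel:
  assumes "finite U" "g \<in> labs U m"
  shows "gop m p v g = (\<Sum>f\<in>labs U m. gop m p (delta f) g * v f)"
proof -
  have "gop m p v g = gop m p (\<lambda>h. \<Sum>f\<in>labs U m. v f * delta f h) g"
    using assms by (intro gop_cong_labs[of U])
      (auto simp: delta_def if_distrib sum.delta' finite_labs cong: if_cong)
  then show ?thesis by (simp add: gop_sum mult.commute)
qed

lemma BA_kernel:
  assumes "finite U" "g \<in> labs U m"
  shows "BA m v g = (\<Sum>f\<in>labs U m. BAk m g f * v f)"
proof -
  have "\<exists>p. \<forall>v. BA m v = gop m p v"
    by (simp add: alpha_eq_gop beta_eq_gop gop_gop) blast
  then obtain p where p: "\<And>v. BA m v = gop m p v" by blast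
  show ?thesis unfolding BAk_def p by (rule gop_kernel[OF assms])
qed

lemma diag_eigen_comp: "\<sigma> permutes squares m \<Longrightarrow> diag_eigen x m (f \<circ> \<sigma>) = diag_eigen x m f"
  unfolding diag_eigen_def
  using prod.permute[of \<sigma> "squares m" "\<lambda>s. x (f s)"] by (simp add: o_def)

section \<open>The character as a trace\<close>

text \<open>Both projections fix \<open>W\<close>, and \<open>X\<close> preserves it, so Q P = P and
  P X Q = X Q. Hence tr(X P) = tr(X Q P) = tr(P X Q) = tr(X Q). This makes the arbitrary choice in
  \<open>schur_char\<close> harmless.\<close>

lemma trace_projection_unique:
  assumes P: "is_projection_onto n m P W" and Q: "is_projection_onto n m Q W"
    and X: "\<And>v. v \<in> W \<Longrightarrow> (\<lambda>f. X f * v f) \<in> W"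
  shows "(\<Sum>f\<in>labelings n m. X f * P f f) = (\<Sum>f\<in>labelings n m. X f * Q f f)"
proof -
  let ?L = "labelings n m"
  have fin: "finite ?L" by (simp add: labelings_eq_labs finite_labs)
  have fixed: "(\<Sum>h\<in>?L. R g h * v h) = v g" if "is_projection_onto n m R W" "v \<in> W" "g \<in> ?L" for R v g
  proof -
    have "v \<in> range (kernel_apply n m R)" using that by (simp add: is_projection_onto_def)
    then obtain w where "v = kernel_apply n m R w" by blast
    then have "kernel_apply n m R v = v" using that by (simp add: is_projection_onto_def)
    then show ?thesis using that(3) by (auto simp: kernel_apply_def fun_eq_iff split: if_splits)
  qed
  have col: "(\<lambda>g. if g \<in> ?L then R g f else 0) \<in> W" if "is_projection_onto n m R W" "f \<in> ?L" for R f
  proof -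
    have "kernel_apply n m R (delta f) = (\<lambda>g. if g \<in> ?L then R g f else 0)"
      using that fin by (intro ext) (simp add: kernel_apply_def delta_def if_distrib sum.delta' cong: if_cong)
    moreover have "kernel_apply n m R (delta f) \<in> W" using that by (auto simp: is_projection_onto_def)
    ultimately show ?thesis by simp
  qed
  have QP: "(\<Sum>h\<in>?L. Q g h * P h f) = P g f" if "g \<in> ?L" "f \<in> ?L" for g f
    using fixed[OF Q col[OF P that(2)] that(1)] that by simp
  have PXQ: "(\<Sum>h\<in>?L. P g h * (X h * Q h f)) = X g * Q g f" if "g \<in> ?L" "f \<in> ?L" for g f
    using fixed[OF P X[OF col[OF Q that(2)]] that(1)] that by simp
  have "(\<Sum>g\<in>?L. X g * P g g) = (\<Sum>g\<in>?L. \<Sum>h\<in>?L. X g * Q g h * P h g)"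
    by (intro sum.cong refl) (simp add: QP[symmetric] sum_distrib_left mult.assoc)
  also have "\<dots> = (\<Sum>h\<in>?L. \<Sum>g\<in>?L. P h g * (X g * Q g h))"
    by (subst sum.swap) (simp add: mult_ac)
  also have "\<dots> = (\<Sum>h\<in>?L. X h * Q h h)"
    by (intro sum.cong refl) (simp add: PXQ)
  finally show ?thesis .
qed

text \<open>With R the matrix of the representative rows, K = C R and P = K Q = C D for D = R Q.
  Since P K = K gives D C R = R, and the rows of R are independent, D C is the identity. Moving
  \<open>X\<close> past \<open>C\<close>, which only links equal weights, then reduces the trace to
  the weights of the representatives.\<close>

lemma trace_rank_factorization:
  fixes K P Q :: "'a \<Rightarrow> 'a \<Rightarrow> complex"
  assumes fin: "finite L" "finite J" and rep: "\<And>j. j \<in> J \<Longrightarrow> rep j \<in> L"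
    and PK: "\<And>g f. g \<in> L \<Longrightarrow> f \<in> L \<Longrightarrow> (\<Sum>h\<in>L. P g h * K h f) = K g f"
    and KQ: "\<And>g f. g \<in> L \<Longrightarrow> f \<in> L \<Longrightarrow> P g f = (\<Sum>h\<in>L. K g h * Q h f)"
    and span: "\<And>g f. g \<in> L \<Longrightarrow> f \<in> L \<Longrightarrow> K g f = (\<Sum>j\<in>J. C g j * K (rep j) f)"
    and weight: "\<And>g j. g \<in> L \<Longrightarrow> j \<in> J \<Longrightarrow> C g j \<noteq> 0 \<Longrightarrow> X g = X (rep j)"
    and indep: "\<And>a. (\<And>f. f \<in> L \<Longrightarrow> (\<Sum>j\<in>J. a j * K (rep j) f) = 0) \<Longrightarrow> (\<And>j. j \<in> J \<Longrightarrow> a j = 0)"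
  shows "(\<Sum>g\<in>L. X g * P g g) = (\<Sum>j\<in>J. X (rep j))"
proof -
  define D where "D j g = (\<Sum>h\<in>L. K (rep j) h * Q h g)" for j g
  have P_eq: "P g f = (\<Sum>j\<in>J. C g j * D j f)" if "g \<in> L" "f \<in> L" for g f
  proof -
    have "P g f = (\<Sum>h\<in>L. \<Sum>j\<in>J. C g j * (K (rep j) h * Q h f))"
      using that by (simp add: KQ span[of g] sum_distrib_right mult.assoc)
    then show ?thesis by (subst (asm) sum.swap) (simp add: D_def sum_distrib_left)
  qed
  have DC: "(\<Sum>g\<in>L. D i g * C g j) = (if j = i then 1 else 0)" if ij: "i \<in> J" "j \<in> J" for i j
  proof -
    have "(\<Sum>g\<in>L. D i g * C g j) - (if j = i then 1 else 0) = 0"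
    proof (rule indep[OF _ ij(2)])
      fix f assume f: "f \<in> L"
      have "(\<Sum>j\<in>J. (\<Sum>g\<in>L. D i g * C g j) * K (rep j) f) = (\<Sum>g\<in>L. D i g * (\<Sum>j\<in>J. C g j * K (rep j) f))"
        by (simp add: sum_distrib_left sum_distrib_right mult.assoc) (rule sum.swap)
      also have "\<dots> = (\<Sum>g\<in>L. P (rep i) g * K g f)"
        using f ij rep by (intro sum.cong) (simp_all add: D_def KQ span[symmetric])
      also have "\<dots> = K (rep i) f" using f ij rep by (simp add: PK)
      finally show "(\<Sum>j\<in>J. ((\<Sum>g\<in>L. D i g * C g j) - (if j = i then 1 else 0)) * K (rep j) f) = 0"
        using fin ij by (simp add: left_diff_distrib sum_subtractf if_distrib[of "\<lambda>c. c * _"] sum.delta' cong: if_cong)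
    qed
    then show ?thesis by simp
  qed
  have "(\<Sum>g\<in>L. X g * P g g) = (\<Sum>g\<in>L. \<Sum>j\<in>J. X g * (C g j * D j g))"
    by (intro sum.cong refl) (simp add: P_eq sum_distrib_left)
  also have "\<dots> = (\<Sum>g\<in>L. \<Sum>j\<in>J. X (rep j) * (D j g * C g j))"
    by (intro sum.cong refl) (use weight in \<open>auto simp: mult.commute\<close>)
  also have "\<dots> = (\<Sum>j\<in>J. X (rep j) * (\<Sum>g\<in>L. D j g * C g j))"
    by (subst sum.swap) (simp add: sum_distrib_left)
  also have "\<dots> = (\<Sum>j\<in>J. X (rep j))"
    by (intro sum.cong refl) (simp add: DC)
  finally show ?thesis .
qed

definition proj_coeff :: "(nat set \<Rightarrow> nat) \<Rightarrow> (square \<Rightarrow> square) \<Rightarrow> complex" where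
  "proj_coeff m = (SOME p. \<forall>U v f. finite U \<longrightarrow> f \<in> labs U m \<longrightarrow> BA m (gop m p (BA m v)) f = BA m v f)"

lemma proj_coeff:
  assumes "finite U" "f \<in> labs U m"
  shows "BA m (gop m (proj_coeff m) (BA m v)) f = BA m v f"
proof -
  obtain p where "\<And>U v f. finite U \<Longrightarrow> f \<in> labs U m \<Longrightarrow> BA m (gop m p (BA m v)) f = BA m v f"
    using BA_regular[of m] by blast
  then have "\<exists>p. \<forall>U v f. finite U \<longrightarrow> f \<in> labs U m \<longrightarrow> BA m (gop m p (BA m v)) f = BA m v f" by blast
  from someI_ex[OF this] show ?thesis using assms unfolding proj_coeff_def by blast
qed

definition proj_kernel :: "(nat set \<Rightarrow> nat) \<Rightarrow> labeling \<Rightarrow> labeling \<Rightarrow> complex" where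
  "proj_kernel m g f = BA m (gop m (proj_coeff m) (delta f)) g"

definition label_char :: "(nat \<Rightarrow> complex) \<Rightarrow> (nat set \<Rightarrow> nat) \<Rightarrow> nat set \<Rightarrow> complex" where
  "label_char x m U = (\<Sum>f\<in>labs U m. diag_eigen x m f * proj_kernel m f f)"

lemma BA_is_gop: "\<exists>p. \<forall>v. BA m v = gop m p v"
  by (simp add: alpha_eq_gop beta_eq_gop gop_gop) blast

lemma BA_cong_labs:
  assumes "\<And>f. f \<in> labs U m \<Longrightarrow> v f = w f" "f \<in> labs U m"
  shows "BA m v f = BA m w f"
  using BA_is_gop[of m] gop_cong_labs[of U m v w f, OF assms] by metis

lemma BA_outside:
  assumes "\<And>f. f \<notin> labs U m \<Longrightarrow> v f = 0" "f \<notin> labs U m"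
  shows "BA m v f = 0"
proof -
  obtain p where p: "\<And>v. BA m v = gop m p v" using BA_is_gop[of m] by blast
  show ?thesis unfolding p gop_def
    by (rule sum.neutral) (use assms in \<open>auto simp: labs_comp_iff\<close>)
qed

lemma proj_kernel_apply:
  assumes "finite U" "g \<in> labs U m"
  shows "(\<Sum>f\<in>labs U m. proj_kernel m g f * v f) = BA m (gop m (proj_coeff m) v) g"
proof -
  have "\<exists>p. \<forall>v. BA m (gop m (proj_coeff m) v) = gop m p v"
    by (simp add: alpha_eq_gop beta_eq_gop gop_gop) blast
  then obtain p where p: "\<And>v. BA m (gop m (proj_coeff m) v) = gop m p v" by blast
  show ?thesis unfolding proj_kernel_def p by (rule gop_kernel[OF assms, symmetric])
qed

text \<open>For u = \<open>BA m\<close> and p the chosen coefficients, u p u = u says that u p is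
  idempotent with the same image as u.\<close>

lemma proj_kernel_is_projection: "is_projection_onto n m (proj_kernel m) (schur_module n m)"
proof -
  let ?L = "labs {1..n} m"
  have ka: "kernel_apply n m (proj_kernel m) v = (\<lambda>f. if f \<in> ?L then BA m (gop m (proj_coeff m) v) f else 0)" for v
    by (auto simp: kernel_apply_def labelings_eq_labs proj_kernel_apply fun_eq_iff)
  have ts: "tensor_space n m = {v. \<forall>f. f \<notin> ?L \<longrightarrow> v f = 0}"
    by (simp add: tensor_space_def labelings_eq_labs)
  have cong: "BA m (gop m (proj_coeff m) v) f = BA m (gop m (proj_coeff m) w) f"
    if "\<And>f. f \<in> ?L \<Longrightarrow> v f = w f" "f \<in> ?L" for v w f
    by (rule BA_cong_labs[OF gop_cong_labs that(2)]) (use that in auto)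
  have idem: "kernel_apply n m (proj_kernel m) (kernel_apply n m (proj_kernel m) v) = kernel_apply n m (proj_kernel m) v" for v
    unfolding ka
  proof (rule ext)
    fix f
    show "(if f \<in> ?L then BA m (gop m (proj_coeff m) (\<lambda>f. if f \<in> ?L then BA m (gop m (proj_coeff m) v) f else 0)) f else 0)
        = (if f \<in> ?L then BA m (gop m (proj_coeff m) v) f else 0)"
      using cong[of "\<lambda>f. if f \<in> ?L then BA m (gop m (proj_coeff m) v) f else 0" "BA m (gop m (proj_coeff m) v)" f]
      by (simp add: proj_coeff[of "{1..n}"])
  qed
  have "range (kernel_apply n m (proj_kernel m)) = schur_module n m"
  proof (intro equalityI subsetI)
    fix w assume "w \<in> range (kernel_apply n m (proj_kernel m))"
    then obtain v where w: "w = (\<lambda>f. if f \<in> ?L then BA m (gop m (proj_coeff m) v) f else 0)" by (auto simp: ka)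
    define v' where "v' f = (if f \<in> ?L then gop m (proj_coeff m) v f else 0)" for f
    have "w = BA m v'"
    proof
      fix f show "w f = BA m v' f"
        using BA_cong_labs[of "{1..n}" m v' "gop m (proj_coeff m) v" f] BA_outside[of "{1..n}" m v' f]
        by (auto simp: w v'_def)
    qed
    then show "w \<in> schur_module n m" by (auto simp: schur_module_def ts v'_def)
  next
    fix w assume "w \<in> schur_module n m"
    then obtain v where v: "w = BA m v" "\<And>f. f \<notin> ?L \<Longrightarrow> v f = 0" by (auto simp: schur_module_def ts)
    have "w = kernel_apply n m (proj_kernel m) w"
    proof
      fix f
      show "w f = kernel_apply n m (proj_kernel m) w f"
        using BA_outside[of "{1..n}" m v f] v(2) proj_coeff[of "{1..n}" f m v] by (simp add: ka v(1))
    qed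
    then show "w \<in> range (kernel_apply n m (proj_kernel m))" by blast
  qed
  with idem show ?thesis by (simp add: is_projection_onto_def)
qed

lemma schur_module_diag:
  assumes "v \<in> schur_module n m"
  shows "(\<lambda>f. diag_eigen x m f * v f) \<in> schur_module n m"
proof -
  let ?L = "labs {1..n} m"
  from assms obtain w where w: "v = BA m w" "\<And>f. f \<notin> ?L \<Longrightarrow> w f = 0"
    by (auto simp: schur_module_def tensor_space_def labelings_eq_labs)
  have "(\<lambda>f. diag_eigen x m f * v f) = BA m (\<lambda>f. diag_eigen x m f * w f)"
  proof
    fix g
    obtain p where p: "\<And>v. BA m v = gop m p v" using BA_is_gop[of m] by blast
    show "diag_eigen x m g * v g = BA m (\<lambda>f. diag_eigen x m f * w f) g"
      unfolding w(1) p by (auto simp: gop_def sum_distrib_left diag_eigen_comp intro!: sum.cong)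
  qed
  moreover have "(\<lambda>f. diag_eigen x m f * w f) \<in> tensor_space n m"
    using w(2) by (simp add: tensor_space_def labelings_eq_labs)
  ultimately show ?thesis unfolding schur_module_def by blast
qed

theorem schur_char_eq_label_char: "schur_char n m x = label_char x m {1..n}"
proof -
  let ?P = "SOME P. is_projection_onto n m P (schur_module n m)"
  have "is_projection_onto n m ?P (schur_module n m)"
    by (rule someI[of "\<lambda>P. is_projection_onto n m P (schur_module n m)"]) (rule proj_kernel_is_projection)
  from trace_projection_unique[OF this proj_kernel_is_projection, of "diag_eigen x m"]
  show ?thesis
    unfolding schur_char_def Let_def label_char_def labelings_eq_labs[symmetric]
    using schur_module_diag by blast
qed

text \<open>The character can be read off from a basis of the row space of \<open>BA m\<close> whose
  expansions respect weights, without any knowledge of the projection.\<close>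

theorem label_char_basis:
  assumes fin: "finite U" "finite J" and rep: "\<And>j. j \<in> J \<Longrightarrow> rep j \<in> labs U m"
    and span: "\<And>g f. g \<in> labs U m \<Longrightarrow> f \<in> labs U m \<Longrightarrow> BAk m g f = (\<Sum>j\<in>J. C g j * BAk m (rep j) f)"
    and weight: "\<And>g j. g \<in> labs U m \<Longrightarrow> j \<in> J \<Longrightarrow> C g j \<noteq> 0 \<Longrightarrow> diag_eigen x m g = diag_eigen x m (rep j)"
    and indep: "\<And>a. (\<And>f. f \<in> labs U m \<Longrightarrow> (\<Sum>j\<in>J. a j * BAk m (rep j) f) = 0) \<Longrightarrow> (\<And>j. j \<in> J \<Longrightarrow> a j = 0)"
  shows "label_char x m U = (\<Sum>j\<in>J. diag_eigen x m (rep j))"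
  unfolding label_char_def
proof (rule trace_rank_factorization[where P = "proj_kernel m" and X = "diag_eigen x m" and L = "labs U m" and J = J
    and rep = rep and K = "BAk m" and Q = "\<lambda>h f. gop m (proj_coeff m) (delta f) h" and C = C])
  show "(\<Sum>h\<in>labs U m. proj_kernel m g h * BAk m h f) = BAk m g f" if "g \<in> labs U m" "f \<in> labs U m" for g f
    using proj_kernel_apply[OF fin(1) that(1), of "\<lambda>h. BAk m h f"] proj_coeff[OF fin(1) that(1), of "delta f"]
    by (simp add: BAk_def)
  show "proj_kernel m g f = (\<Sum>h\<in>labs U m. BAk m g h * gop m (proj_coeff m) (delta f) h)"
    if "g \<in> labs U m" "f \<in> labs U m" for g f
    using BA_kernel[OF fin(1) that(1)] by (simp add: proj_kernel_def)
qed (use assms in \<open>auto intro: finite_labs\<close>)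

text \<open>The alphabet \<open>U\<close> occurs only in the innermost sum, the trace of a single
  permutation; the coefficients in front are common to all alphabets.\<close>

theorem label_char_trace_form:
  assumes "finite U"
  shows "label_char x m U = (\<Sum>\<kappa> | \<kappa> permutes squares m. \<Sum>\<rho> | \<rho> permutes squares m. \<Sum>\<sigma> | \<sigma> permutes squares m.
    col_coeff m \<kappa> * row_coeff m \<rho> * proj_coeff m \<sigma> *
    (\<Sum>f | f \<in> labs U m \<and> f \<circ> (\<kappa> \<circ> \<rho> \<circ> \<sigma>) = f. diag_eigen x m f))"
proof -
  let ?G = "{\<sigma>. \<sigma> permutes squares m}"
  let ?c = "\<lambda>\<kappa> \<rho> \<sigma>. col_coeff m \<kappa> * row_coeff m \<rho> * proj_coeff m \<sigma>"
  have "proj_kernel m f f = (\<Sum>\<kappa>\<in>?G. \<Sum>\<rho>\<in>?G. \<Sum>\<sigma>\<in>?G. ?c \<kappa> \<rho> \<sigma> * (if f \<circ> (\<kappa> \<circ> \<rho> \<circ> \<sigma>) = f then 1 else 0))" for f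
    by (simp add: proj_kernel_def alpha_eq_gop beta_eq_gop gop_def delta_def sum_distrib_left mult.assoc comp_assoc)
  then have "label_char x m U = (\<Sum>f\<in>labs U m. \<Sum>\<kappa>\<in>?G. \<Sum>\<rho>\<in>?G. \<Sum>\<sigma>\<in>?G.
      ?c \<kappa> \<rho> \<sigma> * (if f \<circ> (\<kappa> \<circ> \<rho> \<circ> \<sigma>) = f then diag_eigen x m f else 0))"
    unfolding label_char_def
    by (auto simp: sum_distrib_left intro!: sum.cong)
  also have "\<dots> = (\<Sum>\<kappa>\<in>?G. \<Sum>\<rho>\<in>?G. \<Sum>\<sigma>\<in>?G. \<Sum>f\<in>labs U m.
      ?c \<kappa> \<rho> \<sigma> * (if f \<circ> (\<kappa> \<circ> \<rho> \<circ> \<sigma>) = f then diag_eigen x m f else 0))"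
    apply (subst sum.swap, rule sum.cong[OF refl])
    apply (subst sum.swap, rule sum.cong[OF refl])
    by (subst sum.swap, rule sum.cong[OF refl]) simp
  also have "\<dots> = (\<Sum>\<kappa>\<in>?G. \<Sum>\<rho>\<in>?G. \<Sum>\<sigma>\<in>?G. ?c \<kappa> \<rho> \<sigma> *
      (\<Sum>f | f \<in> labs U m \<and> f \<circ> (\<kappa> \<circ> \<rho> \<circ> \<sigma>) = f. diag_eigen x m f))"
  proof (intro sum.cong refl)
    fix \<kappa> \<rho> \<sigma> :: "square \<Rightarrow> square"
    have "{f. f \<in> labs U m \<and> f \<circ> (\<kappa> \<circ> \<rho> \<circ> \<sigma>) = f} = {f\<in>labs U m. f \<circ> (\<kappa> \<circ> \<rho> \<circ> \<sigma>) = f}" by simp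
    then show "(\<Sum>f\<in>labs U m. ?c \<kappa> \<rho> \<sigma> * (if f \<circ> (\<kappa> \<circ> \<rho> \<circ> \<sigma>) = f then diag_eigen x m f else 0))
       = ?c \<kappa> \<rho> \<sigma> * (\<Sum>f | f \<in> labs U m \<and> f \<circ> (\<kappa> \<circ> \<rho> \<circ> \<sigma>) = f. diag_eigen x m f)"
      by (simp add: sum_distrib_left[symmetric] sum.inter_filter[symmetric] finite_labs assms)
  qed
  finally show ?thesis .
qed

section \<open>Reduction to three letters\<close>

lemma sign_on_insert_fixed: "f b = b \<Longrightarrow> sign_on (insert b A) f = sign_on A f"
proof -
  assume "f b = b"
  then have "restrict_id f (insert b A) = restrict_id f A" by (auto simp: restrict_id_def)
  then show ?thesis by (simp add: sign_on_def)
qed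

lemma permutes_stable_bij: "p permutes S \<Longrightarrow> p ` A = A \<Longrightarrow> bij_betw p A A"
  by (metis bij_betw_def inj_on_subset permutes_inj subset_UNIV)

text \<open>A stable set is a union of cycles, and a cycle of length l contributes (-1)^l times its
  sign (-1)^(l-1), that is -1; the sum is therefore a product of factors 1 - 1. In place of a cycle
  decomposition, the induction toggles a point \<open>b\<close> if it is fixed and otherwise cuts it
  out of its cycle.\<close>

lemma stable_sets_signed_sum:
  fixes p :: "'a \<Rightarrow> 'a"
  assumes "finite S" "p permutes S" "B \<subseteq> S" "p ` B = B" "B \<noteq> {}"
  shows "(\<Sum>A | A \<subseteq> B \<and> p ` A = A. (-1) ^ card A * sign_on A p) = 0"
  using assms(2-)
proof (induction "card B" arbitrary: p B rule: less_induct)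
  case less
  note p = less.prems(1) and BS = less.prems(2) and pB = less.prems(3)
  have finB: "finite B" using BS assms(1) by (rule finite_subset)
  have inj: "inj p" using p by (rule permutes_inj)
  obtain b where b: "b \<in> B" using less.prems(4) by blast
  show ?case
  proof (cases "p b = b")
    case True
    let ?N = "{A. A \<subseteq> B \<and> p ` A = A \<and> b \<notin> A}" and ?Y = "{A. A \<subseteq> B \<and> p ` A = A \<and> b \<in> A}"
    have fin: "finite ?N" "finite ?Y" by (rule finite_subset[of _ "Pow B"]; use finB in auto)+
    have "{A. A \<subseteq> B \<and> p ` A = A} = ?N \<union> ?Y" by auto
    then have "(\<Sum>A | A \<subseteq> B \<and> p ` A = A. (-1) ^ card A * sign_on A p)
        = (\<Sum>A\<in>?N. (-1) ^ card A * sign_on A p) + (\<Sum>A\<in>?Y. (-1) ^ card A * sign_on A p)"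
      using fin by (simp add: sum.union_disjoint disjoint_iff)
    also have "(\<Sum>A\<in>?Y. (-1) ^ card A * sign_on A p) = (\<Sum>A\<in>?N. - ((-1) ^ card A * sign_on A p))"
    proof (rule sum.reindex_bij_witness[of _ "insert b" "\<lambda>A. A - {b}"])
      fix A assume "A \<in> ?Y"
      then have A: "A \<subseteq> B" "p ` A = A" "b \<in> A" by auto
      have "p ` (A - {b}) = A - {b}" using A True inj by (simp add: image_set_diff)
      then show "A - {b} \<in> ?N" using A by auto
      have "finite A" using A finB finite_subset by blast
      then have card_A: "card A = Suc (card (A - {b}))" using A(3) by (rule card.remove)
      have "sign_on A p = sign_on (A - {b}) p"
        using sign_on_insert_fixed[of p b "A - {b}"] True A by (simp add: insert_absorb)
      then show "- ((-1) ^ card (A - {b}) * sign_on (A - {b}) p) = (-1) ^ card A * sign_on A p"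
        unfolding card_A by simp
    qed (use b True in auto)
    finally show ?thesis by (simp add: sum_negf)
  next
    case False
    \<comment> \<open>\<open>q\<close> fixes \<open>b\<close> and sends the former preimage of
      \<open>b\<close> directly to \<open>p b\<close>. A stable set containing \<open>b\<close>
      loses one element, while its permutation changes by one transposition, so the two signs
      compensate.\<close>
    define q where "q = transpose b (p b) \<circ> p"
    have bS: "b \<in> S" "p b \<in> S" "p b \<in> B" using b BS pB by auto
    have q: "q permutes S"
      unfolding q_def using p bS by (intro permutes_compose permutes_swap_id)
    have qb: "q b = b" by (simp add: q_def)
    have injq: "inj q" using q by (rule permutes_inj)
    have q_other: "q s = p s" if "p s \<noteq> b" "s \<noteq> b" for s
      using that inj by (auto simp: q_def transpose_def inj_eq)
    have q_pre: "q s = p b" if "p s = b" for s using that by (simp add: q_def)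
    have both: "q ` A = A" if "p ` A = A" "b \<in> A" for A
    proof -
      have "p b \<in> A" using that by auto
      then have "transpose b (p b) ` A = A" using that(2) by (auto simp: transpose_image_eq)
      then show ?thesis using that(1) by (simp only: q_def image_comp[symmetric])
    qed
    have without: "q s = p s" if "p ` A = A" "b \<notin> A" "s \<in> A" for A s
      using that by (intro q_other) auto
    have "card (B - {b}) < card B" using finB b by (rule card_Diff1_less)
    moreover have "q ` (B - {b}) = B - {b}"
      using both[OF pB b] qb injq by (simp add: image_set_diff)
    moreover have "B - {b} \<noteq> {}" using bS(3) False by blast
    ultimately have IH: "(\<Sum>A | A \<subseteq> B - {b} \<and> q ` A = A. (-1) ^ card A * sign_on A q) = 0"
      using less.hyps[of "B - {b}" q] q BS by blast
    have "(\<Sum>A | A \<subseteq> B \<and> p ` A = A. (-1) ^ card A * sign_on A p)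
        = (\<Sum>A | A \<subseteq> B - {b} \<and> q ` A = A. (-1) ^ card A * sign_on A q)"
    \<comment> \<open>A \<open>p\<close>-stable set contains \<open>b\<close> exactly if it contains
      \<open>p b\<close>; this decides whether \<open>b\<close> has to be put back.\<close>
    proof (rule sum.reindex_bij_witness[of _ "\<lambda>A. if p b \<in> A then insert b A else A" "\<lambda>A. A - {b}"])
      fix A assume "A \<in> {A. A \<subseteq> B \<and> p ` A = A}"
      then have A: "A \<subseteq> B" "p ` A = A" by auto
      have finA: "finite A" using A finB finite_subset by blast
      show "(if p b \<in> A - {b} then insert b (A - {b}) else A - {b}) = A"
        using inj_image_mem_iff[OF inj, of b A] A(2) False by auto
      show "A - {b} \<in> {A. A \<subseteq> B - {b} \<and> q ` A = A}"
      proof (cases "b \<in> A")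
        case True
        then have "q ` (A - {b}) = A - {b}" using both[OF A(2)] qb injq by (simp add: image_set_diff)
        then show ?thesis using A by auto
      next
        case False
        then have "q ` A = A" using without[OF A(2)] A(2) by (metis image_cong)
        then show ?thesis using A False by auto
      qed
      show "(-1) ^ card (A - {b}) * sign_on (A - {b}) q = (-1) ^ card A * sign_on A p"
      proof (cases "b \<in> A")
        case True
        then have pb: "p b \<in> A" using A by auto
        have "sign_on (A - {b}) q = sign_on A q"
          using sign_on_insert_fixed[of q b "A - {b}"] qb True by (simp add: insert_absorb)
        also have "\<dots> = sign_on A (transpose b (p b)) * sign_on A p"
          unfolding q_def
        proof (rule sign_on_compose)
          show "bij_betw (transpose b (p b)) A A"
            using True pb by (auto simp: bij_betw_def transpose_image_eq)
        qed (use finA permutes_stable_bij[OF p A(2)] in auto)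
        also have "\<dots> = - sign_on A p" using sign_on_transpose[OF True pb] False by simp
        finally show ?thesis using card.remove[OF finA True] by simp
      next
        case False
        then have "sign_on A q = sign_on A p" using without[OF A(2)] by (intro sign_on_cong) auto
        then show ?thesis using False by simp
      qed
    next
      fix A assume "A \<in> {A. A \<subseteq> B - {b} \<and> q ` A = A}"
      then have A: "A \<subseteq> B" "b \<notin> A" "q ` A = A" by auto
      show "(if p b \<in> A then insert b A else A) - {b} = A" using A by auto
      have p_q: "p = transpose b (p b) \<circ> q" by (simp add: q_def comp_assoc[symmetric])
      show "(if p b \<in> A then insert b A else A) \<in> {A. A \<subseteq> B \<and> p ` A = A}"
      proof (cases "p b \<in> A")
        case True
        have "q ` insert b A = insert b A" using A qb by simp
        moreover have "transpose b (p b) ` insert b A = insert b A"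
          by (rule permutes_image, rule permutes_swap_id) (use True in auto)
        ultimately have "p ` insert b A = insert b A" by (subst p_q) (metis image_comp)
        then show ?thesis using True A b by auto
      next
        case False
        have "transpose b (p b) ` A = A" using False A(2) by (auto simp: transpose_image_eq)
        then have "p ` A = A" using A(3) by (subst p_q) (metis image_comp)
        then show ?thesis using False A by auto
      qed
    qed
    then show ?thesis using IH by simp
  qed
qed

text \<open>The set \<open>S\<close> is arbitrary because the squares left over by the odd letter
  need not form a set \<open>squares m\<close>.\<close>

definition flabs :: "nat set \<Rightarrow> 'a set \<Rightarrow> ('a \<Rightarrow> nat) set" where
  "flabs U S = {f. (\<forall>s\<in>S. f s \<in> U) \<and> (\<forall>s. s \<notin> S \<longrightarrow> f s = 0)}"

lemma finite_flabs: "finite U \<Longrightarrow> finite S \<Longrightarrow> finite (flabs U S)"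
  using finite_set_of_finite_funs[of S U 0] by (rule finite_subset[rotated]) (auto simp: flabs_def)

text \<open>For \<open>p\<close> stabilising \<open>S\<close>, the trace of \<open>p\<close> times
  the diagonal matrix \<open>x\<close> on the tensors over \<open>S\<close>.\<close>

definition fixsum :: "(nat \<Rightarrow> complex) \<Rightarrow> nat set \<Rightarrow> 'a set \<Rightarrow> ('a \<Rightarrow> 'a) \<Rightarrow> complex" where
  "fixsum x U S p = (\<Sum>f | f \<in> flabs U S \<and> (\<forall>s\<in>S. f (p s) = f s). \<Prod>s\<in>S. x (f s))"

text \<open>The character of \<open>p\<close> on the super vector space with even part \<open>\<complex>\<^sup>U\<close> and one odd letter of weight \<open>-t\<close>.\<close>
definition super_fixsum :: "(nat \<Rightarrow> complex) \<Rightarrow> nat set \<Rightarrow> 'a set \<Rightarrow> complex \<Rightarrow> ('a \<Rightarrow> 'a) \<Rightarrow> complex" where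
  "super_fixsum x U S t p =
     (\<Sum>A | A \<subseteq> S \<and> p ` A = A. (- t) ^ card A * of_int (sign_on A p) * fixsum x U (S - A) p)"

text \<open>Filling \<open>A\<close> with the letter \<open>i\<close> turns each term into a
  labeling of all of \<open>S\<close>. A labeling \<open>f\<close> is then counted once, with a
  sign, for every stable set of squares on which it equals \<open>i\<close>; by
  \<open>stable_sets_signed_sum\<close> only the labelings avoiding \<open>i\<close>
  survive.\<close>

lemma super_fixsum_cancel:
  assumes S: "finite S" and p: "p permutes S" and U: "finite U" "i \<in> U"
  shows "super_fixsum x U S (x i) p = fixsum x (U - {i}) S p"
proof -
  let ?A = "{A. A \<subseteq> S \<and> p ` A = A}"
  let ?F = "{f \<in> flabs U S. \<forall>s\<in>S. f (p s) = f s}"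
  have finA: "finite ?A" by (rule finite_subset[of _ "Pow S"]) (use S in auto)
  have finF: "finite ?F" using finite_flabs[OF U(1) S] by simp
  have pS: "p s \<in> S \<longleftrightarrow> s \<in> S" for s using p by (rule permutes_in_image)
  have term_eq: "(- x i) ^ card A * of_int (sign_on A p) * fixsum x U (S - A) p
      = (\<Sum>f\<in>?F. if \<forall>s\<in>A. f s = i then of_int ((-1) ^ card A * sign_on A p) * (\<Prod>s\<in>S. x (f s)) else 0)"
    if "A \<in> ?A" for A
  proof -
    from that have A: "A \<subseteq> S" "p ` A = A" by auto
    have finA: "finite A" using A S finite_subset by blast
    have pA: "p s \<in> A \<longleftrightarrow> s \<in> A" for s
      using A(2) inj_image_mem_iff[OF permutes_inj[OF p], of s A] by simp
    have "(- x i) ^ card A * of_int (sign_on A p) * fixsum x U (S - A) p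
      = (\<Sum>f | f \<in> flabs U (S - A) \<and> (\<forall>s\<in>S - A. f (p s) = f s).
          (- x i) ^ card A * of_int (sign_on A p) * (\<Prod>s\<in>S - A. x (f s)))"
      by (simp add: fixsum_def sum_distrib_left)
    also have "\<dots> = (\<Sum>f\<in>{f\<in>?F. \<forall>s\<in>A. f s = i}. of_int ((-1) ^ card A * sign_on A p) * (\<Prod>s\<in>S. x (f s)))"
    proof (rule sum.reindex_bij_witness[of _ "\<lambda>f s. if s \<in> A then 0 else f s" "\<lambda>f s. if s \<in> A then i else f s"])
      fix f assume "f \<in> {f. f \<in> flabs U (S - A) \<and> (\<forall>s\<in>S - A. f (p s) = f s)}"
      then have f: "f \<in> flabs U (S - A)" "\<And>s. s \<in> S - A \<Longrightarrow> f (p s) = f s" by auto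
      show "(\<lambda>s. if s \<in> A then 0 else if s \<in> A then i else f s) = f"
        using f by (auto simp: flabs_def)
      show "(\<lambda>s. if s \<in> A then i else f s) \<in> {f\<in>?F. \<forall>s\<in>A. f s = i}"
        using f A U by (auto simp: flabs_def pA)
      have "(\<Prod>s\<in>S. x (if s \<in> A then i else f s))
          = (\<Prod>s\<in>S-A. x (if s \<in> A then i else f s)) * (\<Prod>s\<in>A. x (if s \<in> A then i else f s))"
        by (rule prod.subset_diff[OF A(1) S])
      also have "\<dots> = (\<Prod>s\<in>S-A. x (f s)) * x i ^ card A"
        by simp
      finally show "of_int ((-1) ^ card A * sign_on A p) * (\<Prod>s\<in>S. x (if s \<in> A then i else f s))
          = (- x i) ^ card A * of_int (sign_on A p) * (\<Prod>s\<in>S - A. x (f s))"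
        by (simp add: power_minus[of "x i"])
    next
      fix f assume "f \<in> {f\<in>?F. \<forall>s\<in>A. f s = i}"
      then have f: "f \<in> flabs U S" "\<And>s. s \<in> S \<Longrightarrow> f (p s) = f s" "\<And>s. s \<in> A \<Longrightarrow> f s = i" by auto
      show "(\<lambda>s. if s \<in> A then i else if s \<in> A then 0 else f s) = f" using f by auto
      show "(\<lambda>s. if s \<in> A then 0 else f s) \<in> {f. f \<in> flabs U (S - A) \<and> (\<forall>s\<in>S - A. f (p s) = f s)}"
        using f A by (auto simp: flabs_def pA)
    qed
    also have "\<dots> = (\<Sum>f\<in>?F. if \<forall>s\<in>A. f s = i then of_int ((-1) ^ card A * sign_on A p) * (\<Prod>s\<in>S. x (f s)) else 0)"
      by (rule sum.inter_filter[OF finF])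
    finally show ?thesis .
  qed
  have "super_fixsum x U S (x i) p = (\<Sum>A\<in>?A. \<Sum>f\<in>?F. if \<forall>s\<in>A. f s = i
      then of_int ((-1) ^ card A * sign_on A p) * (\<Prod>s\<in>S. x (f s)) else 0)"
    unfolding super_fixsum_def by (intro sum.cong refl term_eq)
  also have "\<dots> = (\<Sum>f\<in>?F. \<Sum>A\<in>?A. if \<forall>s\<in>A. f s = i
      then of_int ((-1) ^ card A * sign_on A p) * (\<Prod>s\<in>S. x (f s)) else 0)"
    by (rule sum.swap)
  also have "\<dots> = (\<Sum>f\<in>?F. if f \<in> flabs (U - {i}) S then \<Prod>s\<in>S. x (f s) else 0)"
  proof (rule sum.cong[OF refl])
    fix f assume f: "f \<in> ?F"
    define B where "B = {s\<in>S. f s = i}"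
    have pB: "p ` B = B"
    proof (rule card_subset_eq)
      show "finite B" using S by (simp add: B_def)
      show "p ` B \<subseteq> B" using f pS by (auto simp: B_def)
      show "card (p ` B) = card B" using permutes_inj[OF p] by (intro card_image) (auto intro: inj_on_subset)
    qed
    have BS: "B \<subseteq> S" by (auto simp: B_def)
    have "(\<Sum>A\<in>?A. if \<forall>s\<in>A. f s = i then of_int ((-1) ^ card A * sign_on A p) * (\<Prod>s\<in>S. x (f s)) else 0)
        = (\<Sum>A\<in>{A\<in>?A. \<forall>s\<in>A. f s = i}. of_int ((-1) ^ card A * sign_on A p) * (\<Prod>s\<in>S. x (f s)))"
      by (rule sum.inter_filter[OF finA, symmetric])
    also have "{A\<in>?A. \<forall>s\<in>A. f s = i} = {A. A \<subseteq> B \<and> p ` A = A}" by (auto simp: B_def)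
    also have "(\<Sum>A | A \<subseteq> B \<and> p ` A = A. of_int ((-1) ^ card A * sign_on A p) * (\<Prod>s\<in>S. x (f s)))
        = of_int (\<Sum>A | A \<subseteq> B \<and> p ` A = A. (-1) ^ card A * sign_on A p) * (\<Prod>s\<in>S. x (f s))"
      by (simp add: sum_distrib_right)
    also have "(\<Sum>A | A \<subseteq> B \<and> p ` A = A. (-1) ^ card A * sign_on A p) = (if B = {} then 1 else 0)"
    proof (cases "B = {}")
      case True
      then have "{A. A \<subseteq> B \<and> p ` A = A} = {{}}" by auto
      then show ?thesis using True by (simp add: sign_on_def restrict_id_def)
    next
      case False
      then show ?thesis using stable_sets_signed_sum[OF S p BS pB] by simp
    qed
    also have "B = {} \<longleftrightarrow> f \<in> flabs (U - {i}) S" using f by (auto simp: B_def flabs_def)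
    finally show "(\<Sum>A\<in>?A. if \<forall>s\<in>A. f s = i then of_int ((-1) ^ card A * sign_on A p) * (\<Prod>s\<in>S. x (f s)) else 0)
        = (if f \<in> flabs (U - {i}) S then \<Prod>s\<in>S. x (f s) else 0)"
      by simp
  qed
  also have "\<dots> = (\<Sum>f\<in>{f\<in>?F. f \<in> flabs (U - {i}) S}. \<Prod>s\<in>S. x (f s))"
    by (rule sum.inter_filter[OF finF, symmetric])
  also have "{f\<in>?F. f \<in> flabs (U - {i}) S} = {f. f \<in> flabs (U - {i}) S \<and> (\<forall>s\<in>S. f (p s) = f s)}"
    by (auto simp: flabs_def)
  finally show ?thesis by (simp add: fixsum_def)
qed

section \<open>Deleting letters by interpolation\<close>

lemma lagrange_at_zero:
  fixes x :: "'i \<Rightarrow> complex" and q :: "complex poly"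
  assumes U: "finite U" "inj_on x U" and deg: "degree q < card U"
  shows "(\<Sum>i\<in>U. poly q (x i) * (\<Prod>l\<in>U-{i}. x l / (x l - x i))) = poly q 0"
proof -
  define r where "r = (\<Sum>i\<in>U. smult (poly q (x i) / (\<Prod>l\<in>U-{i}. x l - x i)) (\<Prod>l\<in>U-{i}. [:x l, -1:]))"
  have poly_r: "poly r t = (\<Sum>i\<in>U. poly q (x i) * (\<Prod>l\<in>U-{i}. (x l - t) / (x l - x i)))" for t
    by (simp add: r_def poly_sum poly_prod prod_dividef)
  have "q = r"
  proof (rule poly_eqI_degree)
    fix y assume "y \<in> x ` U"
    then obtain j where j: "j \<in> U" "y = x j" by blast
    have "poly r (x j) = (\<Sum>i\<in>U. if i = j then poly q (x j) else 0)"
      unfolding poly_r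
    proof (intro sum.cong refl)
      fix i assume i: "i \<in> U"
      show "poly q (x i) * (\<Prod>l\<in>U-{i}. (x l - x j) / (x l - x i)) = (if i = j then poly q (x j) else 0)"
      proof (cases "i = j")
        case True
        have "(\<Prod>l\<in>U-{i}. (x l - x j) / (x l - x i)) = 1"
          using U j True by (intro prod.neutral) (auto simp: inj_on_def)
        then show ?thesis using True by simp
      next
        case False
        then have "(\<Prod>l\<in>U-{i}. (x l - x j) / (x l - x i)) = 0"
          using U j by (intro prod_zero) auto
        then show ?thesis using False by simp
      qed
    qed
    then show "poly q y = poly r y" using U j by simp
  next
    show "degree q < card (x ` U)" using U deg by (simp add: card_image)
    have "degree r \<le> card U - 1"
      unfolding r_def
    proof (intro degree_sum_le U order_trans[OF degree_smult_le])
      fix i assume i: "i \<in> U"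
      have "degree (\<Prod>l\<in>U-{i}. [:x l, -1:]) \<le> (\<Sum>l\<in>U-{i}. degree [:x l, -1:])"
        using degree_prod_sum_le[of "U - {i}" "\<lambda>l. [:x l, -1:]"] U by (simp add: o_def)
      then show "degree (\<Prod>l\<in>U-{i}. [:x l, -1:]) \<le> card U - 1" using U i by simp
    qed
    moreover have "card U > 0" using deg by simp
    ultimately show "degree r < card (x ` U)" using U by (simp add: card_image)
  qed
  then have "poly q 0 = poly r 0" by simp
  then show ?thesis unfolding poly_r by simp
qed

lemma labs_eq_flabs: "labs U m = flabs U (squares m)"
  by (simp add: labs_def flabs_def)

lemma label_char_fixsum:
  assumes "finite U"
  shows "label_char x m U = (\<Sum>\<kappa> | \<kappa> permutes squares m. \<Sum>\<rho> | \<rho> permutes squares m. \<Sum>\<sigma> | \<sigma> permutes squares m.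
    col_coeff m \<kappa> * row_coeff m \<rho> * proj_coeff m \<sigma> * fixsum x U (squares m) (\<kappa> \<circ> \<rho> \<circ> \<sigma>))"
  unfolding label_char_trace_form[OF assms]
proof (intro sum.cong refl)
  fix \<kappa> \<rho> \<sigma>
  assume k: "\<kappa> \<in> {\<kappa>. \<kappa> permutes squares m}" "\<rho> \<in> {\<kappa>. \<kappa> permutes squares m}" "\<sigma> \<in> {\<kappa>. \<kappa> permutes squares m}"
  define p where "p = \<kappa> \<circ> \<rho> \<circ> \<sigma>"
  have p: "p permutes squares m" using k unfolding p_def by (simp add: permutes_compose)
  have "f \<circ> p = f \<longleftrightarrow> (\<forall>s\<in>squares m. f (p s) = f s)" for f :: labeling
    using permutes_not_in[OF p] by (metis comp_apply ext)
  then have "(\<Sum>f | f \<in> labs U m \<and> f \<circ> p = f. diag_eigen x m f) = fixsum x U (squares m) p"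
    by (simp add: fixsum_def labs_eq_flabs diag_eigen_def)
  then show "col_coeff m \<kappa> * row_coeff m \<rho> * proj_coeff m \<sigma> *
      (\<Sum>f | f \<in> labs U m \<and> f \<circ> (\<kappa> \<circ> \<rho> \<circ> \<sigma>) = f. diag_eigen x m f) =
      col_coeff m \<kappa> * row_coeff m \<rho> * proj_coeff m \<sigma> * fixsum x U (squares m) (\<kappa> \<circ> \<rho> \<circ> \<sigma>)"
    unfolding p_def by simp
qed

text \<open>Extended by 0 to sets that are not stable, so that the sum over \<open>A\<close> has the
  same range for all permutations and can be exchanged with the sums over the group.\<close>

definition stable_term :: "(nat \<Rightarrow> complex) \<Rightarrow> nat set \<Rightarrow> 'a set \<Rightarrow> 'a set \<Rightarrow> ('a \<Rightarrow> 'a) \<Rightarrow> complex" where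
  "stable_term x U S A p = (if p ` A = A then of_int (sign_on A p) * fixsum x U (S - A) p else 0)"

lemma super_fixsum_stable_term:
  assumes "finite S"
  shows "super_fixsum x U S t p = (\<Sum>A\<in>Pow S. (- t) ^ card A * stable_term x U S A p)"
proof -
  have "{A. A \<subseteq> S \<and> p ` A = A} = {A\<in>Pow S. p ` A = A}" by auto
  then have "super_fixsum x U S t p = (\<Sum>A\<in>Pow S. if p ` A = A
      then (- t) ^ card A * of_int (sign_on A p) * fixsum x U (S - A) p else 0)"
    unfolding super_fixsum_def using assms by (simp only: sum.inter_filter[OF finite_Pow_iff[THEN iffD2]])
  also have "\<dots> = (\<Sum>A\<in>Pow S. (- t) ^ card A * stable_term x U S A p)"
    by (intro sum.cong) (auto simp: stable_term_def mult.assoc)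
  finally show ?thesis .
qed

text \<open>The odd letter occurs at most once in each row: transposing two odd squares of a row flips the sign.\<close>
lemma row_sum_stable_term_zero:
  assumes A: "A \<subseteq> squares m" "card A \<ge> 4"
    and k: "\<kappa> permutes squares m" "\<sigma> permutes squares m"
  shows "(\<Sum>\<rho>\<in>row_group m. stable_term x U (squares m) A (\<kappa> \<circ> \<rho> \<circ> \<sigma>)) = 0"
proof -
  let ?S = "squares m"
  have finA: "finite A" using A finite_squares finite_subset by blast
  have inj_s: "inj \<sigma>" using k(2) by (rule permutes_inj)
  have "sq_row ` \<sigma> ` A \<subseteq> {1,2,3}"
  proof
    fix r assume "r \<in> sq_row ` \<sigma> ` A"
    then obtain s where "s \<in> ?S" "r = sq_row s" using A permutes_in_image[OF k(2)] by blast
    then show "r \<in> {1,2,3}" by (auto simp: squares_def sq_row_def Subs_def)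
  qed
  then have "card (sq_row ` \<sigma> ` A) \<le> 3" using card_mono[of "{1,2,3::nat}" "sq_row ` \<sigma> ` A"] by simp
  moreover have "card (\<sigma> ` A) = card A" using inj_s by (simp add: card_image inj_on_subset)
  ultimately have "\<not> inj_on sq_row (\<sigma> ` A)" using A(2) by (auto dest: card_image)
  then obtain y y' where "y \<in> \<sigma> ` A" "y' \<in> \<sigma> ` A" "y \<noteq> y'" "sq_row y = sq_row y'"
    unfolding inj_on_def by blast
  then obtain s s' where s: "s \<in> A" "s' \<in> A" "s \<noteq> s'" "sq_row (\<sigma> s) = sq_row (\<sigma> s')" by blast
  \<comment> \<open>Multiplication by \<open>\<tau>\<close> permutes the row group and hence the
    summands. Moved across \<open>\<sigma>\<close> it becomes \<open>\<tau>'\<close>, which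
    exchanges two squares of \<open>A\<close>: the stable set and the even part stay, the sign on
    \<open>A\<close> flips.\<close>
  define \<tau> where "\<tau> = transpose (\<sigma> s) (\<sigma> s')"
  define \<tau>' where "\<tau>' = transpose s s'"
  have tau: "\<tau> \<circ> \<sigma> = \<sigma> \<circ> \<tau>'"
    unfolding \<tau>_def \<tau>'_def using inj_s by (auto simp: fun_eq_iff transpose_def inj_eq)
  have tS: "\<tau> permutes ?S" unfolding \<tau>_def
    using s A permutes_in_image[OF k(2)] by (intro permutes_swap_id) auto
  have tR: "\<rho> \<circ> \<tau> \<in> row_group m" if "\<rho> \<in> row_group m" for \<rho>
  proof -
    have "sq_row (\<tau> z) = sq_row z" for z using s(4) by (simp add: \<tau>_def transpose_def)
    then show ?thesis using that permutes_compose[OF tS] by (simp add: row_group_def del: split_paired_All)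
  qed
  have tt: "\<rho> \<circ> \<tau> \<circ> \<tau> = \<rho>" for \<rho> :: "square \<Rightarrow> square"
    by (simp add: \<tau>_def comp_assoc)
  have tA: "\<tau>' ` A = A" unfolding \<tau>'_def using s by (intro permutes_image permutes_swap_id)
  have flip: "stable_term x U ?S A (\<kappa> \<circ> (\<rho> \<circ> \<tau>) \<circ> \<sigma>) = - stable_term x U ?S A (\<kappa> \<circ> \<rho> \<circ> \<sigma>)"
    if r: "\<rho> \<in> row_group m" for \<rho>
  proof -
    define p where "p = \<kappa> \<circ> \<rho> \<circ> \<sigma>"
    have p: "p permutes ?S" using k r unfolding p_def row_group_def by (auto intro: permutes_compose)
    have q: "\<kappa> \<circ> (\<rho> \<circ> \<tau>) \<circ> \<sigma> = p \<circ> \<tau>'" unfolding p_def using tau by (simp add: comp_assoc)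
    have im: "(p \<circ> \<tau>') ` A = p ` A" using tA by (simp only: image_comp[symmetric])
    have fx: "fixsum x U (?S - A) (p \<circ> \<tau>') = fixsum x U (?S - A) p"
    proof -
      have "\<tau>' z = z" if "z \<notin> A" for z using that s by (auto simp: \<tau>'_def transpose_def)
      then show ?thesis by (simp add: fixsum_def)
    qed
    have "sign_on A (p \<circ> \<tau>') = - sign_on A p" if pA: "p ` A = A"
    proof -
      have "sign_on A (p \<circ> \<tau>') = sign_on A p * sign_on A \<tau>'"
        using tA by (intro sign_on_compose permutes_stable_bij[OF p pA] finA) (auto simp: bij_betw_def \<tau>'_def)
      then show ?thesis using sign_on_transpose[OF s(1,2,3)] by (simp add: \<tau>'_def)
    qed
    then have "stable_term x U ?S A (p \<circ> \<tau>') = - stable_term x U ?S A p"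
      unfolding stable_term_def im fx by simp
    then show ?thesis unfolding q p_def .
  qed
  have "(\<Sum>\<rho>\<in>row_group m. stable_term x U ?S A (\<kappa> \<circ> \<rho> \<circ> \<sigma>))
      = (\<Sum>\<rho>\<in>row_group m. stable_term x U ?S A (\<kappa> \<circ> (\<rho> \<circ> \<tau>) \<circ> \<sigma>))"
    by (rule sum.reindex_bij_witness[of _ "\<lambda>\<rho>. \<rho> \<circ> \<tau>" "\<lambda>\<rho>. \<rho> \<circ> \<tau>"]) (use tR tt in auto)
  also have "\<dots> = - (\<Sum>\<rho>\<in>row_group m. stable_term x U ?S A (\<kappa> \<circ> \<rho> \<circ> \<sigma>))"
    by (simp add: flip sum_negf)
  finally show ?thesis by simp
qed

lemma label_char_remove_letter:
  assumes U: "finite U" "card U \<ge> 4" "inj_on x U"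
  shows "label_char x m U = (\<Sum>i\<in>U. label_char x m (U - {i}) * (\<Prod>l\<in>U-{i}. x l / (x l - x i)))"
proof -
  let ?S = "squares m" and ?G = "{\<sigma>. \<sigma> permutes squares m}"
  let ?c = "\<lambda>\<kappa> \<rho> \<sigma>. col_coeff m \<kappa> * row_coeff m \<rho> * proj_coeff m \<sigma>"
  define E where "E A = (\<Sum>\<kappa>\<in>?G. \<Sum>\<rho>\<in>?G. \<Sum>\<sigma>\<in>?G. ?c \<kappa> \<rho> \<sigma> * stable_term x U ?S A (\<kappa> \<circ> \<rho> \<circ> \<sigma>))" for A
  define g where "g t = (\<Sum>\<kappa>\<in>?G. \<Sum>\<rho>\<in>?G. \<Sum>\<sigma>\<in>?G. ?c \<kappa> \<rho> \<sigma> * super_fixsum x U ?S t (\<kappa> \<circ> \<rho> \<circ> \<sigma>))" for t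
  \<comment> \<open>\<open>q\<close> is \<open>g\<close> written as a polynomial, without the terms
    of degree above 3; these vanish by \<open>E0\<close>.\<close>
  define q where "q = (\<Sum>A\<in>{A\<in>Pow ?S. card A \<le> 3}. monom ((-1) ^ card A * E A) (card A))"
  have E0: "E A = 0" if "A \<subseteq> ?S" "card A \<ge> 4" for A
  proof -
    have "E A = (\<Sum>\<kappa>\<in>?G. \<Sum>\<sigma>\<in>?G. \<Sum>\<rho>\<in>?G. ?c \<kappa> \<rho> \<sigma> * stable_term x U ?S A (\<kappa> \<circ> \<rho> \<circ> \<sigma>))"
      unfolding E_def by (intro sum.cong refl sum.swap)
    also have "\<dots> = 0"
    proof (rule sum.neutral, rule ballI, rule sum.neutral, rule ballI)
      fix \<kappa> \<sigma> assume k: "\<kappa> \<in> ?G" "\<sigma> \<in> ?G"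
      have "(\<Sum>\<rho>\<in>?G. ?c \<kappa> \<rho> \<sigma> * stable_term x U ?S A (\<kappa> \<circ> \<rho> \<circ> \<sigma>))
          = (\<Sum>\<rho>\<in>row_group m. ?c \<kappa> \<rho> \<sigma> * stable_term x U ?S A (\<kappa> \<circ> \<rho> \<circ> \<sigma>))"
        by (rule sum.mono_neutral_right[OF finite_permuters]) (auto simp: row_group_def row_coeff_def)
      also have "\<dots> = (\<Sum>\<rho>\<in>row_group m. col_coeff m \<kappa> * proj_coeff m \<sigma> / of_nat (card (row_group m))
          * stable_term x U ?S A (\<kappa> \<circ> \<rho> \<circ> \<sigma>))"
        by (intro sum.cong refl) (simp add: row_coeff_def)
      also have "\<dots> = 0"
        unfolding sum_distrib_left[symmetric] using row_sum_stable_term_zero[OF that] k by simp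
      finally show "(\<Sum>\<rho>\<in>?G. ?c \<kappa> \<rho> \<sigma> * stable_term x U ?S A (\<kappa> \<circ> \<rho> \<circ> \<sigma>)) = 0" .
    qed
    finally show ?thesis .
  qed
  have gq: "g t = poly q t" for t
  proof -
    have "g t = (\<Sum>\<kappa>\<in>?G. \<Sum>\<rho>\<in>?G. \<Sum>\<sigma>\<in>?G. \<Sum>A\<in>Pow ?S.
        (- t) ^ card A * (?c \<kappa> \<rho> \<sigma> * stable_term x U ?S A (\<kappa> \<circ> \<rho> \<circ> \<sigma>)))"
      by (simp add: g_def super_fixsum_stable_term[OF finite_squares] sum_distrib_left mult.left_commute)
    also have "\<dots> = (\<Sum>\<kappa>\<in>?G. \<Sum>\<rho>\<in>?G. \<Sum>A\<in>Pow ?S. \<Sum>\<sigma>\<in>?G.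
        (- t) ^ card A * (?c \<kappa> \<rho> \<sigma> * stable_term x U ?S A (\<kappa> \<circ> \<rho> \<circ> \<sigma>)))"
      by (intro sum.cong refl sum.swap)
    also have "\<dots> = (\<Sum>\<kappa>\<in>?G. \<Sum>A\<in>Pow ?S. \<Sum>\<rho>\<in>?G. \<Sum>\<sigma>\<in>?G.
        (- t) ^ card A * (?c \<kappa> \<rho> \<sigma> * stable_term x U ?S A (\<kappa> \<circ> \<rho> \<circ> \<sigma>)))"
      by (intro sum.cong refl sum.swap)
    also have "\<dots> = (\<Sum>A\<in>Pow ?S. \<Sum>\<kappa>\<in>?G. \<Sum>\<rho>\<in>?G. \<Sum>\<sigma>\<in>?G.
        (- t) ^ card A * (?c \<kappa> \<rho> \<sigma> * stable_term x U ?S A (\<kappa> \<circ> \<rho> \<circ> \<sigma>)))"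
      by (rule sum.swap)
    also have "\<dots> = (\<Sum>A\<in>Pow ?S. (- t) ^ card A * E A)"
      by (simp only: E_def sum_distrib_left)
    also have "\<dots> = (\<Sum>A\<in>{A\<in>Pow ?S. card A \<le> 3}. (- t) ^ card A * E A)"
      by (rule sum.mono_neutral_right) (auto simp: finite_squares E0)
    also have "\<dots> = poly q t"
      by (simp add: q_def poly_sum poly_monom power_minus[of t] mult_ac)
    finally show ?thesis .
  qed
  have "degree q \<le> 3"
    unfolding q_def
    by (rule degree_sum_le) (auto simp: finite_squares intro: order_trans[OF degree_monom_le])
  then have deg: "degree q < card U" using U(2) by simp
  have g0: "g 0 = label_char x m U"
  proof -
    have "super_fixsum x U ?S 0 p = fixsum x U ?S p" for p
    proof -
      have "super_fixsum x U ?S 0 p = (\<Sum>A\<in>{{}}. (- 0) ^ card A * stable_term x U ?S A p)"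
        unfolding super_fixsum_stable_term[OF finite_squares]
        by (rule sum.mono_neutral_right)
           (auto simp: finite_squares power_0_left card_eq_0_iff dest: finite_subset[OF _ finite_squares])
      then show ?thesis by (simp add: stable_term_def sign_on_def restrict_id_def)
    qed
    then show ?thesis by (simp add: g_def label_char_fixsum[OF U(1)])
  qed
  have gi: "g (x i) = label_char x m (U - {i})" if "i \<in> U" for i
    unfolding g_def label_char_fixsum[OF finite_Diff[OF U(1)]]
  proof (intro sum.cong refl)
    fix \<kappa> \<rho> \<sigma>
    assume k: "\<kappa> \<in> ?G" "\<rho> \<in> ?G" "\<sigma> \<in> ?G"
    then have "\<kappa> \<circ> \<rho> \<circ> \<sigma> permutes ?S" by (simp add: permutes_compose)
    from super_fixsum_cancel[OF finite_squares this U(1) that]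
    show "?c \<kappa> \<rho> \<sigma> * super_fixsum x U ?S (x i) (\<kappa> \<circ> \<rho> \<circ> \<sigma>) = ?c \<kappa> \<rho> \<sigma> * fixsum x (U - {i}) ?S (\<kappa> \<circ> \<rho> \<circ> \<sigma>)"
      by simp
  qed
  have "label_char x m U = poly q 0" using g0 gq by simp
  also have "\<dots> = (\<Sum>i\<in>U. poly q (x i) * (\<Prod>l\<in>U-{i}. x l / (x l - x i)))"
    using lagrange_at_zero[OF U(1,3) deg] by simp
  also have "\<dots> = (\<Sum>i\<in>U. label_char x m (U - {i}) * (\<Prod>l\<in>U-{i}. x l / (x l - x i)))"
    by (intro sum.cong refl) (simp add: gi[symmetric] gq)
  finally show ?thesis .
qed

text \<open>For a fixed final set \<open>V\<close>, the letter \<open>i\<close> deleted first ranges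
  over \<open>U - V\<close>. Its interpolation factor splits into the part of the weight of
  \<open>V\<close> that belongs to \<open>i\<close> and an interpolation factor within
  \<open>U - V\<close>; the latter factors add up to 1.\<close>

theorem label_char_localization:
  assumes "finite U" "card U \<ge> 3" "inj_on x U"
  shows "label_char x m U = (\<Sum>V | V \<subseteq> U \<and> card V = 3.
    label_char x m V * (\<Prod>v\<in>V. \<Prod>l\<in>U-V. x v / (x v - x l)))"
  using assms
proof (induction "card U" arbitrary: U rule: less_induct)
  case less
  note U = less.prems
  show ?case
  proof (cases "card U = 3")
    case True
    have "{V. V \<subseteq> U \<and> card V = 3} = {U}"
      using True card_subset_eq[OF U(1)] by auto
    then show ?thesis by simp
  next
    case False
    then have c4: "card U \<ge> 4" using U by simp
    let ?T = "{V. V \<subseteq> U \<and> card V = 3}"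
    let ?w = "\<lambda>W V. (\<Prod>v\<in>V. \<Prod>l\<in>W-V. x v / (x v - x l))"
    let ?lag = "\<lambda>W i. (\<Prod>l\<in>W-{i}. x l / (x l - x i))"
    have finT: "finite ?T" by (rule finite_subset[of _ "Pow U"]) (use U in auto)
    have step: "label_char x m (U - {i}) * ?lag U i
        = (\<Sum>V\<in>?T. if i \<in> U - V then label_char x m V * ?w U V * ?lag (U - V) i else 0)" if i: "i \<in> U" for i
    proof -
      have "label_char x m (U - {i}) = (\<Sum>V | V \<subseteq> U - {i} \<and> card V = 3. label_char x m V * ?w (U - {i}) V)"
        using less.hyps[of "U - {i}"] U c4 i by (auto simp: card_Diff_singleton inj_on_diff)
      then have "label_char x m (U - {i}) * ?lag U i
          = (\<Sum>V | V \<subseteq> U - {i} \<and> card V = 3. label_char x m V * ?w (U - {i}) V * ?lag U i)"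
        by (simp add: sum_distrib_right)
      also have "\<dots> = (\<Sum>V | V \<subseteq> U - {i} \<and> card V = 3. label_char x m V * ?w U V * ?lag (U - V) i)"
      proof (intro sum.cong refl)
        fix V assume "V \<in> {V. V \<subseteq> U - {i} \<and> card V = 3}"
        then have V: "V \<subseteq> U" "i \<notin> V" "finite V" using U(1) finite_subset by auto
        have "?lag U i = ?lag (U - V) i * (\<Prod>v\<in>V. x v / (x v - x i))"
        proof -
          have "U - {i} = (U - V - {i}) \<union> V" using V by auto
          then show ?thesis using V U(1) by (simp add: prod.union_disjoint disjoint_iff)
        qed
        moreover have "?w U V = ?w (U - {i}) V * (\<Prod>v\<in>V. x v / (x v - x i))"
        proof -
          have "U - V = insert i (U - {i} - V)" using V i by auto
          then have "(\<Prod>l\<in>U-V. x v / (x v - x l)) = x v / (x v - x i) * (\<Prod>l\<in>U-{i}-V. x v / (x v - x l))" for v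
            using U(1) by (simp only:) (subst prod.insert, auto)
          then show ?thesis by (simp only: prod.distrib mult.commute)
        qed
        ultimately show "label_char x m V * ?w (U - {i}) V * ?lag U i = label_char x m V * ?w U V * ?lag (U - V) i"
          by simp
      qed
      also have "{V. V \<subseteq> U - {i} \<and> card V = 3} = {V\<in>?T. i \<in> U - V}" using i by auto
      also have "(\<Sum>V\<in>{V\<in>?T. i \<in> U - V}. label_char x m V * ?w U V * ?lag (U - V) i)
          = (\<Sum>V\<in>?T. if i \<in> U - V then label_char x m V * ?w U V * ?lag (U - V) i else 0)"
        by (rule sum.inter_filter[OF finT])
      finally show ?thesis .
    qed
    have "label_char x m U = (\<Sum>i\<in>U. \<Sum>V\<in>?T. if i \<in> U - V then label_char x m V * ?w U V * ?lag (U - V) i else 0)"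
      using label_char_remove_letter[OF U(1) c4 U(3)] step by simp
    also have "\<dots> = (\<Sum>V\<in>?T. \<Sum>i\<in>U. if i \<in> U - V then label_char x m V * ?w U V * ?lag (U - V) i else 0)"
      by (rule sum.swap)
    also have "\<dots> = (\<Sum>V\<in>?T. label_char x m V * ?w U V)"
    proof (intro sum.cong refl)
      fix V assume V: "V \<in> ?T"
      have "(\<Sum>i\<in>U. if i \<in> U - V then label_char x m V * ?w U V * ?lag (U - V) i else 0)
          = (\<Sum>i\<in>{i\<in>U. i \<in> U - V}. label_char x m V * ?w U V * ?lag (U - V) i)"
        by (rule sum.inter_filter[OF U(1), symmetric])
      also have "{i\<in>U. i \<in> U - V} = U - V" by auto
      also have "(\<Sum>i\<in>U - V. label_char x m V * ?w U V * ?lag (U - V) i)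
          = label_char x m V * ?w U V * (\<Sum>i\<in>U - V. poly 1 (x i) * ?lag (U - V) i)"
        by (simp add: sum_distrib_left)
      \<comment> \<open>Interpolation of the constant 1 at the nodes in \<open>U - V\<close>. The
        degree condition asks for at least one node, which the fourth letter of \<open>U\<close>
        supplies.\<close>
      also have "(\<Sum>i\<in>U - V. poly 1 (x i) * ?lag (U - V) i) = poly 1 0"
      proof (rule lagrange_at_zero)
        have "card (U - V) = card U - 3" using V U(1) finite_subset[of V U] by (simp add: card_Diff_subset)
        then show "degree (1 :: complex poly) < card (U - V)" using c4 by simp
      qed (use U in \<open>auto intro: inj_on_subset\<close>)
      finally show "(\<Sum>i\<in>U. if i \<in> U - V then label_char x m V * ?w U V * ?lag (U - V) i else 0)
          = label_char x m V * ?w U V" by simp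
    qed
    finally show ?thesis .
  qed
qed

section \<open>Minors\<close>

text \<open>The product of the determinants of \<open>F\<close> on the fibres of \<open>col\<close>,
  written as one sum because this is the form in which \<beta> produces it.\<close>

definition colsum :: "('a \<Rightarrow> 'b) \<Rightarrow> 'a set \<Rightarrow> ('a \<Rightarrow> 'a \<Rightarrow> 'c::comm_ring_1) \<Rightarrow> 'c" where
  "colsum col S F = (\<Sum>\<kappa> | \<kappa> permutes S \<and> (\<forall>s. col (\<kappa> s) = col s). of_int (sign \<kappa>) * (\<Prod>s\<in>S. F s (\<kappa> s)))"

lemma restrict_id_col_permutes:
  assumes S: "finite S" and k: "\<kappa> permutes S" "\<And>s. col (\<kappa> s) = col s"
    and T: "T \<subseteq> S" "\<And>s t. s \<in> T \<Longrightarrow> t \<in> S - T \<Longrightarrow> col s \<noteq> col t"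
  shows "restrict_id \<kappa> T permutes T"
proof (rule permutes_restrict_id)
  have sub: "\<kappa> ` T \<subseteq> T"
  proof
    fix t assume "t \<in> \<kappa> ` T"
    then obtain s where s: "s \<in> T" "t = \<kappa> s" by blast
    then have "t \<in> S" using T(1) permutes_in_image[OF k(1)] by auto
    moreover have "col s = col t" using s k(2) by simp
    ultimately show "t \<in> T" using T(2)[OF s(1), of t] by blast
  qed
  have inj: "inj_on \<kappa> T" using permutes_inj[OF k(1)] by (rule inj_on_subset) simp
  have "\<kappa> ` T = T" using endo_inj_surj[OF finite_subset[OF T(1) S] sub inj] .
  then show "bij_betw \<kappa> T T" using inj by (simp add: bij_betw_def)
qed

text \<open>A permutation preserving \<open>col\<close> cannot mix the two parts, so it is a pair of
  permutations; the sign is multiplicative.\<close>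

lemma colsum_Un:
  assumes fin: "finite S" "finite T" and dis: "\<And>s t. s \<in> S \<Longrightarrow> t \<in> T \<Longrightarrow> col s \<noteq> col t"
  shows "colsum col (S \<union> T) F = colsum col S F * colsum col T F"
proof -
  let ?P = "\<lambda>S. {\<kappa>. \<kappa> permutes S \<and> (\<forall>s. col (\<kappa> s) = col s)}"
  have ST: "S \<inter> T = {}" using dis by auto
  have "colsum col S F * colsum col T F = (\<Sum>(k, l)\<in>?P S \<times> ?P T.
      (of_int (sign k) * (\<Prod>s\<in>S. F s (k s))) * (of_int (sign l) * (\<Prod>s\<in>T. F s (l s))))"
    by (simp add: colsum_def sum_product sum.cartesian_product)
  also have "\<dots> = colsum col (S \<union> T) F"
    unfolding colsum_def
  proof (rule sum.reindex_bij_witness[of _ "\<lambda>\<kappa>. (restrict_id \<kappa> S, restrict_id \<kappa> T)" "\<lambda>(k, l). k \<circ> l"])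
    fix z assume "z \<in> ?P S \<times> ?P T"
    then obtain k l where z: "z = (k, l)" and k: "k permutes S" "\<And>s. col (k s) = col s"
      and l: "l permutes T" "\<And>s. col (l s) = col s" by auto
    have lS: "l s = s" if "s \<notin> T" for s using permutes_not_in[OF l(1) that] .
    have kT: "k s = s" if "s \<notin> S" for s using permutes_not_in[OF k(1) that] .
    have lT: "l s \<in> T" if "s \<in> T" for s using permutes_in_image[OF l(1)] that by simp
    have kS: "k s \<in> S" if "s \<in> S" for s using permutes_in_image[OF k(1)] that by simp
    have "restrict_id (k \<circ> l) S = k"
    proof
      fix s show "restrict_id (k \<circ> l) S s = k s"
      proof (cases "s \<in> S")
        case True
        then have "s \<notin> T" using ST by auto
        then show ?thesis using True by (simp add: lS)
      qed (simp add: kT)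
    qed
    moreover have "restrict_id (k \<circ> l) T = l"
    proof
      fix s show "restrict_id (k \<circ> l) T s = l s"
        using ST lT[of s] by (cases "s \<in> T") (auto simp: lS intro!: kT)
    qed
    ultimately show "(\<lambda>\<kappa>. (restrict_id \<kappa> S, restrict_id \<kappa> T)) (case z of (k, l) \<Rightarrow> k \<circ> l) = z"
      by (simp add: z)
    have kl: "k permutes S \<union> T" "l permutes S \<union> T"
      using k(1) l(1) by (auto intro: permutes_subset)
    then show "(case z of (k, l) \<Rightarrow> k \<circ> l) \<in> ?P (S \<union> T)"
      using k(2) l(2) by (auto simp: z intro: permutes_compose)
    have perm: "permutation k" "permutation l"
      using k(1) l(1) fin permutation_permutes by blast+
    have "(\<Prod>s\<in>S \<union> T. F s ((k \<circ> l) s)) = (\<Prod>s\<in>S. F s ((k \<circ> l) s)) * (\<Prod>s\<in>T. F s ((k \<circ> l) s))"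
      using fin ST by (simp add: prod.union_disjoint)
    also have "(\<Prod>s\<in>S. F s ((k \<circ> l) s)) = (\<Prod>s\<in>S. F s (k s))"
    proof (intro prod.cong refl)
      fix s assume "s \<in> S"
      then have "s \<notin> T" using ST by auto
      then show "F s ((k \<circ> l) s) = F s (k s)" by (simp add: lS)
    qed
    also have "(\<Prod>s\<in>T. F s ((k \<circ> l) s)) = (\<Prod>s\<in>T. F s (l s))"
    proof (intro prod.cong refl)
      fix s assume "s \<in> T"
      then have "l s \<notin> S" using ST lT by auto
      then show "F s ((k \<circ> l) s) = F s (l s)" by (simp add: kT)
    qed
    finally show "of_int (sign (case z of (k, l) \<Rightarrow> k \<circ> l)) * (\<Prod>s\<in>S \<union> T. F s ((case z of (k, l) \<Rightarrow> k \<circ> l) s)) =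
       (case z of (k, l) \<Rightarrow> (of_int (sign k) * (\<Prod>s\<in>S. F s (k s))) * (of_int (sign l) * (\<Prod>s\<in>T. F s (l s))))"
      using sign_compose[OF perm] by (simp add: z mult_ac)
  next
    fix \<kappa> assume "\<kappa> \<in> ?P (S \<union> T)"
    then have k: "\<kappa> permutes S \<union> T" "\<And>s. col (\<kappa> s) = col s" by auto
    have fin': "finite (S \<union> T)" using fin by simp
    have S: "restrict_id \<kappa> S permutes S"
      by (rule restrict_id_col_permutes[where col = col, OF fin' k]) (use dis in auto)
    have T: "restrict_id \<kappa> T permutes T"
      by (rule restrict_id_col_permutes[where col = col, OF fin' k]) (use dis in fastforce)+
    show "(restrict_id \<kappa> S, restrict_id \<kappa> T) \<in> ?P S \<times> ?P T"
      using S T k(2) by (auto simp: restrict_id_def)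
    show "(case (restrict_id \<kappa> S, restrict_id \<kappa> T) of (k, l) \<Rightarrow> k \<circ> l) = \<kappa>"
    proof
      fix s
      have "restrict_id \<kappa> T s \<in> T" if "s \<in> T" using permutes_in_image[OF T, of s] that by blast
      then show "(case (restrict_id \<kappa> S, restrict_id \<kappa> T) of (k, l) \<Rightarrow> k \<circ> l) s = \<kappa> s"
        using ST permutes_not_in[OF k(1), of s] by (cases "s \<in> T") (auto simp: restrict_id_def)
    qed
  qed
  finally show ?thesis by simp
qed

lemma colsum_empty: "colsum col {} F = 1"
proof -
  have "{\<kappa>. \<kappa> permutes {} \<and> (\<forall>s. col (\<kappa> s) = col s)} = {id}" by auto
  then show ?thesis by (simp add: colsum_def)
qed

lemma colsum_partition:
  assumes "finite S"
  shows "colsum col S F = (\<Prod>q\<in>col ` S. colsum col {s\<in>S. col s = q} F)"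
proof -
  have "colsum col {s\<in>S. col s \<in> Q} F = (\<Prod>q\<in>Q. colsum col {s\<in>S. col s = q} F)" if "finite Q" for Q
    using that
  proof (induction Q rule: finite_induct)
    case (insert q Q)
    have "{s\<in>S. col s \<in> insert q Q} = {s\<in>S. col s = q} \<union> {s\<in>S. col s \<in> Q}" by auto
    moreover have "colsum col ({s\<in>S. col s = q} \<union> {s\<in>S. col s \<in> Q}) F
        = colsum col {s\<in>S. col s = q} F * colsum col {s\<in>S. col s \<in> Q} F"
      using assms insert.hyps by (intro colsum_Un) auto
    ultimately show ?case using insert by simp
  qed (simp add: colsum_empty)
  from this[of "col ` S"] have "colsum col {s\<in>S. col s \<in> col ` S} F = (\<Prod>q\<in>col ` S. colsum col {s\<in>S. col s = q} F)"
    using assms by simp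
  moreover have "{s\<in>S. col s \<in> col ` S} = S" by auto
  ultimately show ?thesis by simp
qed

lemma colsum_one_column:
  assumes "\<And>s. s \<in> S \<Longrightarrow> col s = q"
  shows "colsum col S F = (\<Sum>\<kappa> | \<kappa> permutes S. of_int (sign \<kappa>) * (\<Prod>s\<in>S. F s (\<kappa> s)))"
proof -
  have "(\<forall>s. col (\<kappa> s) = col s)" if "\<kappa> permutes S" for \<kappa>
  proof
    fix s show "col (\<kappa> s) = col s"
      using assms permutes_in_image[OF that, of s] permutes_not_in[OF that, of s] by (cases "s \<in> S") auto
  qed
  then have "{\<kappa>. \<kappa> permutes S \<and> (\<forall>s. col (\<kappa> s) = col s)} = {\<kappa>. \<kappa> permutes S}" by auto
  then show ?thesis by (simp add: colsum_def)
qed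

lemma signed_sum_2:
  assumes "a \<noteq> b"
  shows "(\<Sum>\<kappa> | \<kappa> permutes {a,b}. of_int (sign \<kappa>) * (\<Prod>s\<in>{a,b}. F s (\<kappa> s)))
    = (F a a * F b b - F a b * F b a :: 'c::comm_ring_1)"
proof -
  have "{\<kappa>. \<kappa> permutes {a,b}} = {id, transpose a b}" by (auto simp: permutes_doubleton_iff)
  moreover have "id \<noteq> transpose a b" using assms by (metis id_apply transpose_apply_first)
  ultimately show ?thesis using assms by (simp add: sign_swap_id)
qed

lemma signed_sum_3:
  assumes "a \<noteq> b" "a \<noteq> c" "b \<noteq> c"
  shows "(\<Sum>\<kappa> | \<kappa> permutes {a,b,c}. of_int (sign \<kappa>) * (\<Prod>s\<in>{a,b,c}. F s (\<kappa> s)))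
    = (F a a * (F b b * F c c - F b c * F c b) - F a b * (F b a * F c c - F b c * F c a)
      + F a c * (F b a * F c b - F b b * F c a) :: 'c::comm_ring_1)"
proof -
  let ?f = "\<lambda>\<kappa>. of_int (sign \<kappa>) * (\<Prod>s\<in>{a,b,c}. F s (\<kappa> s))"
  have bc: "{\<kappa>. \<kappa> permutes {b,c}} = {id, transpose b c}" by (auto simp: permutes_doubleton_iff)
  have ne: "id \<noteq> transpose b c" using assms by (metis id_apply transpose_apply_first)
  have sg: "sign (transpose a y \<circ> transpose b c) = (if a = y then - 1 else 1)" for y
    using assms by (subst sign_compose) (auto simp: permutation_swap_id sign_swap_id)
  have "(\<Sum>\<kappa> | \<kappa> permutes insert a {b,c}. ?f \<kappa>) = (\<Sum>y\<in>insert a {b,c}. \<Sum>q | q permutes {b,c}. ?f (transpose a y \<circ> q))"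
    by (rule sum_over_permutations_insert) (use assms in auto)
  also have "\<dots> = ?f (transpose a a \<circ> id) + ?f (transpose a a \<circ> transpose b c) + (?f (transpose a b \<circ> id) + ?f (transpose a b \<circ> transpose b c))
     + (?f (transpose a c \<circ> id) + ?f (transpose a c \<circ> transpose b c))"
    using assms ne by (simp add: bc)
  also have "\<dots> = F a a * (F b b * F c c - F b c * F c b) - F a b * (F b a * F c c - F b c * F c a)
      + F a c * (F b a * F c b - F b b * F c a)"
    using assms by (simp add: sg sign_swap_id del: transpose_same) (simp add: transpose_def sign_swap_id algebra_simps)
  finally show ?thesis by simp
qed

section \<open>Polynomials with coprime leading monomials\<close>

type_synonym 'v mon = "'v \<Rightarrow>\<^sub>0 nat"
type_synonym 'v pol = "('v \<Rightarrow>\<^sub>0 nat) \<Rightarrow>\<^sub>0 complex"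

abbreviation lookup where "lookup \<equiv> Poly_Mapping.lookup"
abbreviation keys where "keys \<equiv> Poly_Mapping.keys"
abbreviation single where "single \<equiv> Poly_Mapping.single"

lemma pol_sum_monomials: "p = (\<Sum>M\<in>keys p. single M (lookup p M))"
proof (rule poly_mapping_eqI)
  fix K
  have "lookup (\<Sum>M\<in>keys p. single M (lookup p M)) K = (\<Sum>M\<in>keys p. if M = K then lookup p M else 0)"
    by (simp add: lookup_sum lookup_single when_def)
  also have "\<dots> = lookup p K" by (simp add: sum.delta in_keys_iff)
  finally show "lookup p K = lookup (\<Sum>M\<in>keys p. single M (lookup p M)) K" by simp
qed

lemma single_scalar_mult: "single 0 c * single M d = single M (c * d)"
  by (simp add: mult_single)

lemma lookup_monomial_mult:
  fixes f :: "'v pol"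
  shows "lookup (single u c * f) (u + S) = c * lookup f S"
proof -
  have "single u c * f = (\<Sum>M\<in>keys f. single (u + M) (c * lookup f M))"
    by (subst pol_sum_monomials[of f]) (simp add: sum_distrib_left mult_single)
  then have "lookup (single u c * f) (u + S) = (\<Sum>M\<in>keys f. if M = S then c * lookup f M else 0)"
    by (simp add: lookup_sum lookup_single when_def)
  also have "\<dots> = c * lookup f S" by (simp add: sum.delta in_keys_iff)
  finally show ?thesis .
qed

text \<open>Linear span over the complex numbers, scalars being the constant polynomials
  \<open>single 0 c\<close>; the family may be infinite.\<close>

definition scal_span :: "('z \<Rightarrow> 'v pol) \<Rightarrow> 'z set \<Rightarrow> 'v pol \<Rightarrow> bool" where
  "scal_span B Z p \<longleftrightarrow> (\<exists>F c. finite F \<and> F \<subseteq> Z \<and> p = (\<Sum>z\<in>F. single 0 (c z) * B z))"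

lemma scal_span_base: "z \<in> Z \<Longrightarrow> scal_span B Z (B z)"
  unfolding scal_span_def by (rule exI[of _ "{z}"], rule exI[of _ "\<lambda>_. 1"]) simp

lemma scal_span_scale: "scal_span B Z p \<Longrightarrow> scal_span B Z (single 0 a * p)"
  unfolding scal_span_def
proof (elim exE conjE)
  fix F c assume F: "finite F" "F \<subseteq> Z" "p = (\<Sum>z\<in>F. single 0 (c z) * B z)"
  have "single 0 a * p = (\<Sum>z\<in>F. single 0 (a * c z) * B z)"
    by (simp add: F sum_distrib_left mult.assoc[symmetric] single_scalar_mult)
  then show "\<exists>F c. finite F \<and> F \<subseteq> Z \<and> single 0 a * p = (\<Sum>z\<in>F. single 0 (c z) * B z)"
    using F by (intro exI[of _ F] exI[of _ "\<lambda>z. a * c z"]) simp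
qed

lemma scal_span_zero: "scal_span B Z 0"
  unfolding scal_span_def by (rule exI[of _ "{}"]) simp

lemma scal_span_add:
  assumes "scal_span B Z p" "scal_span B Z q" shows "scal_span B Z (p + q)"
proof -
  obtain F c where F: "finite F" "F \<subseteq> Z" "p = (\<Sum>z\<in>F. single 0 (c z) * B z)"
    using assms(1) unfolding scal_span_def by blast
  obtain G d where G: "finite G" "G \<subseteq> Z" "q = (\<Sum>z\<in>G. single 0 (d z) * B z)"
    using assms(2) unfolding scal_span_def by blast
  let ?c = "\<lambda>z. (if z \<in> F then c z else 0)" and ?d = "\<lambda>z. (if z \<in> G then d z else 0)"
  have "p = (\<Sum>z\<in>F \<union> G. single 0 (?c z) * B z)"
    unfolding F(3) using F G by (intro sum.mono_neutral_cong_left) auto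
  moreover have "q = (\<Sum>z\<in>F \<union> G. single 0 (?d z) * B z)"
    unfolding G(3) using F G by (intro sum.mono_neutral_cong_left) auto
  ultimately have "p + q = (\<Sum>z\<in>F \<union> G. single 0 (?c z + ?d z) * B z)"
    by (simp add: sum.distrib[symmetric] distrib_right[symmetric] single_add)
  then show ?thesis unfolding scal_span_def using F G
    by (intro exI[of _ "F \<union> G"] exI[of _ "\<lambda>z. ?c z + ?d z"]) auto
qed

lemma scal_span_sum: "(\<And>i. i \<in> I \<Longrightarrow> scal_span B Z (p i)) \<Longrightarrow> scal_span B Z (\<Sum>i\<in>I. p i)"
  by (induction I rule: infinite_finite_induct) (auto intro: scal_span_zero scal_span_add)

lemma scal_span_diff:
  assumes "scal_span B Z p" "scal_span B Z q" shows "scal_span B Z (p - q)"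
proof -
  have "single 0 (-1) * q = - q" by (simp add: single_uminus)
  then show ?thesis using scal_span_add[OF assms(1) scal_span_scale[OF assms(2), of "-1"]] by simp
qed

lemma scal_span_monomials:
  assumes "\<And>M. M \<in> keys p \<Longrightarrow> scal_span B Z (single M 1)"
  shows "scal_span B Z p"
proof -
  have "scal_span B Z (\<Sum>M\<in>keys p. single 0 (lookup p M) * single M 1)"
    by (intro scal_span_sum scal_span_scale assms)
  then show ?thesis using pol_sum_monomials[of p] by (simp add: single_scalar_mult)
qed

section \<open>Leading monomials with respect to an additive weight\<close>

definition below :: "('v mon \<Rightarrow> nat) \<Rightarrow> nat \<Rightarrow> 'v pol \<Rightarrow> bool" where
  "below w W p \<longleftrightarrow> (\<forall>M\<in>keys p. w M < W)"

text \<open>An additive weight takes the place of a monomial order. Different monomials may share a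
  weight; it is enough that the leading one, with coefficient 1, is strictly heavier than the others
  of its own polynomial.\<close>

definition leads :: "('v mon \<Rightarrow> nat) \<Rightarrow> 'v pol \<Rightarrow> 'v mon \<Rightarrow> bool" where
  "leads w p M \<longleftrightarrow> below w (w M) (p - single M 1)"

lemma below_add: "below w W p \<Longrightarrow> below w W q \<Longrightarrow> below w W (p + q)"
  using keys_add[of p q] unfolding below_def by blast

lemma below_lookup: "below w W p \<Longrightarrow> w M \<ge> W \<Longrightarrow> lookup p M = 0"
  unfolding below_def by (metis in_keys_iff leD)

lemma below_mult:
  assumes add: "\<And>a b. w (a + b) = w a + w b" and "below w W p" "\<And>M. M \<in> keys q \<Longrightarrow> w M \<le> W'"
  shows "below w (W + W') (p * q)"
  unfolding below_def
proof
  fix M assume "M \<in> keys (p * q)"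
  then obtain a b where "M = a + b" "a \<in> keys p" "b \<in> keys q" using keys_mult[of p q] by blast
  then show "w M < W + W'" using assms by (auto simp: below_def intro: add_less_le_mono)
qed

lemma leads_keys:
  assumes "leads w p M" "K \<in> keys p" shows "w K \<le> w M"
proof (rule ccontr)
  assume "\<not> ?thesis"
  then have "lookup (p - single M 1) K = 0" "K \<noteq> M"
    using below_lookup[of w "w M" "p - single M 1" K] assms(1) by (auto simp: leads_def)
  then show False using assms(2) by (auto simp: lookup_minus lookup_single when_def in_keys_iff)
qed

lemma leads_mult:
  assumes add: "\<And>a b. w (a + b) = w a + w b" and "leads w p M" "leads w q K"
  shows "leads w (p * q) (M + K)"
proof -
  have "p * q - single (M + K) 1 = (p - single M 1) * q + (q - single K 1) * single M 1"
    by (simp add: algebra_simps mult_single)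
  moreover have "below w (w M + w K) ((p - single M 1) * q)"
    using assms(2,3) leads_keys[OF assms(3)] by (intro below_mult add) (auto simp: leads_def)
  moreover have "below w (w K + w M) ((q - single K 1) * single M 1)"
    using assms(3) by (intro below_mult add) (auto simp: leads_def)
  ultimately show ?thesis unfolding leads_def add by (simp add: below_add add.commute)
qed

lemma leads_one: "leads w 1 0"
  by (simp add: leads_def below_def)

lemma leads_single: "leads w (single M 1) M"
  by (simp add: leads_def below_def)

text \<open>The last three assumptions make the 2N variables \<open>a e\<close>, \<open>b e\<close>
  pairwise distinct, so the leading monomials are coprime. In this case the generators form a
  Groebner basis; a triangular change of basis shows what is required of it without
  S-polynomials.\<close>

locale coprime_leading =
  fixes N :: nat and g :: "nat \<Rightarrow> 'v pol" and a b :: "nat \<Rightarrow> 'v" and w :: "'v mon \<Rightarrow> nat"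
  assumes w_add: "w (M + K) = w M + w K"
    and leads_g: "e < N \<Longrightarrow> leads w (g e) (single (a e) 1 + single (b e) 1)"
    and inj_a: "inj_on a {..<N}" and inj_b: "inj_on b {..<N}"
    and a_ne_b: "e < N \<Longrightarrow> e' < N \<Longrightarrow> a e \<noteq> b e'"
begin

definition std :: "'v mon \<Rightarrow> bool" where
  "std S \<longleftrightarrow> (\<forall>e<N. lookup S (a e) = 0 \<or> lookup S (b e) = 0)"

text \<open>Depends on \<open>N\<close> and \<open>g\<close> only: facts obtained from different
  weights and leading variables speak of the same ideal.\<close>

definition ideal :: "'v pol set" where
  "ideal = {p. \<exists>c. p = (\<Sum>e<N. c e * g e)}"

lemma ideal_gen: "e < N \<Longrightarrow> p * g e \<in> ideal"
proof -
  assume e: "e < N"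
  have "p * g e = (\<Sum>i<N. (if i = e then p else 0) * g i)"
    using e by (simp add: if_distrib[of "\<lambda>c. c * _"] sum.delta cong: if_cong)
  then show ?thesis unfolding ideal_def by (intro CollectI exI[of _ "\<lambda>i. if i = e then p else 0"])
qed

lemma ideal_add: "p \<in> ideal \<Longrightarrow> q \<in> ideal \<Longrightarrow> p + q \<in> ideal"
  unfolding ideal_def
proof (elim CollectE exE)
  fix c d assume "p = (\<Sum>e<N. c e * g e)" "q = (\<Sum>e<N. d e * g e)"
  then have "p + q = (\<Sum>e<N. (c e + d e) * g e)" by (simp add: sum.distrib distrib_right)
  then show "p + q \<in> {p. \<exists>c. p = (\<Sum>e<N. c e * g e)}" by (intro CollectI exI)
qed

lemma ideal_mult: "p \<in> ideal \<Longrightarrow> q * p \<in> ideal"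
  unfolding ideal_def
proof (elim CollectE exE)
  fix c assume "p = (\<Sum>e<N. c e * g e)"
  then have "q * p = (\<Sum>e<N. (q * c e) * g e)" by (simp add: sum_distrib_left mult.assoc)
  then show "q * p \<in> {p. \<exists>c. p = (\<Sum>e<N. c e * g e)}" by (intro CollectI exI)
qed

lemma ideal_zero: "0 \<in> ideal"
  unfolding ideal_def by (intro CollectI exI[of _ "\<lambda>_. 0"]) simp

lemma ideal_diff: "p \<in> ideal \<Longrightarrow> q \<in> ideal \<Longrightarrow> p - q \<in> ideal"
  using ideal_add[of p "(-1) * q"] ideal_mult[of q "-1"] by simp

lemma ideal_sum: "(\<And>i. i \<in> I \<Longrightarrow> p i \<in> ideal) \<Longrightarrow> (\<Sum>i\<in>I. p i) \<in> ideal"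
  by (induction I rule: infinite_finite_induct) (auto intro: ideal_zero ideal_add)

text \<open>The polynomials \<open>\<Prod> g\<^sub>e\<^bsup>k\<^sub>e\<^esup> S\<close> with \<open>S\<close> standard have pairwise different leading monomials
  (the pairs \<open>a\<^sub>e b\<^sub>e\<close> are coprime) and form a basis; those with \<open>k \<noteq> 0\<close> span the ideal.\<close>
definition gbasis :: "(nat \<Rightarrow> nat) \<times> 'v mon \<Rightarrow> 'v pol" where
  "gbasis z = (\<Prod>e<N. g e ^ fst z e) * single (snd z) 1"

definition gmon :: "(nat \<Rightarrow> nat) \<times> 'v mon \<Rightarrow> 'v mon" where
  "gmon z = (\<Sum>e<N. single (a e) (fst z e) + single (b e) (fst z e)) + snd z"

definition indices :: "((nat \<Rightarrow> nat) \<times> 'v mon) set" where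
  "indices = {z. std (snd z) \<and> (\<forall>e\<ge>N. fst z e = 0)}"

lemma leads_gbasis: "leads w (gbasis z) (gmon z)"
proof -
  have pow: "leads w (g e ^ k) (single (a e) k + single (b e) k)" if "e < N" for e k
  proof (induction k)
    case (Suc k)
    have "leads w (g e * g e ^ k) ((single (a e) 1 + single (b e) 1) + (single (a e) k + single (b e) k))"
      by (rule leads_mult[OF w_add leads_g[OF that] Suc])
    moreover have "(single (a e) 1 + single (b e) 1) + (single (a e) k + single (b e) k)
        = single (a e) (Suc k) + single (b e) (Suc k)"
      by (rule poly_mapping_eqI) (simp add: lookup_add lookup_single when_def)
    ultimately show ?case by simp
  qed (simp add: leads_one)
  have "leads w (\<Prod>e<n. g e ^ fst z e) (\<Sum>e<n. single (a e) (fst z e) + single (b e) (fst z e))" if "n \<le> N" for n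
    using that
  proof (induction n)
    case (Suc n)
    have "leads w ((\<Prod>e<n. g e ^ fst z e) * g n ^ fst z n)
       ((\<Sum>e<n. single (a e) (fst z e) + single (b e) (fst z e)) + (single (a n) (fst z n) + single (b n) (fst z n)))"
      using Suc by (intro leads_mult w_add pow) auto
    then show ?case by simp
  qed (simp add: leads_one)
  from leads_mult[OF w_add this[OF order_refl] leads_single] show ?thesis
    by (simp add: gbasis_def gmon_def)
qed

lemma lookup_gmon:
  assumes "e < N"
  shows "lookup (gmon z) (a e) = fst z e + lookup (snd z) (a e)"
    and "lookup (gmon z) (b e) = fst z e + lookup (snd z) (b e)"
proof -
  have b_ne_a: "b i \<noteq> a e'" if "i < N" "e' < N" for i e' using a_ne_b[OF that(2,1)] by simp
  have "(\<Sum>i<N. lookup (single (a i) (fst z i) + single (b i) (fst z i)) (a e)) = (\<Sum>i<N. if i = e then fst z i else 0)"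
    using assms inj_a a_ne_b b_ne_a by (intro sum.cong refl) (auto simp: lookup_add lookup_single when_def inj_on_def)
  then show "lookup (gmon z) (a e) = fst z e + lookup (snd z) (a e)"
    using assms by (simp add: gmon_def lookup_add lookup_sum)
  have "(\<Sum>i<N. lookup (single (a i) (fst z i) + single (b i) (fst z i)) (b e)) = (\<Sum>i<N. if i = e then fst z i else 0)"
    using assms inj_b a_ne_b b_ne_a by (intro sum.cong refl) (auto simp: lookup_add lookup_single when_def inj_on_def)
  then show "lookup (gmon z) (b e) = fst z e + lookup (snd z) (b e)"
    using assms by (simp add: gmon_def lookup_add lookup_sum)
qed

text \<open>A standard monomial lacks \<open>a e\<close> or \<open>b e\<close>, so the exponent of
  \<open>g e\<close> is recovered as the minimum of the exponents of \<open>a e\<close> and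
  \<open>b e\<close>.\<close>

lemma inj_gmon: "inj_on gmon indices"
proof (rule inj_onI)
  fix z z' assume z: "z \<in> indices" "z' \<in> indices" "gmon z = gmon z'"
  have k: "fst y e = min (lookup (gmon y) (a e)) (lookup (gmon y) (b e))" if "e < N" "y \<in> indices" for y e
    using that by (auto simp: lookup_gmon indices_def std_def)
  have "fst z = fst z'"
  proof
    fix e show "fst z e = fst z' e"
      using z k[of e z] k[of e z'] by (cases "e < N") (auto simp: indices_def)
  qed
  moreover from this have "snd z = snd z'" using z(3) by (simp add: gmon_def)
  ultimately show "z = z'" by (simp add: prod_eq_iff)
qed

lemma gmon_surj: "\<exists>z\<in>indices. gmon z = M"
proof -
  define k where "k e = (if e < N then min (lookup M (a e)) (lookup M (b e)) else 0)" for e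
  define L where "L = (\<Sum>e<N. single (a e) (k e) + single (b e) (k e))"
  have La: "lookup L (a e) = k e" "lookup L (b e) = k e" if "e < N" for e
    using lookup_gmon[OF that, of "(k, 0)"] by (simp_all add: gmon_def L_def)
  have L0: "lookup L v = 0" if "v \<notin> a ` {..<N}" "v \<notin> b ` {..<N}" for v
    using that by (auto simp: L_def lookup_sum lookup_add lookup_single when_def)
  have le: "lookup L v \<le> lookup M v" for v
    using La L0[of v] by (cases "v \<in> a ` {..<N} \<or> v \<in> b ` {..<N}") (auto simp: k_def)
  have LM: "L + (M - L) = M"
    by (rule poly_mapping_eqI) (simp add: lookup_add lookup_minus le)
  have "(k, M - L) \<in> indices"
    by (auto simp: indices_def std_def lookup_minus La k_def min_def)
  moreover have "gmon (k, M - L) = M" using LM by (simp add: gmon_def L_def)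
  ultimately show ?thesis by blast
qed

text \<open>Triangularity: a monomial differs from the basis element that it leads by monomials of
  smaller weight, and weights are natural numbers.\<close>

lemma gbasis_span: "scal_span gbasis indices p"
proof (rule scal_span_monomials)
  fix M show "scal_span gbasis indices (single M 1)"
  proof (induction "w M" arbitrary: M rule: less_induct)
    case less
    obtain z where z: "z \<in> indices" "gmon z = M" using gmon_surj by blast
    have "below w (w M) (gbasis z - single M 1)"
      using leads_gbasis[of z] z(2) by (simp add: leads_def)
    then have "scal_span gbasis indices (gbasis z - single M 1)"
      unfolding below_def by (intro scal_span_monomials[of "gbasis z - single M 1"]) (rule less.hyps, blast)
    from scal_span_diff[OF scal_span_base[OF z(1), where B = gbasis] this] show ?case by simp
  qed
qed

definition nonstd_indices :: "((nat \<Rightarrow> nat) \<times> 'v mon) set" where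
  "nonstd_indices = {z\<in>indices. \<exists>e<N. fst z e > 0}"

lemma gen_times_gbasis:
  assumes "e < N" "z \<in> indices"
  shows "scal_span gbasis nonstd_indices (g e * gbasis z)"
proof -
  let ?z = "((fst z)(e := Suc (fst z e)), snd z)"
  have "(\<Prod>i<N. g i ^ fst ?z i) = g e * (\<Prod>i<N. g i ^ fst z i)"
    using assms(1) by (simp add: prod.remove[of "{..<N}" e] mult.assoc)
  then have "g e * gbasis z = gbasis ?z" by (simp add: gbasis_def mult.assoc)
  moreover have "?z \<in> nonstd_indices" using assms by (auto simp: nonstd_indices_def indices_def)
  ultimately show ?thesis using scal_span_base[of ?z nonstd_indices gbasis] by simp
qed

lemma ideal_span:
  assumes "p \<in> ideal" shows "scal_span gbasis nonstd_indices p"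
proof -
  obtain c where c: "p = (\<Sum>e<N. c e * g e)" using assms by (auto simp: ideal_def)
  have "scal_span gbasis nonstd_indices (c e * g e)" if "e < N" for e
  proof -
    obtain F d where F: "finite F" "F \<subseteq> indices" "c e = (\<Sum>z\<in>F. single 0 (d z) * gbasis z)"
      using gbasis_span[of "c e"] unfolding scal_span_def by blast
    have "c e * g e = (\<Sum>z\<in>F. single 0 (d z) * (g e * gbasis z))"
      unfolding F(3) mult.commute[of _ "g e"] by (simp add: sum_distrib_left mult.left_commute)
    also have "scal_span gbasis nonstd_indices \<dots>"
      using F that by (intro scal_span_sum scal_span_scale gen_times_gbasis) auto
    finally show ?thesis .
  qed
  then show ?thesis unfolding c by (intro scal_span_sum) simp
qed

lemma gbasis_nonstd_in_ideal:
  assumes "z \<in> nonstd_indices" shows "gbasis z \<in> ideal"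
proof -
  obtain e where e: "e < N" "fst z e > 0" using assms by (auto simp: nonstd_indices_def)
  have "(\<Prod>i<N. g i ^ fst z i) = (g e ^ (fst z e - 1) * (\<Prod>i\<in>{..<N} - {e}. g i ^ fst z i)) * g e"
    using e by (subst prod.remove[of _ e]) (auto simp: power_eq_if mult_ac)
  then have "gbasis z = (g e ^ (fst z e - 1) * (\<Prod>i\<in>{..<N} - {e}. g i ^ fst z i) * single (snd z) 1) * g e"
    by (simp add: gbasis_def mult_ac)
  then show ?thesis using ideal_gen[OF e(1)] by simp
qed

text \<open>In an expansion of \<open>h\<close> let \<open>W\<close> be the largest weight of a
  leading monomial. From weight \<open>W\<close> on, a basis element has no monomial but its leading
  one, and these are pairwise different, so the top terms cannot cancel; each contains some pair
  \<open>a e\<close>, \<open>b e\<close>.\<close>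

lemma ideal_top_nonstd:
  assumes "h \<in> ideal" "h \<noteq> 0"
  shows "\<exists>M\<in>keys h. \<not> std M \<and> (\<forall>K\<in>keys h. w K \<le> w M)"
proof -
  obtain F0 c where F0: "finite F0" "F0 \<subseteq> nonstd_indices" "h = (\<Sum>z\<in>F0. single 0 (c z) * gbasis z)"
    using ideal_span[OF assms(1)] unfolding scal_span_def by blast
  define F where "F = {z\<in>F0. c z \<noteq> 0}"
  have F: "finite F" "F \<subseteq> nonstd_indices" "\<And>z. z \<in> F \<Longrightarrow> c z \<noteq> 0" using F0 by (auto simp: F_def)
  have h: "h = (\<Sum>z\<in>F. single 0 (c z) * gbasis z)"
    unfolding F0(3) F_def using F0(1) by (intro sum.mono_neutral_right) auto
  have Fne: "F \<noteq> {}" using h assms(2) by auto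
  define W where "W = Max ((\<lambda>z. w (gmon z)) ` F)"
  have Wmax: "w (gmon z) \<le> W" if "z \<in> F" for z using that F(1) by (simp add: W_def)
  have "W \<in> (\<lambda>z. w (gmon z)) ` F" unfolding W_def using F(1) Fne by (intro Max_in) auto
  then obtain z0 where z0: "z0 \<in> F" "w (gmon z0) = W" by auto
  have lk: "lookup (gbasis z) K = (if K = gmon z then 1 else 0)" if "z \<in> F" "w K \<ge> W" for z K
  proof -
    have "lookup (gbasis z - single (gmon z) 1) K = 0"
      using leads_gbasis[of z] Wmax[OF that(1)] that(2) unfolding leads_def
      by (intro below_lookup[where w = w and W = "w (gmon z)"]) auto
    then show ?thesis by (simp add: lookup_minus lookup_single when_def split: if_splits)
  qed
  have lh: "lookup h K = (\<Sum>z\<in>F. if K = gmon z then c z else 0)" if "w K \<ge> W" for K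
  proof -
    have "lookup h K = (\<Sum>z\<in>F. c z * lookup (gbasis z) K)"
      using lookup_monomial_mult[of 0 _ _ K] by (simp add: h lookup_sum)
    also have "\<dots> = (\<Sum>z\<in>F. if K = gmon z then c z else 0)"
      using that by (intro sum.cong refl) (simp add: lk)
    finally show ?thesis .
  qed
  have "lookup h (gmon z0) = (\<Sum>z\<in>F. if gmon z0 = gmon z then c z else 0)"
    using lh[of "gmon z0"] z0(2) by simp
  also have "\<dots> = (\<Sum>z\<in>F. if z = z0 then c z else 0)"
    using inj_gmon F z0 by (intro sum.cong refl) (auto simp: inj_on_def nonstd_indices_def)
  finally have "lookup h (gmon z0) = c z0" using F z0 by simp
  then have key: "gmon z0 \<in> keys h" using F(3)[OF z0(1)] by (simp add: in_keys_iff)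
  have "w K \<le> w (gmon z0)" if "K \<in> keys h" for K
  proof (rule ccontr)
    assume "\<not> ?thesis"
    then have K: "w K > W" using z0 by simp
    then have "K \<noteq> gmon z" if "z \<in> F" for z using Wmax[OF that] by auto
    then have "lookup h K = 0" using lh[of K] K by simp
    then show False using that by (simp add: in_keys_iff)
  qed
  moreover have "\<not> std (gmon z0)"
  proof -
    obtain e where "e < N" "fst z0 e > 0" using z0 F by (auto simp: nonstd_indices_def)
    then show ?thesis using lookup_gmon[of e z0] by (auto simp: std_def)
  qed
  ultimately show ?thesis using key by blast
qed

lemma std_in_ideal_zero:
  assumes "f \<in> ideal" "\<And>M. M \<in> keys f \<Longrightarrow> std M" shows "f = 0"
  using ideal_top_nonstd[of f] assms by blast

text \<open>Modulo the ideal \<open>f\<close> may be replaced by a combination \<open>fs\<close> of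
  standard monomials. The heaviest monomials of \<open>q * fs\<close> are \<open>u\<close> times
  standard ones, and remain standard as \<open>u\<close> involves none of the variables
  \<open>a e\<close>, \<open>b e\<close>; a nonzero element of the ideal would have a nonstandard
  one among them.\<close>

lemma nonzerodivisor:
  assumes q: "leads w q u" and u: "\<And>e. e < N \<Longrightarrow> lookup u (a e) = 0 \<and> lookup u (b e) = 0"
    and qf: "q * f \<in> ideal"
  shows "f \<in> ideal"
proof -
  obtain F c where F: "finite F" "F \<subseteq> indices" "f = (\<Sum>z\<in>F. single 0 (c z) * gbasis z)"
    using gbasis_span[of f] unfolding scal_span_def by blast
  define fi where "fi = (\<Sum>z\<in>F \<inter> nonstd_indices. single 0 (c z) * gbasis z)"
  define fs where "fs = (\<Sum>z\<in>F - nonstd_indices. single 0 (c z) * gbasis z)"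
  have f: "f = fi + fs" unfolding F(3) fi_def fs_def using F(1) by (rule sum.Int_Diff)
  have fi: "fi \<in> ideal" unfolding fi_def
    by (intro ideal_sum ideal_mult gbasis_nonstd_in_ideal) auto
  have "q * fs \<in> ideal" using ideal_diff[OF qf ideal_mult[OF fi, of q]] f by (simp add: algebra_simps)
  have fs_std: "std M" if "M \<in> keys fs" for M
  proof -
    have "fs = (\<Sum>z\<in>F - nonstd_indices. single (snd z) (c z))"
      unfolding fs_def
    proof (intro sum.cong refl)
      fix z assume "z \<in> F - nonstd_indices"
      then have "fst z e = 0" if "e < N" for e using F(2) that by (auto simp: nonstd_indices_def)
      then show "single 0 (c z) * gbasis z = single (snd z) (c z)"
        by (simp add: gbasis_def single_scalar_mult)
    qed
    then have "lookup fs M = (\<Sum>z\<in>F - nonstd_indices. if snd z = M then c z else 0)"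
      by (simp add: lookup_sum lookup_single when_def)
    moreover have "lookup fs M \<noteq> 0" using that by (simp add: in_keys_iff)
    ultimately have "(\<Sum>z\<in>F - nonstd_indices. if snd z = M then c z else 0) \<noteq> 0" by simp
    then have "\<exists>z\<in>F - nonstd_indices. snd z = M" by (rule contrapos_np) (auto intro!: sum.neutral)
    then show ?thesis using F(2) by (auto simp: indices_def)
  qed
  have "fs = 0"
  proof (rule ccontr)
    assume "fs \<noteq> 0"
    then have ne: "keys fs \<noteq> {}" by simp
    define W where "W = Max (w ` keys fs)"
    have "W \<in> w ` keys fs" unfolding W_def using ne by (intro Max_in) auto
    then obtain S0 where S0: "S0 \<in> keys fs" "w S0 = W" by auto
    have W: "w S \<le> W" if "S \<in> keys fs" for S using that by (simp add: W_def)
    have split: "q * fs = single u 1 * fs + (q - single u 1) * fs" by (simp add: algebra_simps)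
    have low: "below w (w u + W) ((q - single u 1) * fs)"
      using q W by (intro below_mult w_add) (auto simp: leads_def)
    have top: "lookup (q * fs) K = lookup (single u 1 * fs) K" if "w K \<ge> w u + W" for K
      using below_lookup[OF low that] by (simp add: split lookup_add)
    have "lookup (q * fs) (u + S0) = lookup fs S0"
      using top[of "u + S0"] S0 by (simp add: w_add lookup_monomial_mult)
    then have k0: "u + S0 \<in> keys (q * fs)" using S0 by (simp add: in_keys_iff)
    then have "q * fs \<noteq> 0" by auto
    from ideal_top_nonstd[OF \<open>q * fs \<in> ideal\<close> this]
    obtain M where M: "M \<in> keys (q * fs)" "\<not> std M" "w (u + S0) \<le> w M" using k0 by blast
    then have "M \<in> keys (single u 1 * fs)" using top[of M] S0 by (simp add: w_add in_keys_iff)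
    then obtain S where "M = u + S" "S \<in> keys fs" using keys_mult[of "single u 1" fs] by auto
    then have "std M" using fs_std[of S] u by (simp add: std_def lookup_add)
    then show False using M by simp
  qed
  then show ?thesis using f fi by simp
qed

lemma nonzerodivisor_power:
  assumes "leads w q u" "\<And>e. e < N \<Longrightarrow> lookup u (a e) = 0 \<and> lookup u (b e) = 0" "q ^ n * f \<in> ideal"
  shows "f \<in> ideal"
  using assms(3)
proof (induction n)
  case (Suc n)
  then have "q * (q ^ n * f) \<in> ideal" by (simp add: mult.assoc)
  then show ?case using nonzerodivisor[OF assms(1,2)] Suc.IH by blast
qed simp

end

section \<open>The hexagon of incidence relations\<close>

declare One_nat_def [simp del]

type_synonym hpol = "(nat \<times> nat) pol"

definition X :: "nat \<Rightarrow> nat \<Rightarrow> hpol" where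
  "X v c = single (single (v, c) 1) 1"

definition nxt :: "nat \<Rightarrow> nat" where "nxt e = (e + 1) mod 6"

definition hrel :: "nat \<Rightarrow> hpol" where
  "hrel e = (\<Sum>c<3. X e c * X (nxt e) c)"

definition cross :: "(nat \<Rightarrow> 'a::comm_ring) \<Rightarrow> (nat \<Rightarrow> 'a) \<Rightarrow> nat \<Rightarrow> 'a" where
  "cross p q k = (if k = 0 then p 1 * q 2 - p 2 * q 1 else if k = 1 then p 2 * q 0 - p 0 * q 2
     else p 0 * q 1 - p 1 * q 0)"

definition phi :: "nat \<Rightarrow> nat \<Rightarrow> hpol" where
  "phi v c = (if even v then X v c else cross (X (v - 1)) (X (nxt v)) c)"

lemma lessThan_3: "{..<3::nat} = {0,1,2}" by auto

lemma lessThan_6: "{..<6::nat} = {0,1,2,3,4,5}" by auto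

lemma less_6_cases: "e < (6::nat) \<Longrightarrow> e = 0 \<or> e = 1 \<or> e = 2 \<or> e = 3 \<or> e = 4 \<or> e = 5" by auto

lemma less_3_cases: "e < (3::nat) \<Longrightarrow> e = 0 \<or> e = 1 \<or> e = 2" by auto

lemma nxt_simps: "nxt 0 = 1" "nxt 1 = 2" "nxt 2 = 3" "nxt 3 = 4" "nxt 4 = 5" "nxt 5 = 0"
  by (simp_all add: nxt_def)

lemma nxt_less: "nxt e < 6" by (simp add: nxt_def)

lemma phi_orthogonal:
  assumes "e < 6"
  shows "(\<Sum>c<3. phi e c * phi (nxt e) c) = 0"
  using less_6_cases[OF assms]
  by (elim disjE) (simp_all add: phi_def nxt_simps cross_def lessThan_3 algebra_simps)

text \<open>Weights making \<open>X e (c e) * X (e+1) (c e)\<close> the leading monomials of the relations for the colours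
  \<open>c = 0, 1, 0, 1, 0, 2\<close>, and simultaneously \<open>X 0 1 * X 2 2\<close> the leading monomial of the first coordinate
  of the cross product of \<open>X 0\<close> and \<open>X 2\<close>; the variants are obtained by rotating the hexagon.\<close>
definition wt0 :: "nat \<Rightarrow> nat \<Rightarrow> nat" where
  "wt0 v c = [[2,0,0],[1,2,0],[0,0,1],[2,1,0],[4,6,0],[3,0,6]] ! v ! c"

definition col0 :: "nat \<Rightarrow> nat" where "col0 e = [0,1,0,1,0,2] ! e"

definition rot :: "nat \<Rightarrow> nat \<Rightarrow> nat" where "rot r v = (v + 6 - r) mod 6"

lemma wt0_simps:
  "wt0 0 0 = 2" "wt0 0 1 = 0" "wt0 0 2 = 0"
  "wt0 1 0 = 1" "wt0 1 1 = 2" "wt0 1 2 = 0"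
  "wt0 2 0 = 0" "wt0 2 1 = 0" "wt0 2 2 = 1"
  "wt0 3 0 = 2" "wt0 3 1 = 1" "wt0 3 2 = 0"
  "wt0 4 0 = 4" "wt0 4 1 = 6" "wt0 4 2 = 0"
  "wt0 5 0 = 3" "wt0 5 1 = 0" "wt0 5 2 = 6"
  by (simp_all add: wt0_def One_nat_def)

lemma col0_simps:
  "col0 0 = 0" "col0 1 = 1" "col0 2 = 0" "col0 3 = 1" "col0 4 = 0" "col0 5 = 2"
  by (simp_all add: col0_def One_nat_def)

lemma rot_simps:
  "rot 0 0 = 0" "rot 0 1 = 1" "rot 0 2 = 2" "rot 0 3 = 3" "rot 0 4 = 4" "rot 0 5 = 5"
  "rot 2 0 = 4" "rot 2 1 = 5" "rot 2 2 = 0" "rot 2 3 = 1" "rot 2 4 = 2" "rot 2 5 = 3"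
  "rot 4 0 = 2" "rot 4 1 = 3" "rot 4 2 = 4" "rot 4 3 = 5" "rot 4 4 = 0" "rot 4 5 = 1"
  by (simp_all add: rot_def)

lemma rot_less: "rot r e < 6" by (simp add: rot_def)

definition mwt :: "nat \<Rightarrow> (nat \<times> nat) mon \<Rightarrow> nat" where
  "mwt r M = (\<Sum>v<6. \<Sum>c<3. wt0 (rot r v) c * lookup M (v, c))"

lemma mwt_add: "mwt r (M + K) = mwt r M + mwt r K"
  by (simp add: mwt_def lookup_add distrib_left sum.distrib)

lemma mwt_single: "v < 6 \<Longrightarrow> c < 3 \<Longrightarrow> mwt r (single (v, c) 1) = wt0 (rot r v) c"
proof -
  assume vc: "v < 6" "c < 3"
  have "(\<Sum>c'<3. wt0 (rot r v') c' * lookup (single (v, c) 1) (v', c')) = (if v' = v then wt0 (rot r v) c else 0)" for v'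
  proof -
    have "wt0 (rot r v') c' * lookup (single (v, c) 1) (v', c') = (if c' = c then if v' = v then wt0 (rot r v) c else 0 else 0)" for c'
      by (simp add: lookup_single when_def)
    then show ?thesis using vc by simp
  qed
  then have "mwt r (single (v, c) 1) = (\<Sum>v'<6. if v' = v then wt0 (rot r v) c else 0)" by (simp add: mwt_def)
  then show ?thesis using vc by simp
qed

definition pr :: "nat \<Rightarrow> nat \<Rightarrow> nat \<Rightarrow> nat \<Rightarrow> (nat \<times> nat) mon" where
  "pr v c v' c' = single (v, c) 1 + single (v', c') 1"

lemma X_mult: "X v c * X v' c' = single (pr v c v' c') 1"
  by (simp add: X_def pr_def mult_single)

lemma mwt_pr: "v < 6 \<Longrightarrow> c < 3 \<Longrightarrow> v' < 6 \<Longrightarrow> c' < 3 \<Longrightarrow> mwt r (pr v c v' c') = wt0 (rot r v) c + wt0 (rot r v') c'"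
  by (simp add: pr_def mwt_add mwt_single)

lemma below_sum: "(\<And>i. i \<in> I \<Longrightarrow> below w W (p i)) \<Longrightarrow> below w W (\<Sum>i\<in>I. p i)"
  by (induction I rule: infinite_finite_induct) (auto intro: below_add, simp_all add: below_def)

lemma leads_hrel:
  assumes "e < 6" "k < 3" "\<And>c. c < 3 \<Longrightarrow> c \<noteq> k \<Longrightarrow>
     wt0 (rot r e) c + wt0 (rot r (nxt e)) c < wt0 (rot r e) k + wt0 (rot r (nxt e)) k"
  shows "leads (mwt r) (hrel e) (pr e k (nxt e) k)"
proof -
  have "hrel e - single (pr e k (nxt e) k) 1 = (\<Sum>c\<in>{..<3} - {k}. single (pr e c (nxt e) c) 1)"
    using assms(2) by (simp add: hrel_def X_mult sum.remove[of "{..<3}" k])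
  also have "below (mwt r) (mwt r (pr e k (nxt e) k)) \<dots>"
    by (rule below_sum) (use assms nxt_less in \<open>auto simp: below_def mwt_pr\<close>)
  finally show ?thesis by (simp add: leads_def)
qed

text \<open>At each vertex two consecutive edges meet, and their colours differ; so the twelve
  variables in the leading monomials are distinct.\<close>

lemma hexagon_locale:
  assumes "r \<in> {0,2,4}"
  shows "coprime_leading 6 hrel (\<lambda>e. (e, col0 (rot r e))) (\<lambda>e. (nxt e, col0 (rot r e))) (mwt r)"
proof
  show "mwt r (M + K) = mwt r M + mwt r K" for M K by (rule mwt_add)
  have c3: "col0 (rot r e) < 3" for e
    using less_6_cases[OF rot_less[of r e]] by (auto simp: col0_simps)
  show "leads (mwt r) (hrel e) (single (e, col0 (rot r e)) 1 + single (nxt e, col0 (rot r e)) 1)" if "e < 6" for e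
    unfolding pr_def[symmetric]
  proof (rule leads_hrel[OF that c3])
    fix c assume c: "c < (3::nat)" "c \<noteq> col0 (rot r e)"
    then show "wt0 (rot r e) c + wt0 (rot r (nxt e)) c
        < wt0 (rot r e) (col0 (rot r e)) + wt0 (rot r (nxt e)) (col0 (rot r e))"
      using less_6_cases[OF that] less_3_cases[OF c(1)] assms
      by (elim insertE disjE emptyE) (simp_all add: rot_simps nxt_simps wt0_simps col0_simps)
  qed
  show "inj_on (\<lambda>e. (e, col0 (rot r e))) {..<6}" by (auto simp: inj_on_def)
  show "inj_on (\<lambda>e. (nxt e, col0 (rot r e))) {..<6}"
  proof (rule inj_onI)
    fix e e' assume e: "e \<in> {..<6}" "e' \<in> {..<6}" "(nxt e, col0 (rot r e)) = (nxt e', col0 (rot r e'))"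
    then show "e = e'" using less_6_cases[of e] less_6_cases[of e'] by (auto simp: nxt_simps)
  qed
  show "(e, col0 (rot r e)) \<noteq> (nxt e', col0 (rot r e'))" if "e < 6" "e' < 6" for e e'
    using less_6_cases[OF that(2)] assms by (elim insertE disjE emptyE) (auto simp: nxt_simps rot_simps col0_simps)
qed

abbreviation hideal :: "hpol set" where "hideal \<equiv> coprime_leading.ideal 6 hrel"

text \<open>The leading monomial of \<open>phi v 0\<close> has to avoid the twelve variables used by
  the relations. This is what the single colour 2 is for: with 0 and 1 alternating all around, only
  colour 2 would be free at each vertex, while every monomial of a cross product combines two
  different colours.\<close>

lemma phi_nonzerodivisor:
  assumes "v \<in> {1,3,5}" "phi v 0 ^ n * f \<in> hideal"
  shows "f \<in> hideal"
proof -
  define r where "r = v - 1"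
  have r: "r \<in> {0,2,4}" using assms(1) by (auto simp: r_def)
  interpret coprime_leading 6 hrel "\<lambda>e. (e, col0 (rot r e))" "\<lambda>e. (nxt e, col0 (rot r e))" "mwt r"
    by (rule hexagon_locale[OF r])
  let ?s = "nxt (nxt r)"
  have phi: "phi v 0 = X r 1 * X ?s 2 - X r 2 * X ?s 1"
    using r assms(1) by (auto simp: phi_def cross_def r_def nxt_simps)
  show ?thesis
  proof (rule nonzerodivisor_power[OF _ _ assms(2)])
    have "phi v 0 - single (pr r 1 ?s 2) 1 = - single (pr r 2 ?s 1) 1"
      by (simp add: phi X_mult)
    moreover have "mwt r (pr r 2 ?s 1) < mwt r (pr r 1 ?s 2)"
      using r by (auto simp: mwt_pr nxt_simps rot_simps wt0_simps)
    ultimately show "leads (mwt r) (phi v 0) (pr r 1 ?s 2)"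
      by (simp add: leads_def below_def)
    show "lookup (pr r 1 ?s 2) (e, col0 (rot r e)) = 0 \<and> lookup (pr r 1 ?s 2) (nxt e, col0 (rot r e)) = 0"
      if "e < 6" for e
      using less_6_cases[OF that] r
      by (elim insertE disjE emptyE) (simp_all add: pr_def lookup_add lookup_single when_def nxt_simps rot_simps col0_simps)
  qed
qed

section \<open>Independence and spanning of the standard monomials\<close>

definition box :: "(nat \<times> nat) mon \<Rightarrow> bool" where
  "box M \<longleftrightarrow> keys M \<subseteq> {..<6} \<times> {..<3}"

text \<open>Evaluation of a monomial at \<open>y\<close>. The values may lie in any commutative
  monoid, since both polynomials (\<open>X\<close>, \<open>phi\<close>) and torus weights are
  substituted.\<close>

definition mprod :: "(nat \<Rightarrow> nat \<Rightarrow> 'a::comm_monoid_mult) \<Rightarrow> (nat \<times> nat) mon \<Rightarrow> 'a" where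
  "mprod y M = (\<Prod>v<6. \<Prod>c<3. y v c ^ lookup M (v, c))"

lemma mprod_add: "mprod y (M + K) = mprod y M * mprod y K"
  by (simp add: mprod_def lookup_add power_add prod.distrib)

lemma mprod_single: "v < 6 \<Longrightarrow> c < 3 \<Longrightarrow> mprod y (single (v, c) 1) = y v c"
proof -
  assume vc: "v < 6" "c < 3"
  have "(\<Prod>c'<3. y v' c' ^ lookup (single (v, c) 1) (v', c')) = (if v' = v then y v c else 1)" for v'
  proof -
    have "y v' c' ^ lookup (single (v, c) 1) (v', c') = (if c' = c then if v' = v then y v c else 1 else 1)" for c'
      by (simp add: lookup_single when_def)
    then show ?thesis using vc by simp
  qed
  then have "mprod y (single (v, c) 1) = (\<Prod>v'<6. if v' = v then y v c else 1)" by (simp add: mprod_def)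
  then show ?thesis using vc by simp
qed

lemma mprod_mult: "mprod (\<lambda>v c. y v c * z v c) M = mprod y M * mprod z M"
  by (simp add: mprod_def power_mult_distrib prod.distrib)

lemma mprod_X:
  assumes "box M" shows "mprod X M = single M 1"
proof -
  have pw: "X v c ^ k = single (single (v, c) k) 1" for v c k
    by (induction k) (simp_all add: X_def mult_single single_add[symmetric] Suc_eq_plus1_left[symmetric])
  have prs: "(\<Prod>i\<in>I. single (f i) (1::complex)) = single (\<Sum>i\<in>I. f i) 1" for I :: "nat set" and f :: "nat \<Rightarrow> (nat \<times> nat) mon"
    by (induction I rule: infinite_finite_induct) (simp_all add: mult_single)
  have "mprod X M = single (\<Sum>v<6. \<Sum>c<3. single (v, c) (lookup M (v, c))) 1"
    by (simp add: mprod_def pw prs)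
  also have "(\<Sum>v<6. \<Sum>c<3. single (v, c) (lookup M (v, c))) = M"
  proof (rule poly_mapping_eqI)
    fix k :: "nat \<times> nat" obtain u d where k: "k = (u, d)" by fastforce
    have "(\<Sum>c<3. lookup (single (v, c) (lookup M (v, c))) (u, d)) = (if v = u then if d < 3 then lookup M (u, d) else 0 else 0)" for v
    proof -
      have "lookup (single (v, c) (lookup M (v, c))) (u, d) = (if c = d then if v = u then lookup M (u, d) else 0 else 0)" for c
        by (simp add: lookup_single when_def)
      then show ?thesis by simp
    qed
    then have "lookup (\<Sum>v<6. \<Sum>c<3. single (v, c) (lookup M (v, c))) k
        = (\<Sum>v<6. if v = u then if d < 3 then lookup M (u, d) else 0 else 0)"
      by (simp add: lookup_sum k)
    also have "\<dots> = lookup M k" using assms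
      by (cases "u < 6"; cases "d < 3") (auto simp: k box_def in_keys_iff)
    finally show "lookup (\<Sum>v<6. \<Sum>c<3. single (v, c) (lookup M (v, c))) k = lookup M k" .
  qed
  finally show ?thesis .
qed

definition has_degree :: "(nat \<Rightarrow> nat) \<Rightarrow> (nat \<times> nat) mon \<Rightarrow> bool" where
  "has_degree d M \<longleftrightarrow> (\<forall>v<6. (\<Sum>c<3. lookup M (v, c)) = d v)"

lemma mprod_const: "has_degree d M \<Longrightarrow> mprod (\<lambda>v c. y v) M = (\<Prod>v<6. y v ^ d v)"
  by (simp add: mprod_def has_degree_def power_sum[symmetric])

definition hstd :: "(nat \<times> nat) mon \<Rightarrow> bool" where
  "hstd M \<longleftrightarrow> (\<forall>e<6. lookup M (e, col0 e) = 0 \<or> lookup M (nxt e, col0 e) = 0)"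

lemma rot_0: "e < 6 \<Longrightarrow> rot 0 e = e" by (simp add: rot_def)

text \<open>A vector orthogonal to \<open>p\<close> and \<open>q\<close> is proportional to their
  cross product. The multipliers of the two relations come from the triple product z \<times> (p
  \<times> q) = (z \<cdot> q) p - (z \<cdot> p) q.\<close>

lemma X_phi_proportional:
  assumes "v \<in> {1,3,5}" "c < 3"
  shows "phi v 0 * X v c - X v 0 * phi v c \<in> hideal"
proof -
  interpret coprime_leading 6 hrel "\<lambda>e. (e, col0 (rot 0 e))" "\<lambda>e. (nxt e, col0 (rot 0 e))" "mwt 0"
    by (rule hexagon_locale) simp
  let ?p = "X (v - 1)" and ?q = "X (nxt v)" and ?z = "X v"
  have r1: "hrel (v - 1) = ?p 0 * ?z 0 + ?p 1 * ?z 1 + ?p 2 * ?z 2"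
    using assms(1) by (auto simp: hrel_def nxt_simps lessThan_3 algebra_simps)
  have r2: "hrel v = ?z 0 * ?q 0 + ?z 1 * ?q 1 + ?z 2 * ?q 2"
    using assms(1) by (auto simp: hrel_def nxt_simps lessThan_3 algebra_simps)
  have ph: "phi v k = cross ?p ?q k" for k using assms(1) by (auto simp: phi_def)
  have in1: "a * hrel (v - 1) - b * hrel v \<in> ideal" for a b
    using assms(1) by (intro ideal_diff ideal_gen) auto
  have "\<exists>a b. phi v 0 * ?z c - ?z 0 * phi v c = a * hrel (v - 1) - b * hrel v"
    using less_3_cases[OF assms(2)]
  proof (elim disjE)
    assume "c = 0" then show ?thesis by (intro exI[of _ 0]) simp
  next
    assume c: "c = 1"
    show ?thesis unfolding c ph r1 r2 cross_def
      by (intro exI[of _ "?q 2"] exI[of _ "?p 2"]) (simp add: algebra_simps)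
  next
    assume c: "c = 2"
    show ?thesis unfolding c ph r1 r2 cross_def
      by (intro exI[of _ "- ?q 1"] exI[of _ "- ?p 1"]) (simp add: algebra_simps)
  qed
  then show ?thesis using in1 by metis
qed

lemma mprod_congruent:
  assumes "\<And>v c. v < 6 \<Longrightarrow> c < 3 \<Longrightarrow> y v c - z v c \<in> hideal"
  shows "mprod y M - mprod z M \<in> hideal"
proof -
  interpret coprime_leading 6 hrel "\<lambda>e. (e, col0 (rot 0 e))" "\<lambda>e. (nxt e, col0 (rot 0 e))" "mwt 0"
    by (rule hexagon_locale) simp
  have mult: "p * p' - q * q' \<in> ideal" if "p - q \<in> ideal" "p' - q' \<in> ideal" for p q p' q'
  proof -
    have "p * p' - q * q' = p' * (p - q) + q * (p' - q')" by (simp add: algebra_simps)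
    then show ?thesis using that by (simp add: ideal_add ideal_mult)
  qed
  have pow: "p ^ k - q ^ k \<in> ideal" if "p - q \<in> ideal" for p q k
    using that by (induction k) (auto intro: mult simp: ideal_zero)
  have prd: "(\<Prod>i<n. p i) - (\<Prod>i<n. q i) \<in> ideal" if "\<And>i. i < n \<Longrightarrow> p i - q i \<in> ideal" for p q :: "nat \<Rightarrow> hpol" and n
    using that by (induction n) (auto intro: mult simp: ideal_zero)
  show ?thesis unfolding mprod_def by (intro prd pow assms) auto
qed

text \<open>Multiplication by powers of one coordinate of each cross product turns a relation among
  the \<open>mprod phi j\<close> into one among the monomials \<open>j\<close>, modulo the ideal.
  Equal degrees at every vertex make the multiplier common to all \<open>j\<close>, and it can be
  cancelled.\<close>

theorem hexagon_independent:
  assumes fin: "finite J" and J: "\<And>j. j \<in> J \<Longrightarrow> box j \<and> hstd j \<and> has_degree d j"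
    and rel: "(\<Sum>j\<in>J. single 0 (a j) * mprod phi j) = 0" and j: "j \<in> J"
  shows "a j = 0"
proof -
  interpret coprime_leading 6 hrel "\<lambda>e. (e, col0 (rot 0 e))" "\<lambda>e. (nxt e, col0 (rot 0 e))" "mwt 0"
    by (rule hexagon_locale) simp
  define f where "f = (\<Sum>j\<in>J. single j (a j))"
  \<comment> \<open>\<open>?u v * X v c\<close> and \<open>?t v * phi v c\<close> agree modulo the
    ideal: by proportionality at odd vertices, and because \<open>phi v c\<close> is
    \<open>X v c\<close> at even ones.\<close>
  let ?u = "\<lambda>v. if odd v then phi v 0 else 1" and ?t = "\<lambda>v. if odd v then X v 0 else 1"
  have cong: "(\<Prod>v<6. ?u v ^ d v) * single i 1 - (\<Prod>v<6. ?t v ^ d v) * mprod phi i \<in> ideal" if "i \<in> J" for i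
  proof -
    have "mprod (\<lambda>v c. ?u v * X v c) i - mprod (\<lambda>v c. ?t v * phi v c) i \<in> ideal"
    proof (rule mprod_congruent)
      fix v c :: nat assume "v < 6" "c < 3"
      then show "?u v * X v c - ?t v * phi v c \<in> ideal"
        using X_phi_proportional[of v c] less_6_cases[of v] by (auto simp: phi_def ideal_zero)
    qed
    then show ?thesis
      using J[OF that] by (simp add: mprod_mult mprod_X mprod_const[of d i])
  qed
  have "(\<Prod>v<6. ?u v ^ d v) * f = (\<Sum>j\<in>J. single 0 (a j) * ((\<Prod>v<6. ?u v ^ d v) * single j 1))"
    by (simp add: f_def sum_distrib_left mult.left_commute[of "single 0 _"] single_scalar_mult)
  also have "\<dots> = (\<Sum>j\<in>J. single 0 (a j) * ((\<Prod>v<6. ?u v ^ d v) * single j 1 - (\<Prod>v<6. ?t v ^ d v) * mprod phi j))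
      + (\<Prod>v<6. ?t v ^ d v) * (\<Sum>j\<in>J. single 0 (a j) * mprod phi j)"
    by (simp add: right_diff_distrib sum_subtractf sum_distrib_left mult.left_commute)
  finally have "(\<Prod>v<6. ?u v ^ d v) * f \<in> ideal"
    using cong by (simp add: rel ideal_sum ideal_mult)
  moreover have "(\<Prod>v<6. ?u v ^ d v) = phi 1 0 ^ d 1 * (phi 3 0 ^ d 3 * phi 5 0 ^ d 5)"
    by (simp add: lessThan_6 mult_ac)
  ultimately have "phi 1 0 ^ d 1 * (phi 3 0 ^ d 3 * (phi 5 0 ^ d 5 * f)) \<in> ideal" by (simp add: mult.assoc)
  then have "phi 3 0 ^ d 3 * (phi 5 0 ^ d 5 * f) \<in> ideal" by (rule phi_nonzerodivisor[rotated]) simp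
  then have "phi 5 0 ^ d 5 * f \<in> ideal" by (rule phi_nonzerodivisor[rotated]) simp
  then have "f \<in> ideal" by (rule phi_nonzerodivisor[rotated]) simp
  have lf: "lookup f M = (\<Sum>j\<in>J. if j = M then a j else 0)" for M
    by (simp add: f_def lookup_sum lookup_single when_def)
  have "f = 0"
  proof (rule std_in_ideal_zero[OF \<open>f \<in> ideal\<close>])
    fix M assume "M \<in> keys f"
    then have "M \<in> J" using fin by (auto simp: in_keys_iff lf sum.delta split: if_splits)
    then show "std M" using J[of M] by (simp add: std_def hstd_def rot_0)
  qed
  then show ?thesis using lf[of j] fin j by (simp add: sum.delta)
qed

text \<open>Straightening: a nonstandard monomial contains a leading pair, which orthogonality
  trades for the pairs of the two other colours, of smaller weight \<open>mwt 0\<close>. The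
  assumption on \<open>y\<close> makes each exchange preserve the torus weight; the span records
  this because the trace computation depends on it.\<close>

theorem hexagon_spanning:
  fixes y :: "nat \<Rightarrow> nat \<Rightarrow> complex"
  assumes y: "\<And>e c. e < 6 \<Longrightarrow> c < 3 \<Longrightarrow> y e c * y (nxt e) c = W"
    and M: "box M" "has_degree d M"
  shows "scal_span (mprod phi) {j. box j \<and> hstd j \<and> has_degree d j \<and> mprod y j = mprod y M} (mprod phi M)"
  using M
proof (induction "mwt 0 M" arbitrary: M rule: less_induct)
  case less
  interpret coprime_leading 6 hrel "\<lambda>e. (e, col0 (rot 0 e))" "\<lambda>e. (nxt e, col0 (rot 0 e))" "mwt 0"
    by (rule hexagon_locale) simp
  show ?case
  proof (cases "hstd M")
    case True
    then show ?thesis using less.prems by (intro scal_span_base) simp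
  next
    case False
    then obtain e where e: "e < 6" "lookup M (e, col0 e) \<noteq> 0" "lookup M (nxt e, col0 e) \<noteq> 0"
      by (auto simp: hstd_def)
    have ne: "nxt e \<noteq> e" using less_6_cases[OF e(1)] by (auto simp: nxt_simps)
    have c3: "col0 e < 3" using less_6_cases[OF e(1)] by (auto simp: col0_simps)
    define K where "K = M - pr e (col0 e) (nxt e) (col0 e)"
    have MK: "M = pr e (col0 e) (nxt e) (col0 e) + K"
      using e ne by (intro poly_mapping_eqI) (auto simp: K_def pr_def lookup_add lookup_minus lookup_single when_def)
    define M' where "M' c = pr e c (nxt e) c + K" for c
    have boxK: "box K" using less.prems(1) unfolding MK box_def
      by (auto simp: subset_iff in_keys_iff lookup_add)
    have box': "box (M' c)" if "c < 3" for c
      unfolding box_def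
    proof
      fix k assume "k \<in> keys (M' c)"
      then have "k \<in> keys K \<or> k = (e, c) \<or> k = (nxt e, c)"
        by (auto simp: M'_def pr_def in_keys_iff lookup_add lookup_single when_def split: if_splits)
      then show "k \<in> {..<6} \<times> {..<3}" using boxK e that nxt_less by (auto simp: box_def)
    qed
    have lk_pr: "(\<Sum>k<3. lookup (pr e c (nxt e) c) (v, k)) = (if v = e \<or> v = nxt e then 1 else 0)" if "c < 3" for c v
      using less_3_cases[OF that] ne by (auto simp: pr_def lookup_add lookup_single when_def lessThan_3)
    have deg': "has_degree d (M' c)" if "c < 3" for c
      using less.prems(2) lk_pr[OF that] lk_pr[OF c3]
      by (simp add: has_degree_def M'_def MK lookup_add sum.distrib)
    have mp: "mprod z (M' c) = z e c * z (nxt e) c * mprod z K" if "c < 3"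
      for z :: "nat \<Rightarrow> nat \<Rightarrow> 'a::comm_monoid_mult" and c
      using that e nxt_less by (simp add: M'_def pr_def mprod_add mprod_single)
    have MM: "M = M' (col0 e)" by (simp add: M'_def MK)
    have wty: "mprod y (M' c) = mprod y M" if "c < 3" for c
      using mp[OF that, of y] mp[OF c3, of y] y e that c3 by (simp add: MM)
    have small: "mwt 0 (M' c) < mwt 0 M" if "c < 3" "c \<noteq> col0 e" for c
    proof -
      have "mwt 0 (pr e c (nxt e) c) < mwt 0 (pr e (col0 e) (nxt e) (col0 e))"
        using less_6_cases[OF e(1)] less_3_cases[OF that(1)] that(2)
        by (elim disjE) (simp_all add: mwt_pr nxt_simps rot_simps wt0_simps col0_simps)
      then show ?thesis by (simp add: M'_def MK mwt_add)
    qed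
    have "(\<Sum>c<3. mprod phi (M' c)) = (\<Sum>c<3. phi e c * phi (nxt e) c) * mprod phi K"
      unfolding sum_distrib_right by (intro sum.cong refl) (simp add: mp)
    then have "(\<Sum>c<3. mprod phi (M' c)) = 0" using phi_orthogonal[OF e(1)] by simp
    then have "mprod phi M = 0 - (\<Sum>c\<in>{..<3} - {col0 e}. mprod phi (M' c))"
      using c3 by (simp add: MM sum.remove[of "{..<3}" "col0 e"] eq_neg_iff_add_eq_0)
    moreover have "scal_span (mprod phi) {j. box j \<and> hstd j \<and> has_degree d j \<and> mprod y j = mprod y M} (mprod phi (M' c))"
      if "c \<in> {..<3} - {col0 e}" for c
      using less.hyps[OF small box' deg'] wty that by simp
    ultimately show ?thesis by (simp only:) (intro scal_span_diff scal_span_zero scal_span_sum)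
  qed
qed

section \<open>Summing the weights of the standard monomials\<close>

declare One_nat_def [simp del]

lemma box_lookup: "box M \<Longrightarrow> \<not> (v < 6 \<and> c < 3) \<Longrightarrow> lookup M (v, c) = 0"
  by (auto simp: box_def in_keys_iff subset_iff)

definition prv :: "nat \<Rightarrow> nat" where "prv v = (v + 5) mod 6"

lemma prv_nxt: "v < 6 \<Longrightarrow> prv (nxt v) = v" "v < 6 \<Longrightarrow> nxt (prv v) = v" "prv v < 6"
  using less_6_cases[of v] by (auto simp: prv_def nxt_def)

text \<open>Expanding the edge factors over sets \<open>S\<close> of edges decouples the vertices.
  The total therefore depends on the index sets only through the vertex sums on the right, and two
  models with equal vertex sums have equal totals.\<close>

lemma hexagon_moments:
  fixes w p q :: "nat \<Rightarrow> 'i \<Rightarrow> 'a::comm_ring_1"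
  assumes fin: "\<And>v. v < 6 \<Longrightarrow> finite (A v)"
  shows "(\<Sum>k\<in>PiE {..<6} A. (\<Prod>v<6. w v (k v)) * (\<Prod>e<6. 1 - p e (k e) * q (nxt e) (k (nxt e))))
    = (\<Sum>S\<in>Pow {..<6}. (-1) ^ card S * (\<Prod>v<6. \<Sum>k\<in>A v. w v k * ((if v \<in> S then p v k else 1) * (if prv v \<in> S then q v k else 1))))"
proof -
  let ?g = "\<lambda>S v k. w v k * ((if v \<in> S then p v k else 1) * (if prv v \<in> S then q v k else 1))"
  have exp: "(\<Prod>v<6. w v (k v)) * (\<Prod>e<6. 1 - p e (k e) * q (nxt e) (k (nxt e)))
      = (\<Sum>S\<in>Pow {..<6}. (-1) ^ card S * (\<Prod>v<6. ?g S v (k v)))" for k :: "nat \<Rightarrow> 'i"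
  proof -
    have "(\<Prod>e<6. 1 - p e (k e) * q (nxt e) (k (nxt e)))
        = (\<Prod>e<6. - (p e (k e) * q (nxt e) (k (nxt e))) + 1)" by simp
    also have "\<dots> = (\<Sum>S\<in>Pow {..<6}. (\<Prod>e\<in>S. - (p e (k e) * q (nxt e) (k (nxt e)))) * (\<Prod>e\<in>{..<6} - S. 1))"
      by (rule prod_add) simp
    also have "\<dots> = (\<Sum>S\<in>Pow {..<6}. (-1) ^ card S * (\<Prod>v<6. (if v \<in> S then p v (k v) else 1) * (if prv v \<in> S then q v (k v) else 1)))"
    proof (intro sum.cong refl)
      fix S assume S: "S \<in> Pow {..<6::nat}"
      have "(\<Prod>e\<in>S. - (p e (k e) * q (nxt e) (k (nxt e)))) = (-1) ^ card S * (\<Prod>e\<in>S. p e (k e) * q (nxt e) (k (nxt e)))"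
        by (simp add: prod_uminus)
      also have "(\<Prod>e\<in>S. p e (k e) * q (nxt e) (k (nxt e))) = (\<Prod>e\<in>S. p e (k e)) * (\<Prod>e\<in>S. q (nxt e) (k (nxt e)))"
        by (rule prod.distrib)
      also have "(\<Prod>e\<in>S. p e (k e)) = (\<Prod>v<6. if v \<in> S then p v (k v) else 1)"
        using S by (simp add: prod.inter_restrict[symmetric] Int_absorb1)
      also have "(\<Prod>e\<in>S. q (nxt e) (k (nxt e))) = (\<Prod>v\<in>{v\<in>{..<6}. prv v \<in> S}. q v (k v))"
        using S by (intro prod.reindex_bij_witness[of _ prv nxt]) (auto simp: prv_nxt nxt_less)
      also have "\<dots> = (\<Prod>v<6. if prv v \<in> S then q v (k v) else 1)"
        by (rule prod.inter_filter) simp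
      finally show "(\<Prod>e\<in>S. - (p e (k e) * q (nxt e) (k (nxt e)))) * (\<Prod>e\<in>{..<6} - S. 1)
          = (-1) ^ card S * (\<Prod>v<6. (if v \<in> S then p v (k v) else 1) * (if prv v \<in> S then q v (k v) else 1))"
        by (simp add: prod.distrib)
    qed
    finally show ?thesis by (simp add: sum_distrib_left prod.distrib mult_ac)
  qed
  have "(\<Sum>k\<in>PiE {..<6} A. (\<Prod>v<6. w v (k v)) * (\<Prod>e<6. 1 - p e (k e) * q (nxt e) (k (nxt e))))
      = (\<Sum>S\<in>Pow {..<6}. \<Sum>k\<in>PiE {..<6} A. (-1) ^ card S * (\<Prod>v<6. ?g S v (k v)))"
    by (simp only: exp) (rule sum.swap)
  also have "\<dots> = (\<Sum>S\<in>Pow {..<6}. (-1) ^ card S * (\<Prod>v<6. \<Sum>k\<in>A v. ?g S v k))"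
  proof (intro sum.cong refl)
    fix S
    have "(\<Prod>v<6. \<Sum>k\<in>A v. ?g S v k) = (\<Sum>k\<in>PiE {..<6} A. \<Prod>v<6. ?g S v (k v))"
      by (rule prod_sum_PiE) (use fin in auto)
    then show "(\<Sum>k\<in>PiE {..<6} A. (-1) ^ card S * (\<Prod>v<6. ?g S v (k v))) = (-1) ^ card S * (\<Prod>v<6. \<Sum>k\<in>A v. ?g S v k)"
      by (simp add: sum_distrib_left)
  qed
  finally show ?thesis .
qed

section \<open>Complete homogeneous polynomials as sums over fixed points\<close>

definition compositions :: "nat set \<Rightarrow> nat \<Rightarrow> (nat \<Rightarrow> nat) set" where
  "compositions I d = {k. (\<forall>c. c \<notin> I \<longrightarrow> k c = 0) \<and> (\<Sum>c\<in>I. k c) = d}"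

lemma finite_compositions: "finite I \<Longrightarrow> finite (compositions I d)"
proof -
  assume I: "finite I"
  have "compositions I d \<subseteq> {k. \<forall>c. (c \<in> I \<longrightarrow> k c \<in> {..d}) \<and> (c \<notin> I \<longrightarrow> k c = 0)}"
    using member_le_sum[OF _ _ I] by (fastforce simp: compositions_def)
  then show ?thesis by (rule finite_subset) (rule finite_set_of_finite_funs[OF I], simp)
qed

text \<open>The complete homogeneous symmetric polynomial of degree \<open>d\<close> in the
  variables \<open>y c\<close>.\<close>

definition hsum :: "(nat \<Rightarrow> complex) \<Rightarrow> nat set \<Rightarrow> nat \<Rightarrow> complex" where
  "hsum y I d = (\<Sum>k\<in>compositions I d. \<Prod>c\<in>I. y c ^ k c)"

lemma compositions_shift:
  assumes I: "finite I" "i \<in> I"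
  shows "(\<Sum>k\<in>compositions I (Suc d). if k i > 0 then F k else (0::complex)) = (\<Sum>k\<in>compositions I d. F (k(i := Suc (k i))))"
proof -
  have s: "(\<Sum>c\<in>I. (k(i := z)) c) = z + (\<Sum>c\<in>I - {i}. k c)" for k :: "nat \<Rightarrow> nat" and z
    using I by (subst sum.remove[of I i]) auto
  have s': "(\<Sum>c\<in>I. k c) = k i + (\<Sum>c\<in>I - {i}. k c)" for k :: "nat \<Rightarrow> nat"
    using I by (subst sum.remove[of I i]) auto
  have "(\<Sum>k\<in>compositions I (Suc d). if k i > 0 then F k else 0) = (\<Sum>k\<in>{k\<in>compositions I (Suc d). k i > 0}. F k)"
    by (rule sum.inter_filter[OF finite_compositions[OF I(1)], symmetric])
  also have "\<dots> = (\<Sum>k\<in>compositions I d. F (k(i := Suc (k i))))"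
    by (rule sum.reindex_bij_witness[of _ "\<lambda>k. k(i := Suc (k i))" "\<lambda>k. k(i := k i - 1)"])
       (use I in \<open>auto simp: compositions_def s s' simp del: fun_upd_apply, auto\<close>)
  finally show ?thesis .
qed

lemma prod_power_upd:
  assumes "finite I" "i \<in> I"
  shows "(\<Prod>c\<in>I. y c ^ (k(i := Suc (k i))) c) = (y i :: complex) * (\<Prod>c\<in>I. y c ^ k c)"
  using assms by (subst (1 2) prod.remove[of I i]) auto

lemma hsum_Suc:
  assumes I: "finite I" "i \<in> I"
  shows "hsum y I (Suc d) = y i * hsum y I d + hsum y (I - {i}) (Suc d)"
proof -
  have "hsum y I (Suc d) = (\<Sum>k\<in>compositions I (Suc d). if k i > 0 then \<Prod>c\<in>I. y c ^ k c else 0)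
      + (\<Sum>k\<in>compositions I (Suc d). if k i = 0 then \<Prod>c\<in>I. y c ^ k c else 0)"
    unfolding hsum_def sum.distrib[symmetric] by (intro sum.cong) auto
  also have "(\<Sum>k\<in>compositions I (Suc d). if k i > 0 then \<Prod>c\<in>I. y c ^ k c else 0) = y i * hsum y I d"
    unfolding compositions_shift[OF I] hsum_def sum_distrib_left by (intro sum.cong refl prod_power_upd I)
  also have "(\<Sum>k\<in>compositions I (Suc d). if k i = 0 then \<Prod>c\<in>I. y c ^ k c else 0)
      = (\<Sum>k\<in>{k\<in>compositions I (Suc d). k i = 0}. \<Prod>c\<in>I. y c ^ k c)"
    by (rule sum.inter_filter[OF finite_compositions[OF I(1)], symmetric])
  also have "\<dots> = hsum y (I - {i}) (Suc d)"
    unfolding hsum_def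
  proof (rule sum.cong)
    have "(\<Sum>c\<in>I. k c) = k i + (\<Sum>c\<in>I - {i}. k c)" for k :: "nat \<Rightarrow> nat"
      using I by (subst sum.remove[of I i]) auto
    then show "{k \<in> compositions I (Suc d). k i = 0} = compositions (I - {i}) (Suc d)"
      by (auto simp: compositions_def)
    fix k assume "k \<in> compositions (I - {i}) (Suc d)"
    then show "(\<Prod>c\<in>I. y c ^ k c) = (\<Prod>c\<in>I - {i}. y c ^ k c)"
      using I by (subst prod.remove[of I i]) (auto simp: compositions_def)
  qed
  finally show ?thesis .
qed

lemma hsum_zero: "finite I \<Longrightarrow> hsum y I 0 = 1"
proof -
  assume "finite I"
  then have "compositions I 0 = {\<lambda>_. 0}" by (auto simp: compositions_def)
  then show ?thesis by (simp add: hsum_def)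
qed

lemma hsum_empty: "hsum y {} (Suc d) = 0"
  by (simp add: hsum_def compositions_def)

lemma hsum_1: "hsum y {c} d = y c ^ d"
  by (induction d) (simp_all add: hsum_zero hsum_Suc hsum_empty)

lemma hsum_2:
  assumes "b \<noteq> c" "y b \<noteq> y c"
  shows "hsum y {b,c} d = (y b ^ Suc d - y c ^ Suc d) / (y b - y c)"
proof (induction d)
  case 0 show ?case using assms by (simp add: hsum_zero)
next
  case (Suc d)
  have "hsum y {b,c} (Suc d) = y b * hsum y {b,c} d + y c ^ Suc d"
    using assms hsum_Suc[of "{b,c}" b y d] by (simp add: hsum_1 insert_Diff_if)
  then show ?case using assms by (simp add: Suc field_simps)
qed

text \<open>For nonzero \<open>y a\<close>, the local factor of a fixed point of the projective
  plane, the product of the 1 / (1 - \<open>y b / y a\<close>); the degree enters separately as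
  \<open>y a ^ d\<close>.\<close>

definition lag :: "(nat \<Rightarrow> complex) \<Rightarrow> nat \<Rightarrow> complex" where
  "lag y a = (\<Prod>b\<in>{..<3} - {a}. y a / (y a - y b))"

lemma lag_simps:
  "lag y 0 = y 0 / (y 0 - y 1) * (y 0 / (y 0 - y 2))"
  "lag y 1 = y 1 / (y 1 - y 0) * (y 1 / (y 1 - y 2))"
  "lag y 2 = y 2 / (y 2 - y 0) * (y 2 / (y 2 - y 1))"
proof -
  have "{..<3} - {0} = {1,2::nat}" "{..<3} - {1} = {0,2::nat}" "{..<3} - {2} = {0,1::nat}" by auto
  then show "lag y 0 = y 0 / (y 0 - y 1) * (y 0 / (y 0 - y 2))"
  "lag y 1 = y 1 / (y 1 - y 0) * (y 1 / (y 1 - y 2))"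
  "lag y 2 = y 2 / (y 2 - y 0) * (y 2 / (y 2 - y 1))" by (simp_all add: lag_def)
qed

lemma hsum_3:
  assumes y: "y 0 \<noteq> y 1" "y 0 \<noteq> y 2" "y 1 \<noteq> (y 2 :: complex)"
  shows "hsum y {..<3} d = (\<Sum>a<3. y a ^ d * lag y a)"
proof (induction d)
  case 0
  have "y 0 / (y 0 - y 1) * (y 0 / (y 0 - y 2)) + (y 1 / (y 1 - y 0) * (y 1 / (y 1 - y 2)) + y 2 / (y 2 - y 0) * (y 2 / (y 2 - y 1))) = 1"
    using y by (simp add: divide_simps) (simp add: algebra_simps)
  then show ?case by (simp add: hsum_zero lessThan_3 lag_simps)
next
  case (Suc d)
  have set: "{..<3} - {0} = {1,2::nat}" by auto
  have "hsum y {..<3} (Suc d) = y 0 * (\<Sum>a<3. y a ^ d * lag y a) + (y 1 ^ Suc (Suc d) - y 2 ^ Suc (Suc d)) / (y 1 - y 2)"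
    using hsum_Suc[of "{..<3}" 0 y d] y by (simp add: Suc set hsum_2)
  also have "\<dots> = (\<Sum>a<3. y a ^ Suc d * lag y a)"
  proof -
    have "y 0 * (u * (y 0 / (y 0 - y 1) * (y 0 / (y 0 - y 2))) + (v * (y 1 / (y 1 - y 0) * (y 1 / (y 1 - y 2))) + w * (y 2 / (y 2 - y 0) * (y 2 / (y 2 - y 1)))))
       + (y 1 * (y 1 * v) - y 2 * (y 2 * w)) / (y 1 - y 2) =
       y 0 * u * (y 0 / (y 0 - y 1) * (y 0 / (y 0 - y 2))) + (y 1 * v * (y 1 / (y 1 - y 0) * (y 1 / (y 1 - y 2))) + y 2 * w * (y 2 / (y 2 - y 0) * (y 2 / (y 2 - y 1))))"
      for u v w
      using y by (simp add: divide_simps) (simp add: algebra_simps)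
    from this[of "y 0 ^ d" "y 1 ^ d" "y 2 ^ d"] show ?thesis by (simp add: lessThan_3 lag_simps)
  qed
  finally show ?case .
qed

text \<open>The fixed point formula for degrees -1 and -2, where complete homogeneous polynomials
  are zero. It covers the case of degree 0, in which no exponent can be positive.\<close>

lemma lag_vanish:
  assumes y: "y 0 \<noteq> y 1" "y 0 \<noteq> y 2" "y 1 \<noteq> (y 2 :: complex)" "y 0 \<noteq> 0" "y 1 \<noteq> 0" "y 2 \<noteq> 0"
  shows "(\<Sum>a<3. lag y a / y a) = 0" "(\<Sum>a<3. lag y a / (y a * y a)) = 0"
proof -
  have "y 0 / (y 0 - y 1) * (y 0 / (y 0 - y 2)) / y 0 + (y 1 / (y 1 - y 0) * (y 1 / (y 1 - y 2)) / y 1 + y 2 / (y 2 - y 0) * (y 2 / (y 2 - y 1)) / y 2) = 0"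
    using y by (simp add: divide_simps) (simp add: algebra_simps)
  then show "(\<Sum>a<3. lag y a / y a) = 0" by (simp add: lessThan_3 lag_simps)
  have "y 0 / (y 0 - y 1) * (y 0 / (y 0 - y 2)) / (y 0 * y 0) + (y 1 / (y 1 - y 0) * (y 1 / (y 1 - y 2)) / (y 1 * y 1) + y 2 / (y 2 - y 0) * (y 2 / (y 2 - y 1)) / (y 2 * y 2)) = 0"
    using y by (simp add: divide_simps) (simp add: algebra_simps)
  then show "(\<Sum>a<3. lag y a / (y a * y a)) = 0" by (simp add: lessThan_3 lag_simps)
qed

text \<open>The condition \<open>k i > 0\<close> splits off a factor \<open>y i\<close> and lowers
  the degree by one; at the fixed point \<open>a\<close> this is multiplication by
  \<open>y i / y a\<close>. Two conditions at different colours do so twice.\<close>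

lemma vertex_moments:
  fixes y :: "nat \<Rightarrow> complex"
  assumes y: "inj_on y {..<3}" "\<And>c. c < 3 \<Longrightarrow> y c \<noteq> 0" and ij: "i < 3" "j < 3" "i \<noteq> j"
  shows "(\<Sum>k\<in>compositions {..<3} d. (\<Prod>c<3. y c ^ k c) *
      ((if P then (if k i > 0 then 1 else 0) else 1) * (if Q then (if k j > 0 then 1 else 0) else 1)))
    = (\<Sum>a<3. (y a ^ d * lag y a) * ((if P then y i / y a else 1) * (if Q then y j / y a else 1)))"
proof -
  let ?m = "\<lambda>k. \<Prod>c<3. y c ^ k c" and ?A = "compositions {..<3}"
  have yy: "y 0 \<noteq> y 1" "y 0 \<noteq> y 2" "y 1 \<noteq> y 2" by (simp_all add: inj_on_eq_iff[OF y(1)])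
  have y0: "y 0 \<noteq> 0" "y 1 \<noteq> 0" "y 2 \<noteq> 0" using y(2) by auto
  have h: "(\<Sum>k\<in>?A d. ?m k) = (\<Sum>a<3. y a ^ d * lag y a)" for d using hsum_3[OF yy, of d] by (simp add: hsum_def)
  have pw: "y a ^ Suc d / y a = y a ^ d" if "a < 3" for a d using y(2)[OF that] by simp
  have one: "(\<Sum>k\<in>?A d. if k i > 0 then ?m k else 0) = (\<Sum>a<3. y a ^ d * lag y a * (y i / y a))" if i: "i < 3" for i d
  proof (cases d)
    case 0
    have "?A 0 = {\<lambda>_. 0}" by (auto simp: compositions_def)
    moreover have "(\<Sum>a<3. y a ^ 0 * lag y a * (y i / y a)) = y i * (\<Sum>a<3. lag y a / y a)"
      by (simp add: sum_distrib_left mult_ac)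
    ultimately show ?thesis using lag_vanish[OF yy y0] 0 by simp
  next
    case (Suc e)
    have "(\<Sum>k\<in>?A d. if k i > 0 then ?m k else 0) = y i * (\<Sum>k\<in>?A e. ?m k)"
      unfolding Suc using i by (subst compositions_shift) (auto simp: prod_power_upd sum_distrib_left simp del: fun_upd_apply)
    also have "\<dots> = (\<Sum>a<3. y i * (y a ^ e * lag y a))" unfolding h by (rule sum_distrib_left)
    also have "\<dots> = (\<Sum>a<3. y a ^ d * lag y a * (y i / y a))"
      unfolding Suc using y(2) by (intro sum.cong refl) (simp add: field_simps)
    finally show ?thesis .
  qed
  have both: "(\<Sum>k\<in>?A d. if k i > 0 then if k j > 0 then ?m k else 0 else 0) = (\<Sum>a<3. y a ^ d * lag y a * (y i / y a * (y j / y a)))"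
  proof (cases d)
    case 0
    have "?A 0 = {\<lambda>_. 0}" by (auto simp: compositions_def)
    moreover have "(\<Sum>a<3. y a ^ 0 * lag y a * (y i / y a * (y j / y a))) = y i * y j * (\<Sum>a<3. lag y a / (y a * y a))"
      by (simp add: sum_distrib_left mult_ac)
    ultimately show ?thesis using lag_vanish[OF yy y0] 0 by simp
  next
    case (Suc e)
    have "(\<Sum>k\<in>?A d. if k i > 0 then if k j > 0 then ?m k else 0 else 0)
        = (\<Sum>k\<in>?A e. if (k(i := Suc (k i))) j > 0 then ?m (k(i := Suc (k i))) else 0)"
      unfolding Suc using ij by (subst compositions_shift) auto
    also have "\<dots> = (\<Sum>k\<in>?A e. y i * (if k j > 0 then ?m k else 0))"
    proof (intro sum.cong refl)
      fix k
      show "(if (k(i := Suc (k i))) j > 0 then ?m (k(i := Suc (k i))) else 0) = y i * (if k j > 0 then ?m k else 0)"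
        using ij prod_power_upd[of "{..<3}" i y k] by (simp del: fun_upd_apply) simp
    qed
    also have "\<dots> = y i * (\<Sum>a<3. y a ^ e * lag y a * (y j / y a))"
      by (simp only: sum_distrib_left[symmetric] one[OF ij(2)])
    also have "\<dots> = (\<Sum>a<3. y i * (y a ^ e * lag y a * (y j / y a)))" by (rule sum_distrib_left)
    also have "\<dots> = (\<Sum>a<3. y a ^ d * lag y a * (y i / y a * (y j / y a)))"
      unfolding Suc using y(2) by (intro sum.cong refl) (simp add: field_simps)
    finally show ?thesis .
  qed
  have e1: "(\<Sum>k\<in>?A d. ?m k * (if k i > 0 then 1 else 0)) = (\<Sum>k\<in>?A d. if k i > 0 then ?m k else 0)" for i
    by (intro sum.cong) auto
  have e2: "(\<Sum>k\<in>?A d. ?m k * ((if k i > 0 then 1 else 0) * (if k j > 0 then 1 else 0))) = (\<Sum>k\<in>?A d. if k i > 0 then if k j > 0 then ?m k else 0 else 0)"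
    by (intro sum.cong) auto
  show ?thesis
  proof (cases P; cases Q)
    assume "P" "Q" then show ?thesis using both e2 by simp
  next
    assume "P" "\<not> Q" then show ?thesis using one[OF ij(1), of d] e1[of i] by simp
  next
    assume "\<not> P" "Q" then show ?thesis using one[OF ij(2), of d] e1[of j] by simp
  next
    assume "\<not> P" "\<not> Q" then show ?thesis using h[of d] by simp
  qed
qed

section \<open>The weight sum of the standard monomials\<close>

definition std_mons :: "(nat \<Rightarrow> nat) \<Rightarrow> (nat \<times> nat) mon set" where
  "std_mons d = {j. box j \<and> hstd j \<and> has_degree d j}"

lemma col0_less: "e < 6 \<Longrightarrow> col0 e < 3"
  using less_6_cases[of e] by (auto simp: col0_simps)

lemma bij_mons_compositions:
  "bij_betw (\<lambda>j. \<lambda>v\<in>{..<6}. \<lambda>c. lookup j (v, c)) {j. box j \<and> has_degree d j} (PiE {..<6} (\<lambda>v. compositions {..<3} (d v)))"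
    (is "bij_betw ?f ?A ?B")
proof (rule bij_betwI[where g = "\<lambda>k. Abs_poly_mapping (\<lambda>(v,c). if v < 6 then k v c else 0)"])
  show "?f \<in> ?A \<rightarrow> ?B"
    by (auto simp: has_degree_def compositions_def box_lookup)
  have fin: "finite {z. (case z of (v,c) \<Rightarrow> if v < 6 then k v c else 0) \<noteq> (0::nat)}" if "k \<in> ?B" for k
    by (rule finite_subset[of _ "{..<6} \<times> {..<3}"]) (use that in \<open>auto simp: PiE_def Pi_def compositions_def split: if_splits\<close>, metis gr_implies_not0)
  have lk: "lookup (Abs_poly_mapping (\<lambda>(v,c). if v < 6 then k v c else 0)) (v, c) = (if v < 6 then k v c else 0)" if "k \<in> ?B" for k v c
    using lookup_Abs_poly_mapping[OF fin[OF that]] by simp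
  show "(\<lambda>k. Abs_poly_mapping (\<lambda>(v,c). if v < 6 then k v c else 0)) \<in> ?B \<rightarrow> ?A"
  proof
    fix k assume k: "k \<in> ?B"
    then have kc: "k v \<in> compositions {..<3} (d v)" if "v < 6" for v using that by auto
    show "Abs_poly_mapping (\<lambda>(v,c). if v < 6 then k v c else 0) \<in> ?A"
      using kc by (auto simp: box_def has_degree_def in_keys_iff lk[OF k] compositions_def split: if_splits)
        (metis gr_implies_not0)
  qed
  show "Abs_poly_mapping (\<lambda>(v,c). if v < 6 then ?f j v c else 0) = j" if j: "j \<in> ?A" for j
  proof (rule poly_mapping_eqI)
    fix z :: "nat \<times> nat" obtain v c where z: "z = (v, c)" by fastforce
    have fB: "?f j \<in> ?B" using j by (auto simp: has_degree_def compositions_def box_lookup)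
    show "lookup (Abs_poly_mapping (\<lambda>(v,c). if v < 6 then ?f j v c else 0)) z = lookup j z"
      unfolding z lk[OF fB] using j by (auto simp: box_lookup)
  qed
  show "?f (Abs_poly_mapping (\<lambda>(v,c). if v < 6 then k v c else 0)) = k" if k: "k \<in> ?B" for k
  proof
    fix v show "?f (Abs_poly_mapping (\<lambda>(v,c). if v < 6 then k v c else 0)) v = k v"
      using k by (cases "v < 6") (auto simp: lk[OF k] PiE_def extensional_def)
  qed
qed

lemma finite_std_mons: "finite (std_mons d)"
proof -
  have "finite {j. box j \<and> has_degree d j}"
    using bij_betw_finite[OF bij_mons_compositions[of d]] by (simp add: finite_PiE finite_compositions)
  then show ?thesis by (rule rev_finite_subset) (auto simp: std_mons_def)
qed

text \<open>Standardness is a product of edge factors 1 - p q with p and q equal to 0 or 1, so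
  \<open>hexagon_moments\<close> applies on both sides. In the fixed point model the factor has
  numerator \<open>y e c * y (nxt e) c\<close> at \<open>c = col0 e\<close>, which is
  \<open>W\<close> for every colour.\<close>

theorem std_mons_sum:
  fixes y :: "nat \<Rightarrow> nat \<Rightarrow> complex"
  assumes y: "\<And>v. v < 6 \<Longrightarrow> inj_on (y v) {..<3}" "\<And>v c. v < 6 \<Longrightarrow> c < 3 \<Longrightarrow> y v c \<noteq> 0"
    and W: "\<And>e c. e < 6 \<Longrightarrow> c < 3 \<Longrightarrow> y e c * y (nxt e) c = W"
  shows "(\<Sum>j\<in>std_mons d. mprod y j) = (\<Sum>a\<in>PiE {..<6} (\<lambda>_. {..<3}).
     (\<Prod>v<6. y v (a v) ^ d v * lag (y v) (a v)) * (\<Prod>e<6. 1 - W / (y e (a e) * y (nxt e) (a (nxt e)))))"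
proof -
  let ?C = "\<lambda>v. compositions {..<3} (d v)" and ?A = "{j. box j \<and> has_degree d j}"
  let ?p = "\<lambda>v k. if k (col0 v) > 0 then 1 else (0::complex)"
  let ?q = "\<lambda>v k. if k (col0 (prv v)) > 0 then 1 else (0::complex)"
  let ?p' = "\<lambda>v a. y v (col0 v) / y v a" and ?q' = "\<lambda>v a. y v (col0 (prv v)) / y v a"
  let ?w = "\<lambda>v k. \<Prod>c<3. y v c ^ k c"
  have finA: "finite ?A"
    using bij_betw_finite[OF bij_mons_compositions[of d]] by (simp add: finite_PiE finite_compositions)
  have std01: "(\<Prod>e<6. 1 - ?p e (\<lambda>c. lookup j (e, c)) * ?q (nxt e) (\<lambda>c. lookup j (nxt e, c))) = (if hstd j then 1 else 0)" for j
  proof (cases "hstd j")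
    case True
    then have "(\<Prod>e<6. 1 - ?p e (\<lambda>c. lookup j (e, c)) * ?q (nxt e) (\<lambda>c. lookup j (nxt e, c))) = 1"
      by (intro prod.neutral) (auto simp: hstd_def prv_nxt)
    then show ?thesis using True by simp
  next
    case False
    then have "(\<Prod>e<6. 1 - ?p e (\<lambda>c. lookup j (e, c)) * ?q (nxt e) (\<lambda>c. lookup j (nxt e, c))) = 0"
      by (intro prod_zero) (auto simp: hstd_def prv_nxt)
    then show ?thesis using False by simp
  qed
  have "(\<Sum>j\<in>std_mons d. mprod y j) = (\<Sum>j\<in>{j\<in>?A. hstd j}. mprod y j)"
    by (rule sum.cong) (auto simp: std_mons_def)
  also have "\<dots> = (\<Sum>j\<in>?A. if hstd j then mprod y j else 0)"
    by (rule sum.inter_filter[OF finA])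
  also have "\<dots> = (\<Sum>j\<in>?A. mprod y j * (\<Prod>e<6. 1 - ?p e (\<lambda>c. lookup j (e, c)) * ?q (nxt e) (\<lambda>c. lookup j (nxt e, c))))"
    by (intro sum.cong refl) (simp only: std01, simp)
  also have "\<dots> = (\<Sum>k\<in>PiE {..<6} ?C. (\<Prod>v<6. ?w v (k v)) * (\<Prod>e<6. 1 - ?p e (k e) * ?q (nxt e) (k (nxt e))))"
    by (subst sum.reindex_bij_betw[OF bij_mons_compositions, symmetric])
       (intro sum.cong refl arg_cong2[of _ _ _ _ "(*)"] prod.cong, auto simp: mprod_def nxt_less)
  also have "\<dots> = (\<Sum>S\<in>Pow {..<6}. (-1) ^ card S * (\<Prod>v<6. \<Sum>k\<in>?C v. ?w v k *
      ((if v \<in> S then ?p v k else 1) * (if prv v \<in> S then ?q v k else 1))))"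
    by (rule hexagon_moments) (simp add: finite_compositions)
  also have "\<dots> = (\<Sum>S\<in>Pow {..<6}. (-1) ^ card S * (\<Prod>v<6. \<Sum>a<3. (y v a ^ d v * lag (y v) a) *
      ((if v \<in> S then ?p' v a else 1) * (if prv v \<in> S then ?q' v a else 1))))"
  proof (intro sum.cong refl arg_cong2[of _ _ _ _ "(*)"] prod.cong)
    fix S v assume "v \<in> {..<6::nat}"
    then have v: "v < 6" by simp
    have "col0 v \<noteq> col0 (prv v)" using less_6_cases[OF v] by (auto simp: prv_def col0_simps)
    then show "(\<Sum>k\<in>?C v. ?w v k * ((if v \<in> S then ?p v k else 1) * (if prv v \<in> S then ?q v k else 1)))
      = (\<Sum>a<3. (y v a ^ d v * lag (y v) a) * ((if v \<in> S then ?p' v a else 1) * (if prv v \<in> S then ?q' v a else 1)))"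
      using y v by (intro vertex_moments) (auto simp: col0_less prv_nxt)
  qed
  also have "\<dots> = (\<Sum>a\<in>PiE {..<6} (\<lambda>_. {..<3}). (\<Prod>v<6. y v (a v) ^ d v * lag (y v) (a v)) *
     (\<Prod>e<6. 1 - ?p' e (a e) * ?q' (nxt e) (a (nxt e))))"
    by (rule hexagon_moments[symmetric]) simp
  also have "\<dots> = (\<Sum>a\<in>PiE {..<6} (\<lambda>_. {..<3}).
     (\<Prod>v<6. y v (a v) ^ d v * lag (y v) (a v)) * (\<Prod>e<6. 1 - W / (y e (a e) * y (nxt e) (a (nxt e)))))"
  proof (intro sum.cong refl arg_cong2[of _ _ _ _ "(*)"] prod.cong)
    fix a e assume "e \<in> {..<6::nat}"
    then show "1 - ?p' e (a e) * ?q' (nxt e) (a (nxt e)) = 1 - W / (y e (a e) * y (nxt e) (a (nxt e)))"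
      using W[of e "col0 e"] col0_less[of e] by (simp add: prv_nxt)
  qed
  finally show ?thesis .
qed

section \<open>Products of minors and the rows of the symmetrizer\<close>

lemma prod_monomials: "(\<Prod>i\<in>I. single (f i) (1::complex)) = single (\<Sum>i\<in>I. f i) 1"
  for f :: "'i \<Rightarrow> 'v mon"
  by (induction I rule: infinite_finite_induct) (simp_all add: mult_single)

lemma lookup_sum_singles_count:
  "finite S \<Longrightarrow> lookup (\<Sum>s\<in>S. single (h s) (1::nat)) z = count (image_mset h (mset_set S)) z"
  by (induction S rule: finite_induct) (auto simp: lookup_add lookup_single when_def)

lemma mprod_sum: "mprod z (\<Sum>i\<in>I. M i) = (\<Prod>i\<in>I. mprod z (M i))"
proof (induction I rule: infinite_finite_induct)
  case (insert i I) then show ?case by (simp add: mprod_add)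
qed (simp_all add: mprod_def)

text \<open>The proper nonempty subsets in the cyclic order in which neighbours are comparable:
  singletons at even vertices, pairs at odd ones. The rows thus occur in the order 1, 3, 2.\<close>

definition cset :: "nat \<Rightarrow> nat set" where
  "cset v = (if v = 0 then {1} else if v = 1 then {1,3} else if v = 2 then {3} else if v = 3 then {2,3}
     else if v = 4 then {2} else {1,2})"

definition rv :: "nat \<Rightarrow> nat" where "rv r = (if r = 1 then 0 else if r = 3 then 2 else 4)"

lemma Subs_eq: "Subs = insert {1,2,3} (cset ` {..<6})"
proof -
  have "Subs = Pow {1,2,3} - {{}}" by (auto simp: Subs_def)
  also have "\<dots> = insert {1,2,3} (cset ` {..<6})"
    by (simp add: lessThan_6 cset_def Pow_insert) auto
  finally show ?thesis .
qed

lemma inj_cset: "inj_on cset {..<6}"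
proof (rule inj_onI)
  fix v v' assume v: "v \<in> {..<6}" "v' \<in> {..<6}" and eq: "cset v = cset v'"
  have "r \<in> cset v \<longleftrightarrow> r \<in> cset v'" for r using eq by simp
  from this[of 1] this[of 2] this[of 3] show "v = v'"
    using less_6_cases[of v, OF v(1)[simplified]] less_6_cases[of v', OF v(2)[simplified]] by (elim disjE) (auto simp: cset_def)
qed

lemma full_not_cset: "{1,2,3} \<notin> cset ` {..<6}"
proof
  assume "{1,2,3} \<in> cset ` {..<6}"
  then obtain v where v: "v < 6" "cset v = {1,2,3}" by auto
  then have "1 \<in> cset v" "2 \<in> cset v" "3 \<in> cset v" by simp_all
  then show False using less_6_cases[OF v(1)] by (auto simp: cset_def)
qed

lemma prod_Subs: "(\<Prod>C\<in>Subs. F C) = (\<Prod>v<6. F (cset v)) * F {1,2,3}"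
proof -
  have "(\<Prod>C\<in>Subs. F C) = F {1,2,3} * (\<Prod>C\<in>cset ` {..<6}. F C)"
    unfolding Subs_eq using full_not_cset by (subst prod.insert) auto
  also have "(\<Prod>C\<in>cset ` {..<6}. F C) = (\<Prod>v<6. F (cset v))"
    by (simp add: prod.reindex[OF inj_cset])
  finally show ?thesis by (simp add: mult.commute)
qed

lemma cset_Subs: "v < 6 \<Longrightarrow> cset v \<in> Subs" by (simp add: Subs_eq)

section \<open>The matrix of the symmetrizer in terms of products of minors\<close>

locale three_letters =
  fixes \<nu> :: "nat \<Rightarrow> nat" and m :: "nat set \<Rightarrow> nat" and x :: "nat \<Rightarrow> complex"
  assumes inj_\<nu>: "inj_on \<nu> {..<3}"
begin

definition V :: "nat set" where "V = \<nu> ` {..<3}"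

definition kap :: "nat \<Rightarrow> nat" where "kap = inv_into {..<3} \<nu>"

abbreviation "Sq \<equiv> squares m"

lemma kap_\<nu>: "c < 3 \<Longrightarrow> kap (\<nu> c) = c"
  by (simp add: kap_def inv_into_f_f[OF inj_\<nu>])

lemma \<nu>_kap: "l \<in> V \<Longrightarrow> \<nu> (kap l) = l" "l \<in> V \<Longrightarrow> kap l < 3"
  by (auto simp: V_def kap_\<nu>)

lemma lab_V: "g \<in> labs V m \<Longrightarrow> s \<in> Sq \<Longrightarrow> g s \<in> V"
  by (simp add: labs_def)

lemma finite_V: "finite V" by (simp add: V_def)

text \<open>A complete invariant for the action of the row group on labelings: it records the
  multiset of letters in each row.\<close>

definition rowmon :: "labeling \<Rightarrow> (nat \<times> nat) mon" where
  "rowmon f = (\<Sum>s\<in>Sq. single (rv (sq_row s), kap (f s)) 1)"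

definition colpol :: "labeling \<Rightarrow> hpol" where
  "colpol g = colsum sq_col Sq (\<lambda>s t. X (rv (sq_row s)) (kap (g t)))"

lemma col_group_eq: "col_group m = {\<kappa>. \<kappa> permutes Sq \<and> (\<forall>s. sq_col (\<kappa> s) = sq_col s)}"
  by (simp add: col_group_def)

lemma colpol_monomials: "colpol g = (\<Sum>\<kappa>\<in>col_group m. single (rowmon (g \<circ> \<kappa>)) (of_int (sign \<kappa>)))"
  unfolding colpol_def colsum_def col_group_eq
  by (intro sum.cong refl) (simp add: X_def prod_monomials rowmon_def single_of_int[symmetric] single_scalar_mult del: single_of_int)

lemma lookup_colpol:
  "lookup (colpol g) M = (\<Sum>\<kappa>\<in>col_group m. of_int (sign \<kappa>) * (if rowmon (g \<circ> \<kappa>) = M then 1 else 0))"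
  unfolding colpol_monomials by (auto simp: lookup_sum lookup_single when_def intro!: sum.cong)

lemma rowmon_comp:
  assumes "\<rho> \<in> row_group m" shows "rowmon (f \<circ> \<rho>) = rowmon f"
proof -
  have r: "\<rho> permutes Sq" "\<And>s. sq_row (\<rho> s) = sq_row s" using assms by (auto simp: row_group_def)
  have "rowmon f = (\<Sum>s\<in>Sq. single (rv (sq_row (\<rho> s)), kap (f (\<rho> s))) 1)"
    unfolding rowmon_def by (subst sum.permute[OF r(1)]) (simp add: o_def)
  then show ?thesis by (simp add: rowmon_def r(2))
qed

lemma sq_row_squares: "s \<in> Sq \<Longrightarrow> sq_row s = 1 \<or> sq_row s = 2 \<or> sq_row s = 3"
  by (auto simp: squares_def sq_row_def Subs_def)

lemma rowmon_eqD:
  assumes f: "f \<in> labs V m" "f' \<in> labs V m" and eq: "rowmon f = rowmon f'"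
  shows "\<exists>\<rho>\<in>row_group m. f \<circ> \<rho> = f'"
proof -
  let ?h = "\<lambda>f s. (rv (sq_row s), kap (f s))"
  have "image_mset (?h f') (mset_set Sq) = image_mset (?h f) (mset_set Sq)"
  proof (rule multiset_eqI)
    fix z
    show "count (image_mset (?h f') (mset_set Sq)) z = count (image_mset (?h f) (mset_set Sq)) z"
      using eq unfolding rowmon_def by (simp only: lookup_sum_singles_count[OF finite_squares, symmetric])
  qed
  then obtain p where p: "p permutes Sq" "\<forall>s\<in>Sq. ?h f' s = ?h f (p s)"
    by (rule image_mset_eq_implies_permutes[OF finite_squares])
  have pS: "p s \<in> Sq" if "s \<in> Sq" for s using permutes_in_image[OF p(1), of s] that by blast
  have "f (p s) = f' s" for s
  proof (cases "s \<in> Sq")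
    case True
    then have "kap (f' s) = kap (f (p s))" using p(2) by blast
    then show ?thesis using \<nu>_kap(1)[OF lab_V[OF f(2) True]] \<nu>_kap(1)[OF lab_V[OF f(1) pS[OF True]]] by metis
  next
    case False
    then show ?thesis using f permutes_not_in[OF p(1) False] by (simp add: labs_def del: split_paired_All)
  qed
  moreover have "sq_row (p s) = sq_row s" for s
  proof (cases "s \<in> Sq")
    case True
    then have "rv (sq_row s) = rv (sq_row (p s))" using p(2) by blast
    then show ?thesis using sq_row_squares[OF True] sq_row_squares[OF pS[OF True]] by (auto simp: rv_def)
  next
    case False
    then show ?thesis using permutes_not_in[OF p(1) False] by simp
  qed
  ultimately show ?thesis using p(1) by (intro bexI[of _ p]) (auto simp: row_group_def)
qed

definition stab :: "labeling \<Rightarrow> nat" where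
  "stab f = card {\<rho>\<in>row_group m. f \<circ> \<rho> = f}"

lemma id_row_group: "id \<in> row_group m" by (simp add: row_group_def permutes_id)

lemma stab_pos: "stab f > 0"
  unfolding stab_def using id_row_group finite_row_group by (subst card_gt_0_iff) auto

lemma count_row_translates:
  assumes h: "h \<in> labs V m" "f \<in> labs V m"
  shows "card {\<rho>\<in>row_group m. h \<circ> \<rho> = f} = (if rowmon h = rowmon f then stab f else 0)"
proof (cases "rowmon h = rowmon f")
  case True
  then obtain r where r: "r \<in> row_group m" "h \<circ> r = f" using rowmon_eqD[OF h] by blast
  have rp: "r permutes Sq" using r(1) by (simp add: row_group_def)
  have comp: "a \<circ> b \<in> row_group m" if "a \<in> row_group m" "b \<in> row_group m" for a b
    using that by (simp add: row_group_def permutes_compose del: split_paired_All)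
  have h_eq: "h = f \<circ> inv r" using r(2) by (simp add: comp_assoc permutes_inv_o[OF rp] flip: r(2))
  have "bij_betw (\<lambda>\<rho>. r \<circ> \<rho>) {\<rho>\<in>row_group m. f \<circ> \<rho> = f} {\<rho>\<in>row_group m. h \<circ> \<rho> = f}"
  proof (rule bij_betwI[where g = "\<lambda>\<rho>. inv r \<circ> \<rho>"])
    show "(\<circ>) r \<in> {\<rho>\<in>row_group m. f \<circ> \<rho> = f} \<rightarrow> {\<rho>\<in>row_group m. h \<circ> \<rho> = f}"
      using r comp by (auto simp: comp_assoc[symmetric])
    show "(\<circ>) (inv r) \<in> {\<rho>\<in>row_group m. h \<circ> \<rho> = f} \<rightarrow> {\<rho>\<in>row_group m. f \<circ> \<rho> = f}"
      using comp[OF inv_in_row_group[OF r(1)]] by (auto simp: comp_assoc[symmetric] h_eq[symmetric])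
  qed (auto simp: comp_assoc[symmetric] permutes_inv_o[OF rp])
  then show ?thesis using True by (simp add: stab_def bij_betw_same_card)
next
  case False
  then have e: "{\<rho>\<in>row_group m. h \<circ> \<rho> = f} = {}" by (auto simp: rowmon_comp)
  show ?thesis unfolding e using False by simp
qed

text \<open>\<beta> contributes the signed sum over column permutations, and \<alpha> identifies
  labelings with equal \<open>rowmon\<close>. So a row of \<open>BA m\<close> is the coefficient
  list of a product of minors, up to a nonzero factor that depends on the column \<open>f\<close>
  only.\<close>

lemma BAk_eq_lookup:
  assumes g: "g \<in> labs V m" "f \<in> labs V m"
  shows "BAk m g f = of_nat (stab f) / (of_nat (card (row_group m)) * of_nat (card (col_group m)))
    * lookup (colpol g) (rowmon f)"
proof -
  let ?G = "{\<sigma>. \<sigma> permutes Sq}" and ?R = "of_nat (card (row_group m)) :: complex"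
    and ?C = "of_nat (card (col_group m)) :: complex"
  have row: "(\<Sum>\<rho>\<in>?G. row_coeff m \<rho> * delta f (h \<circ> \<rho>)) = (if rowmon h = rowmon f then of_nat (stab f) / ?R else 0)"
    if h: "h \<in> labs V m" for h
  proof -
    have "(\<Sum>\<rho>\<in>?G. row_coeff m \<rho> * delta f (h \<circ> \<rho>)) = (\<Sum>\<rho>\<in>row_group m. row_coeff m \<rho> * delta f (h \<circ> \<rho>))"
      by (rule sum.mono_neutral_right[OF finite_permuters]) (auto simp: row_group_def row_coeff_def)
    also have "\<dots> = (\<Sum>\<rho>\<in>row_group m. if h \<circ> \<rho> = f then 1 / ?R else 0)"
      by (intro sum.cong refl) (simp add: row_coeff_def delta_def)
    also have "\<dots> = (\<Sum>\<rho>\<in>{\<rho>\<in>row_group m. h \<circ> \<rho> = f}. 1 / ?R)"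
      by (rule sum.inter_filter[OF finite_row_group, symmetric])
    also have "\<dots> = of_nat (card {\<rho>\<in>row_group m. h \<circ> \<rho> = f}) / ?R" by simp
    finally show ?thesis unfolding count_row_translates[OF h g(2)] by simp
  qed
  have "BAk m g f = (\<Sum>\<kappa>\<in>?G. col_coeff m \<kappa> * (\<Sum>\<rho>\<in>?G. row_coeff m \<rho> * delta f (g \<circ> \<kappa> \<circ> \<rho>)))"
    by (simp add: BAk_def alpha_eq_gop beta_eq_gop gop_def)
  also have "\<dots> = (\<Sum>\<kappa>\<in>?G. col_coeff m \<kappa> * (if rowmon (g \<circ> \<kappa>) = rowmon f then of_nat (stab f) / ?R else 0))"
    by (intro sum.cong refl arg_cong2[of _ _ _ _ "(*)"] row labs_comp g) simp
  also have "\<dots> = (\<Sum>\<kappa>\<in>col_group m. col_coeff m \<kappa> * (if rowmon (g \<circ> \<kappa>) = rowmon f then of_nat (stab f) / ?R else 0))"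
    by (rule sum.mono_neutral_right[OF finite_permuters]) (auto simp: col_group_def col_coeff_def)
  also have "\<dots> = (\<Sum>\<kappa>\<in>col_group m. of_nat (stab f) / (?R * ?C) * (of_int (sign \<kappa>) * (if rowmon (g \<circ> \<kappa>) = rowmon f then 1 else 0)))"
    by (intro sum.cong refl) (simp add: col_coeff_def)
  finally show ?thesis by (simp only: lookup_colpol sum_distrib_left)
qed

lemma id_col_group: "id \<in> col_group m" by (simp add: col_group_def permutes_id)

lemma row_relation_iff:
  assumes g: "\<And>i. i \<in> I \<Longrightarrow> g i \<in> labs V m"
  shows "(\<forall>f\<in>labs V m. (\<Sum>i\<in>I. a i * BAk m (g i) f) = 0) \<longleftrightarrow> (\<Sum>i\<in>I. single 0 (a i) * colpol (g i)) = 0"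
proof -
  let ?P = "\<Sum>i\<in>I. single 0 (a i) * colpol (g i)"
  have lk: "lookup ?P M = (\<Sum>i\<in>I. a i * lookup (colpol (g i)) M)" for M
    using lookup_monomial_mult[of 0 _ _ M] by (simp add: lookup_sum)
  have RC: "(of_nat (card (row_group m)) * of_nat (card (col_group m)) :: complex) \<noteq> 0"
    using id_row_group finite_row_group[of m] id_col_group finite_col_group[of m] by auto
  have rel: "(\<Sum>i\<in>I. a i * BAk m (g i) f) = of_nat (stab f) / (of_nat (card (row_group m)) * of_nat (card (col_group m)))
      * lookup ?P (rowmon f)" if "f \<in> labs V m" for f
    unfolding lk sum_distrib_left by (intro sum.cong refl) (simp add: BAk_eq_lookup[OF g that])
  \<comment> \<open>Every monomial of a \<open>colpol\<close> is the \<open>rowmon\<close> of some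
    labeling, so testing coefficients at labelings is enough.\<close>
  have other: "lookup ?P M = 0" if M: "\<And>f. f \<in> labs V m \<Longrightarrow> rowmon f \<noteq> M" for M
    unfolding lk
  proof (intro sum.neutral ballI)
    fix i assume i: "i \<in> I"
    have "lookup (colpol (g i)) M = 0"
      unfolding lookup_colpol
    proof (intro sum.neutral ballI)
      fix \<kappa> assume "\<kappa> \<in> col_group m"
      then have "g i \<circ> \<kappa> \<in> labs V m" using g[OF i] by (intro labs_comp) (auto simp: col_group_def)
      then show "of_int (sign \<kappa>) * (if rowmon (g i \<circ> \<kappa>) = M then 1 else 0) = (0::complex)" using M by simp
    qed
    then show "a i * lookup (colpol (g i)) M = 0" by simp
  qed
  show ?thesis
  proof
    assume z: "\<forall>f\<in>labs V m. (\<Sum>i\<in>I. a i * BAk m (g i) f) = 0"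
    show "?P = 0"
    proof (rule poly_mapping_eqI)
      fix M
      show "lookup ?P M = lookup 0 M"
      proof (cases "\<exists>f\<in>labs V m. rowmon f = M")
        case True
        then obtain f where f: "f \<in> labs V m" "rowmon f = M" by blast
        have "of_nat (stab f) \<noteq> (0::complex)" using stab_pos[of f] by simp
        then show ?thesis using rel[OF f(1)] z f RC by auto
      next
        case False
        then show ?thesis using other[of M] by auto
      qed
    qed
  next
    assume "?P = 0"
    then show "\<forall>f\<in>labs V m. (\<Sum>i\<in>I. a i * BAk m (g i) f) = 0" using rel by simp
  qed
qed

end

lemma cset_simps:
  "cset 0 = {1}" "cset 1 = {1,3}" "cset 2 = {3}" "cset 3 = {2,3}" "cset 4 = {2}" "cset 5 = {1,2}"
  by (simp_all add: cset_def)

lemma rv_simps: "rv 1 = 0" "rv 2 = 4" "rv 3 = 2" by (simp_all add: rv_def)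

text \<open>The three colours 0, 1, 2 add up to 3, so \<open>3 - (c + c')\<close> is the remaining
  one.\<close>

lemma minor_cross:
  fixes p q :: "nat \<Rightarrow> 'a::comm_ring_1"
  assumes "c < 3" "c' < 3" "c \<noteq> c'"
  shows "\<exists>\<epsilon>\<in>{1,-1::int}. p c * q c' - p c' * q c = of_int \<epsilon> * cross p q (3 - (c + c'))"
  using less_3_cases[OF assms(1)] less_3_cases[OF assms(2)] assms(3)
  by (elim disjE) (simp_all add: cross_def algebra_simps)

lemma cross_swap: "cross q p k = - cross p q (k :: nat)" for p q :: "nat \<Rightarrow> 'a::comm_ring_1"
  by (simp add: cross_def algebra_simps)

definition det3 :: hpol where
  "det3 = X 0 0 * (X 4 1 * X 2 2 - X 4 2 * X 2 1) - X 0 1 * (X 4 0 * X 2 2 - X 4 2 * X 2 0)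
    + X 0 2 * (X 4 0 * X 2 1 - X 4 1 * X 2 0)"

lemma det3_nonzero: "det3 \<noteq> 0"
proof
  assume D: "det3 = 0"
  \<comment> \<open>The diagonal term of the determinant; \<open>ne\<close> separates it from the
    other five.\<close>
  let ?M = "single (0,0) 1 + (single (4,1) 1 + single (2,2) 1) :: (nat \<times> nat) mon"
  have X3: "X a b * (X c d * X e f) = single (single (a,b) 1 + (single (c,d) 1 + single (e,f) 1)) 1" for a b c d e f
    by (simp add: X_def mult_single)
  have ne: "single (0,b) 1 + (single (4,d) 1 + single (2,f) 1) \<noteq> ?M" if "b \<noteq> 0 \<or> d \<noteq> 1" for b d f :: nat
  proof
    assume "single (0,b) 1 + (single (4,d) 1 + single (2,f) 1) = ?M"
    then have "lookup (single (0,b) 1 + (single (4,d) 1 + single (2,f) (1::nat))) z = lookup ?M z" for z by simp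
    from this[of "(0,b)"] this[of "(4,d)"] show False
      using that by (auto simp: lookup_add lookup_single when_def split: if_splits)
  qed
  have "lookup det3 ?M = 1"
    using ne ne[of 0 2 1] by (simp add: det3_def right_diff_distrib X3 lookup_add lookup_minus lookup_single when_def)
  then show False using D by simp
qed

lemma alternating_det:
  fixes p q r :: "nat \<Rightarrow> 'a::comm_ring_1"
  defines "T \<equiv> \<lambda>a b c. p a * (q b * r c - q c * r b) - p b * (q a * r c - q c * r a) + p c * (q a * r b - q b * r a)"
  assumes abc: "a < 3" "b < 3" "c < 3"
  shows "if distinct [a,b,c] then \<exists>\<epsilon>\<in>{1,-1::int}. T a b c = of_int \<epsilon> * T 0 1 2 else T a b c = 0"
proof -
  have z: "T a' a' c' = 0" "T a' c' c' = 0" "T a' c' a' = 0" for a' c' by (simp_all add: T_def algebra_simps)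
  have five: "T 0 2 1 = - T 0 1 2" "T 1 0 2 = - T 0 1 2" "T 1 2 0 = T 0 1 2" "T 2 0 1 = T 0 1 2" "T 2 1 0 = - T 0 1 2"
    by (simp_all add: T_def algebra_simps)
  show ?thesis
    using less_3_cases[OF abc(1)] less_3_cases[OF abc(2)] less_3_cases[OF abc(3)]
    by (elim disjE) (simp_all add: z five)
qed

section \<open>Columns as coordinates on the hexagon\<close>

context three_letters
begin

definition colval :: "labeling \<Rightarrow> nat set \<Rightarrow> nat \<Rightarrow> hpol" where
  "colval g C t = colsum sq_col {s\<in>Sq. sq_col s = (C,t)} (\<lambda>s t. X (rv (sq_row s)) (kap (g t)))"

lemma squares_column: "C \<in> Subs \<Longrightarrow> t < m C \<Longrightarrow> {s\<in>Sq. sq_col s = (C,t)} = (\<lambda>r. (C,t,r)) ` C"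
  by (auto simp: squares_def sq_col_def)

lemma sq_col_squares: "sq_col ` Sq = (SIGMA C:Subs. {..<m C})"
proof (intro equalityI subsetI)
  fix q assume "q \<in> (SIGMA C:Subs. {..<m C})"
  then obtain C t where q: "q = (C,t)" "C \<in> Subs" "t < m C" by auto
  moreover from q(2) obtain r where "r \<in> C" by (auto simp: Subs_def)
  ultimately have "(C,t,r) \<in> Sq" "q = sq_col (C,t,r)" by (auto simp: squares_def sq_col_def)
  then show "q \<in> sq_col ` Sq" by blast
qed (auto simp: squares_def sq_col_def)

lemma colpol_prod: "colpol g = (\<Prod>C\<in>Subs. \<Prod>t<m C. colval g C t)"
proof -
  have "colpol g = (\<Prod>(C,t)\<in>(SIGMA C:Subs. {..<m C}). colval g C t)"
    unfolding colpol_def colsum_partition[OF finite_squares] sq_col_squares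
    by (intro prod.cong refl) (auto simp: colval_def)
  then show ?thesis by (simp add: prod.Sigma[OF finite_Subs])
qed

lemma diag_eigen_prod: "diag_eigen x m g = (\<Prod>C\<in>Subs. \<Prod>t<m C. \<Prod>r\<in>C. x (g (C,t,r)))"
proof -
  have "diag_eigen x m g = (\<Prod>q\<in>(SIGMA C:Subs. {..<m C}). \<Prod>s\<in>{s\<in>Sq. sq_col s = q}. x (g s))"
    unfolding diag_eigen_def sq_col_squares[symmetric] by (rule prod.image_gen[OF finite_squares])
  also have "\<dots> = (\<Prod>(C,t)\<in>(SIGMA C:Subs. {..<m C}). \<Prod>r\<in>C. x (g (C,t,r)))"
  proof (rule prod.cong[OF refl])
    fix q assume "q \<in> (SIGMA C:Subs. {..<m C})"
    then obtain C t where q: "q = (C,t)" "C \<in> Subs" "t < m C" by auto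
    have "inj_on (\<lambda>r. (C,t,r)) C" by (auto simp: inj_on_def)
    then show "(\<Prod>s\<in>{s\<in>Sq. sq_col s = q}. x (g s)) = (case q of (C,t) \<Rightarrow> \<Prod>r\<in>C. x (g (C,t,r)))"
      by (simp only: q squares_column[OF q(2,3)] prod.case prod.reindex comp_def)
  qed
  finally show ?thesis by (simp add: prod.Sigma[OF finite_Subs])
qed

text \<open>A minor of size two is indexed by the letter that it misses, in agreement with the
  coordinates of the cross product.\<close>

definition colour :: "labeling \<Rightarrow> nat set \<Rightarrow> nat \<Rightarrow> nat" where
  "colour g C t = (if card C = 1 then \<Sum>r\<in>C. kap (g (C,t,r)) else 3 - (\<Sum>r\<in>C. kap (g (C,t,r))))"

text \<open>Torus weights of the coordinates. Indexing a pair by its missing letter makes the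
  product along an edge equal to \<open>e3\<close> for every colour, as spanning and the weight sum
  require.\<close>

definition yw :: "nat \<Rightarrow> nat \<Rightarrow> complex" where
  "yw v c = (if even v then x (\<nu> c) else if c = 0 then x (\<nu> 1) * x (\<nu> 2)
     else if c = 1 then x (\<nu> 0) * x (\<nu> 2) else x (\<nu> 0) * x (\<nu> 1))"

definition e3 :: complex where "e3 = x (\<nu> 0) * x (\<nu> 1) * x (\<nu> 2)"

lemma yw_pair:
  assumes "c < 3" "c' < 3" "c \<noteq> c'" "odd v"
  shows "x (\<nu> c) * x (\<nu> c') = yw v (3 - (c + c'))"
  using less_3_cases[OF assms(1)] less_3_cases[OF assms(2)] assms(3,4)
  by (elim disjE) (simp_all add: yw_def)

lemma yw_edge:
  assumes "e < 6" "c < 3" shows "yw e c * yw (nxt e) c = e3"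
  using less_6_cases[OF assms(1)] less_3_cases[OF assms(2)]
  by (elim disjE) (simp_all add: yw_def nxt_simps e3_def)

lemma kap_inj: "l \<in> V \<Longrightarrow> l' \<in> V \<Longrightarrow> kap l = kap l' \<longleftrightarrow> l = l'"
  using \<nu>_kap(1) by metis

text \<open>The sign depends on the order of the letters in the column and of the rows on the
  hexagon. It is only claimed to exist, since neither spans nor weights feel it.\<close>

lemma colval_hexagon:
  assumes g: "g \<in> labs V m" and v: "v < 6" and t: "t < m (cset v)"
  shows "if inj_on (\<lambda>r. g (cset v,t,r)) (cset v)
    then (\<exists>\<epsilon>\<in>{1,-1::int}. colval g (cset v) t = of_int \<epsilon> * phi v (colour g (cset v) t)) \<and> colour g (cset v) t < 3
       \<and> (\<Prod>r\<in>cset v. x (g (cset v,t,r))) = yw v (colour g (cset v) t)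
    else colval g (cset v) t = 0"
proof -
  let ?C = "cset v"
  let ?k = "\<lambda>r. kap (g (?C,t,r))"
  have inV: "g (?C,t,r) \<in> V" if "r \<in> ?C" for r
    using that t cset_Subs[OF v] by (intro lab_V[OF g]) (simp add: squares_def)
  have k3: "?k r < 3" if "r \<in> ?C" for r using \<nu>_kap(2)[OF inV[OF that]] .
  have xk: "x (g (?C,t,r)) = x (\<nu> (?k r))" if "r \<in> ?C" for r using \<nu>_kap(1)[OF inV[OF that]] by simp
  have cv: "colval g ?C t = (\<Sum>\<kappa> | \<kappa> permutes (\<lambda>r. (?C,t,r)) ` ?C. of_int (sign \<kappa>) *
      (\<Prod>s\<in>(\<lambda>r. (?C,t,r)) ` ?C. X (rv (sq_row s)) (kap (g (\<kappa> s)))))"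
    unfolding colval_def squares_column[OF cset_Subs[OF v] t]
    by (rule colsum_one_column[where q = "(?C,t)"]) (auto simp: sq_col_def)
  have single_case: ?thesis if C: "?C = {r}" and ph: "phi v = X (rv r)" and ev: "even v" for r
  proof -
    have "colval g ?C t = X (rv r) (?k r)"
      using cv by (simp add: C permutes_sing sq_row_def)
    moreover have "colour g ?C t = ?k r" by (simp add: colour_def C)
    moreover have "(\<Prod>r\<in>?C. x (g (?C,t,r))) = yw v (?k r)" using xk[of r] ev C by (simp add: yw_def)
    moreover have "inj_on (\<lambda>r. g (?C,t,r)) ?C" by (simp add: C)
    ultimately show ?thesis using k3[of r] C ph by (auto intro: bexI[of _ 1])
  qed
  have pair_case: ?thesis if C: "?C = {r,r'}" "r \<noteq> r'" and od: "odd v"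
    and ph: "\<exists>\<delta>\<in>{1,-1::int}. \<forall>k. cross (X (rv r)) (X (rv r')) k = of_int \<delta> * phi v k" for r r'
  proof -
    have rr: "r \<in> ?C" "r' \<in> ?C" using C by auto
    have val: "colval g ?C t = X (rv r) (?k r) * X (rv r') (?k r') - X (rv r) (?k r') * X (rv r') (?k r)"
      using cv signed_sum_2[of "(?C,t,r)" "(?C,t,r')" "\<lambda>s t. X (rv (sq_row s)) (kap (g t))"] C(2)
      by (simp add: C(1) sq_row_def)
    show ?thesis
    proof (cases "?k r = ?k r'")
      case True
      then have "g (?C,t,r) = g (?C,t,r')" using kap_inj[OF inV[OF rr(1)] inV[OF rr(2)]] by simp
      then have "\<not> inj_on (\<lambda>r. g (?C,t,r)) ?C" using rr C(2) by (auto simp: inj_on_def)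
      moreover have "colval g ?C t = 0" using val True by simp
      ultimately show ?thesis by simp
    next
      case False
      then have "g (?C,t,r) \<noteq> g (?C,t,r')" by auto
      note ne = this
      have mem: "s \<in> ?C \<longleftrightarrow> s = r \<or> s = r'" for s using C(1) by simp
      have inj: "inj_on (\<lambda>r. g (?C,t,r)) ?C"
      proof (rule inj_onI)
        fix a b assume "a \<in> ?C" "b \<in> ?C" "g (?C,t,a) = g (?C,t,b)"
        then show "a = b" using ne mem[of a] mem[of b] by metis
      qed
      have col: "colour g ?C t = 3 - (?k r + ?k r')" using C by (simp add: colour_def)
      have kk: "?k r < 3" "?k r' < 3" using k3 rr by auto
      obtain \<epsilon> where e: "\<epsilon> \<in> {1,-1::int}" "colval g ?C t = of_int \<epsilon> * cross (X (rv r)) (X (rv r')) (colour g ?C t)"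
        using minor_cross[OF kk False, of "X (rv r)" "X (rv r')"] unfolding val col by blast
      obtain \<delta> where d: "\<delta> \<in> {1,-1::int}" "\<And>k. cross (X (rv r)) (X (rv r')) k = of_int \<delta> * phi v k" using ph by blast
      have "colval g ?C t = of_int (\<epsilon> * \<delta>) * phi v (colour g ?C t)" using e(2) d(2) by (simp add: mult.assoc)
      moreover have "\<epsilon> * \<delta> \<in> {1,-1}" using e(1) d(1) by auto
      ultimately have "\<exists>\<epsilon>\<in>{1,-1::int}. colval g ?C t = of_int \<epsilon> * phi v (colour g ?C t)" by blast
      moreover have "colour g ?C t < 3" unfolding col using False kk by auto
      moreover have "(\<Prod>r\<in>?C. x (g (?C,t,r))) = yw v (colour g ?C t)"
        using C xk rr yw_pair[OF kk False od] col by simp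
      ultimately show ?thesis using inj by (simp only: if_True simp_thms)
    qed
  qed
  show ?thesis using less_6_cases[OF v]
  proof (elim disjE)
    assume v: "v = 0"
    have "phi 0 c = X 0 c" for c by (simp add: phi_def)
    then have "phi v = X (rv 1)" by (intro ext) (simp only: v rv_simps)
    moreover have "even v" by (simp add: v)
    ultimately show ?thesis by (intro single_case[of 1]) (simp_all only: v cset_simps)
  next
    assume v: "v = 2"
    have "phi 2 c = X 2 c" for c by (simp add: phi_def)
    then have "phi v = X (rv 3)" by (intro ext) (simp only: v rv_simps)
    moreover have "even v" by (simp add: v)
    ultimately show ?thesis by (intro single_case[of 3]) (simp_all only: v cset_simps)
  next
    assume v: "v = 4"
    have "phi 4 c = X 4 c" for c by (simp add: phi_def)
    then have "phi v = X (rv 2)" by (intro ext) (simp only: v rv_simps)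
    moreover have "even v" by (simp add: v)
    ultimately show ?thesis by (intro single_case[of 2]) (simp_all only: v cset_simps)
  next
    assume v: "v = 1"
    have "cross (X 0) (X 2) k = of_int (1) * phi 1 k" for k by (simp add: phi_def nxt_simps)
    then have "\<exists>\<delta>\<in>{1,-1::int}. \<forall>k. cross (X (rv 1)) (X (rv 3)) k = of_int \<delta> * phi v k"
      unfolding v rv_simps by blast
    moreover have "odd v" by (simp add: v)
    ultimately show ?thesis by (intro pair_case[of 1 3]) (simp_all add: v cset_simps)
  next
    assume v: "v = 3"
    have "cross (X 4) (X 2) k = of_int (-1) * phi 3 k" for k by (simp add: phi_def nxt_simps cross_swap[of "X 4" "X 2"])
    then have "\<exists>\<delta>\<in>{1,-1::int}. \<forall>k. cross (X (rv 2)) (X (rv 3)) k = of_int \<delta> * phi v k"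
      unfolding v rv_simps by blast
    moreover have "odd v" by (simp add: v)
    ultimately show ?thesis by (intro pair_case[of 2 3]) (simp_all add: v cset_simps)
  next
    assume v: "v = 5"
    have "cross (X 0) (X 4) k = of_int (-1) * phi 5 k" for k by (simp add: phi_def nxt_simps cross_swap[of "X 0" "X 4"])
    then have "\<exists>\<delta>\<in>{1,-1::int}. \<forall>k. cross (X (rv 1)) (X (rv 2)) k = of_int \<delta> * phi v k"
      unfolding v rv_simps by blast
    moreover have "odd v" by (simp add: v)
    ultimately show ?thesis by (intro pair_case[of 1 2]) (simp_all add: v cset_simps)
  qed
qed

lemma colval_full:
  assumes g: "g \<in> labs V m" and t: "t < m {1,2,3}"
  shows "if inj_on (\<lambda>r. g ({1,2,3},t,r)) {1,2,3}
    then (\<exists>\<epsilon>\<in>{1,-1::int}. colval g {1,2,3} t = of_int \<epsilon> * det3) \<and> (\<Prod>r\<in>{1,2,3}. x (g ({1,2,3},t,r))) = e3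
    else colval g {1,2,3} t = 0"
proof -
  let ?C = "{1,2,3::nat}"
  let ?k = "\<lambda>r. kap (g (?C,t,r))"
  have CS: "?C \<in> Subs" by (simp add: Subs_eq)
  have inV: "g (?C,t,r) \<in> V" if "r \<in> ?C" for r
    using that t CS by (intro lab_V[OF g]) (simp add: squares_def)
  have k3: "?k 1 < 3" "?k 2 < 3" "?k 3 < 3" using \<nu>_kap(2)[OF inV] by simp_all
  have xk: "x (g (?C,t,r)) = x (\<nu> (?k r))" if "r \<in> ?C" for r using \<nu>_kap(1)[OF inV[OF that]] by simp
  have img: "(\<lambda>r. (?C,t,r)) ` ?C = {(?C,t,1),(?C,t,2),(?C,t,3)}" by auto
  have "colval g ?C t = (\<Sum>\<kappa> | \<kappa> permutes (\<lambda>r. (?C,t,r)) ` ?C. of_int (sign \<kappa>) *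
      (\<Prod>s\<in>(\<lambda>r. (?C,t,r)) ` ?C. X (rv (sq_row s)) (kap (g (\<kappa> s)))))"
    unfolding colval_def squares_column[OF CS t]
    by (rule colsum_one_column[where q = "(?C,t)"]) (auto simp: sq_col_def)
  also have "\<dots> = X 0 (?k 1) * (X 4 (?k 2) * X 2 (?k 3) - X 4 (?k 3) * X 2 (?k 2))
     - X 0 (?k 2) * (X 4 (?k 1) * X 2 (?k 3) - X 4 (?k 3) * X 2 (?k 1))
     + X 0 (?k 3) * (X 4 (?k 1) * X 2 (?k 2) - X 4 (?k 2) * X 2 (?k 1))"
    unfolding img by (subst signed_sum_3) (simp_all add: sq_row_def rv_simps)
  finally have val: "colval g ?C t = \<dots>" .
  have inj: "inj_on (\<lambda>r. g (?C,t,r)) ?C \<longleftrightarrow> distinct [?k 1, ?k 2, ?k 3]"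
    using kap_inj[OF inV inV, of 1 2] kap_inj[OF inV inV, of 1 3] kap_inj[OF inV inV, of 2 3] by auto
  have "(\<Prod>r\<in>?C. x (g (?C,t,r))) = e3" if "distinct [?k 1, ?k 2, ?k 3]"
  proof -
    have "(\<Prod>r\<in>?C. x (g (?C,t,r))) = x (\<nu> (?k 1)) * x (\<nu> (?k 2)) * x (\<nu> (?k 3))"
      using xk by simp
    also have "\<dots> = e3"
      using that less_3_cases[OF k3(1)] less_3_cases[OF k3(2)] less_3_cases[OF k3(3)]
      by (elim disjE) (simp_all add: e3_def)
    finally show ?thesis .
  qed
  then show ?thesis
    using alternating_det[OF k3, of "X 0" "X 4" "X 2"] unfolding val inj det3_def by auto
qed

definition labmon :: "labeling \<Rightarrow> (nat \<times> nat) mon" where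
  "labmon g = (\<Sum>v<6. \<Sum>t<m (cset v). single (v, colour g (cset v) t) 1)"

definition colinj :: "labeling \<Rightarrow> bool" where
  "colinj g \<longleftrightarrow> (\<forall>C\<in>Subs. \<forall>t<m C. inj_on (\<lambda>r. g (C,t,r)) C)"

lemma colpol_not_colinj:
  assumes g: "g \<in> labs V m" "\<not> colinj g" shows "colpol g = 0"
proof -
  obtain C t where C: "C \<in> Subs" "t < m C" "\<not> inj_on (\<lambda>r. g (C,t,r)) C" using g(2) by (auto simp: colinj_def)
  have "colval g C t = 0"
    using C colval_full[OF g(1), of t] colval_hexagon[OF g(1), of _ t] unfolding Subs_eq by auto
  then have "(\<Prod>t<m C. colval g C t) = 0" using C by (intro prod_zero) auto
  then show ?thesis unfolding colpol_prod using C finite_Subs by (intro prod_zero) auto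
qed

lemma sign_prod:
  assumes "finite I" "\<And>i. i \<in> I \<Longrightarrow> \<exists>\<epsilon>\<in>{1,-1::int}. f i = of_int \<epsilon> * (h i :: 'a::comm_ring_1)"
  shows "\<exists>\<epsilon>\<in>{1,-1::int}. (\<Prod>i\<in>I. f i) = of_int \<epsilon> * (\<Prod>i\<in>I. h i)"
  using assms
proof (induction I rule: finite_induct)
  case (insert i I)
  then obtain \<epsilon> where e: "\<epsilon> \<in> {1,-1::int}" "(\<Prod>i\<in>I. f i) = of_int \<epsilon> * (\<Prod>i\<in>I. h i)" by blast
  obtain \<delta> where d: "\<delta> \<in> {1,-1::int}" "f i = of_int \<delta> * h i" using insert.prems[of i] by blast
  have "(\<Prod>i\<in>insert i I. f i) = of_int (\<delta> * \<epsilon>) * (\<Prod>i\<in>insert i I. h i)"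
    using insert.hyps e d by (simp add: mult_ac)
  moreover have "\<delta> * \<epsilon> \<in> {1,-1}" using e d by auto
  ultimately show ?case by blast
qed auto

lemma colpol_colinj:
  assumes g: "g \<in> labs V m" "colinj g"
  shows "\<exists>\<epsilon>\<in>{1,-1::int}. colpol g = of_int \<epsilon> * (mprod phi (labmon g) * det3 ^ m {1,2,3})"
    and "box (labmon g)" and "has_degree (\<lambda>v. m (cset v)) (labmon g)"
    and "diag_eigen x m g = mprod yw (labmon g) * e3 ^ m {1,2,3}"
proof -
  have inj: "inj_on (\<lambda>r. g (C,t,r)) C" if "C \<in> Subs" "t < m C" for C t using g(2) that by (auto simp: colinj_def)
  have full: "\<exists>\<epsilon>\<in>{1,-1::int}. colval g {1,2,3} t = of_int \<epsilon> * det3" "(\<Prod>r\<in>{1,2,3}. x (g ({1,2,3},t,r))) = e3"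
    if "t < m {1,2,3}" for t
    using colval_full[OF g(1) that] inj[OF _ that] by (simp_all add: Subs_eq)
  have hex: "\<exists>\<epsilon>\<in>{1,-1::int}. colval g (cset v) t = of_int \<epsilon> * phi v (colour g (cset v) t)"
    "colour g (cset v) t < 3" "(\<Prod>r\<in>cset v. x (g (cset v,t,r))) = yw v (colour g (cset v) t)"
    if "v < 6" "t < m (cset v)" for v t
    using colval_hexagon[OF g(1) that] inj[OF cset_Subs[OF that(1)] that(2)] by (simp_all only: if_True)
  have mp: "mprod z (labmon g) = (\<Prod>v<6. \<Prod>t<m (cset v). z v (colour g (cset v) t))"
    for z :: "nat \<Rightarrow> nat \<Rightarrow> 'b::comm_monoid_mult"
    unfolding labmon_def mprod_sum by (intro prod.cong refl) (simp add: mprod_single hex)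
  have "\<exists>\<epsilon>\<in>{1,-1::int}. (\<Prod>v<6. \<Prod>t<m (cset v). colval g (cset v) t) = of_int \<epsilon> * (\<Prod>v<6. \<Prod>t<m (cset v). phi v (colour g (cset v) t))"
    by (intro sign_prod hex) auto
  then obtain \<epsilon> where e: "\<epsilon> \<in> {1,-1::int}" "(\<Prod>v<6. \<Prod>t<m (cset v). colval g (cset v) t) = of_int \<epsilon> * mprod phi (labmon g)"
    unfolding mp by blast
  have "\<exists>\<delta>\<in>{1,-1::int}. (\<Prod>t<m {1,2,3}. colval g {1,2,3} t) = of_int \<delta> * (\<Prod>t<m {1,2,3}. det3)"
    by (intro sign_prod full) auto
  then obtain \<delta> where d: "\<delta> \<in> {1,-1::int}" "(\<Prod>t<m {1,2,3}. colval g {1,2,3} t) = of_int \<delta> * det3 ^ m {1,2,3}"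
    unfolding prod_constant card_lessThan by blast
  have "colpol g = of_int (\<epsilon> * \<delta>) * (mprod phi (labmon g) * det3 ^ m {1,2,3})"
    unfolding colpol_prod prod_Subs e d by (simp add: mult_ac)
  moreover have "\<epsilon> * \<delta> \<in> {1,-1}" using e d by auto
  ultimately show "\<exists>\<epsilon>\<in>{1,-1::int}. colpol g = of_int \<epsilon> * (mprod phi (labmon g) * det3 ^ m {1,2,3})" by blast
  have lk: "lookup (labmon g) z = (\<Sum>v<6. \<Sum>t<m (cset v). if (v, colour g (cset v) t) = z then 1 else 0)" for z
    by (simp add: labmon_def lookup_sum lookup_single when_def)
  show "box (labmon g)"
    unfolding box_def
  proof
    fix z assume "z \<in> keys (labmon g)"
    then have "(\<Sum>v<6. \<Sum>t<m (cset v). if (v, colour g (cset v) t) = z then 1 else 0 :: nat) \<noteq> 0"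
      by (simp add: in_keys_iff lk)
    then obtain v where "v < 6" "(\<Sum>t<m (cset v). if (v, colour g (cset v) t) = z then 1 else 0 :: nat) \<noteq> 0"
      by (elim sum.not_neutral_contains_not_neutral) auto
    moreover from this obtain t where "t < m (cset v)" "(v, colour g (cset v) t) = z"
      by (elim sum.not_neutral_contains_not_neutral) (auto split: if_splits)
    ultimately show "z \<in> {..<6} \<times> {..<3}" using hex(2)[of v t] by auto
  qed
  show "has_degree (\<lambda>v. m (cset v)) (labmon g)"
    unfolding has_degree_def
  proof (intro allI impI)
    fix v :: nat assume v: "v < 6"
    have "lookup (labmon g) (v, c) = (\<Sum>t<m (cset v). if colour g (cset v) t = c then 1 else 0)" for c
    proof -
      have "lookup (labmon g) (v, c) = (\<Sum>v'<6. if v' = v then \<Sum>t<m (cset v). if colour g (cset v) t = c then 1 else 0 else 0)"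
        unfolding lk by (intro sum.cong refl) auto
      then show ?thesis using v by simp
    qed
    then have "(\<Sum>c<3. lookup (labmon g) (v, c)) = (\<Sum>t<m (cset v). \<Sum>c<3. if colour g (cset v) t = c then 1 else 0)"
      by (simp only:) (rule sum.swap)
    also have "\<dots> = (\<Sum>t<m (cset v). 1)"
      by (intro sum.cong refl) (use hex(2)[OF v] in simp)
    finally show "(\<Sum>c<3. lookup (labmon g) (v, c)) = m (cset v)" by simp
  qed
  show "diag_eigen x m g = mprod yw (labmon g) * e3 ^ m {1,2,3}"
    unfolding diag_eigen_prod prod_Subs mp using hex(3) full(2) by simp
qed

end

section \<open>A basis of the row space for three letters\<close>

context three_letters
begin

lemma colouring_exists:
  assumes "(\<Sum>c<3. k c) = (N :: nat)"
  shows "\<exists>F. (\<forall>t. F t < (3::nat)) \<and> (\<forall>c<3. (\<Sum>t<N. if F t = c then 1 else 0) = k c)"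
proof -
  define F where "F t = (if t < k 0 then 0 else if t < k 0 + k 1 then 1 else (2::nat))" for t
  have N: "N = k 0 + k 1 + k 2" using assms by (simp add: lessThan_3)
  have card_eq: "(\<Sum>t<N. if F t = c then 1 else 0) = card {t. t < N \<and> F t = c}" for c
    by (simp add: sum.If_cases Int_def)
  have "{t. t < N \<and> F t = 0} = {0..<k 0}" "{t. t < N \<and> F t = 1} = {k 0..<k 0 + k 1}"
    "{t. t < N \<and> F t = 2} = {k 0 + k 1..<N}"
    by (auto simp: F_def N)
  then have "card {t. t < N \<and> F t = c} = k c" if "c < 3" for c
    using less_3_cases[OF that] by (elim disjE) (simp_all add: N)
  moreover have "F t < 3" for t by (simp add: F_def)
  ultimately show ?thesis using card_eq by (intro exI[of _ F]) simp
qed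

lemma labmon_surj:
  assumes M: "box M" "has_degree (\<lambda>v. m (cset v)) M"
  shows "\<exists>g\<in>labs V m. colinj g \<and> labmon g = M"
proof -
  have "\<forall>v<6. \<exists>F. (\<forall>t. F t < (3::nat)) \<and> (\<forall>c<3. (\<Sum>t<m (cset v). if F t = c then 1 else 0) = lookup M (v,c))"
    using M(2) by (auto simp: has_degree_def intro!: colouring_exists)
  then obtain F where F: "\<And>v t. v < 6 \<Longrightarrow> F v t < (3::nat)"
    "\<And>v c. v < 6 \<Longrightarrow> c < 3 \<Longrightarrow> (\<Sum>t<m (cset v). if F v t = c then 1 else 0) = lookup M (v,c)"
    by metis
  define vtx where "vtx = inv_into {..<6} cset"
  have vtx: "vtx (cset v) = v" if "v < 6" for v
    using that by (simp add: vtx_def inv_into_f_f[OF inj_cset])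
  \<comment> \<open>A column of two squares has to miss the colour \<open>F v t\<close>: its upper
    row, which is 2 for \<open>v = 3\<close> and 1 otherwise, receives the smaller of the two
    remaining colours and its lower row the larger.\<close>
  define cc where "cc v t r = (if even v then F v t else if r = (if v = 3 then 2 else 1)
     then (if F v t = 0 then 1 else 0) else (if F v t = 2 then 1 else 2))" for v t r :: nat
  define g where "g = (\<lambda>(C,t,r). if (C,t,r) \<in> Sq then \<nu> (if C = {1,2,3} then r - 1 else cc (vtx C) t r) else 0)"
  have cc3: "cc v t r < 3" if "v < 6" for v t r using F(1)[OF that] by (simp add: cc_def)
  have g_hex: "g (cset v,t,r) = \<nu> (cc v t r)" if "v < 6" "t < m (cset v)" "r \<in> cset v" for v t r
    using that full_not_cset cset_Subs[OF that(1)] by (auto simp: g_def vtx squares_def)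
  have g_full: "g ({1,2,3},t,r) = \<nu> (r - 1)" if "t < m {1,2,3}" "r \<in> {1,2,3}" for t r
    using that by (auto simp: g_def squares_def Subs_eq)
  have lab: "g \<in> labs V m"
    unfolding labs_def
  proof (intro CollectI conjI ballI allI impI)
    fix s assume s: "s \<in> Sq"
    obtain C t r where str: "s = (C,t,r)" by (cases s)
    have C: "C \<in> Subs" "t < m C" "r \<in> C" using s by (auto simp: str squares_def)
    show "g s \<in> V"
    proof (cases "C = {1,2,3}")
      case True
      then show ?thesis using C g_full[of t r] by (auto simp: str V_def)
    next
      case False
      then obtain v where "v < 6" "C = cset v" using C by (auto simp: Subs_eq)
      then show ?thesis using C g_hex[of v t r] cc3[of v t r] by (simp add: str V_def)
    qed
  qed (auto simp: g_def)
  have inj: "colinj g"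
    unfolding colinj_def
  proof (intro ballI allI impI)
    fix C t assume C: "C \<in> Subs" "t < m C"
    show "inj_on (\<lambda>r. g (C,t,r)) C"
    proof (cases "C = {1,2,3}")
      case True
      then show ?thesis using C g_full[of t] inj_on_eq_iff[OF inj_\<nu>] by (auto simp: inj_on_def)
    next
      case False
      then obtain v where v: "v < 6" "C = cset v" using C by (auto simp: Subs_eq)
      have "r = r'" if r: "r \<in> C" "r' \<in> C" "g (C,t,r) = g (C,t,r')" for r r'
      proof -
        have "\<nu> (cc v t r) = \<nu> (cc v t r')"
          using r(3) g_hex[of v t r] g_hex[of v t r'] r(1,2) C(2) v by simp
        then have cceq: "cc v t r = cc v t r'"
          using inj_on_eq_iff[OF inj_\<nu>] cc3[OF v(1)] by simp
        show ?thesis using less_6_cases[OF v(1)]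
        proof (elim disjE)
          assume e: "v = 0"
          show ?thesis using cceq r(1,2) unfolding v(2) e cset_simps cc_def by (auto split: if_splits)
        next
          assume e: "v = 1"
          show ?thesis using cceq r(1,2) unfolding v(2) e cset_simps cc_def by (auto split: if_splits)
        next
          assume e: "v = 2"
          show ?thesis using cceq r(1,2) unfolding v(2) e cset_simps cc_def by (auto split: if_splits)
        next
          assume e: "v = 3"
          show ?thesis using cceq r(1,2) unfolding v(2) e cset_simps cc_def by (auto split: if_splits)
        next
          assume e: "v = 4"
          show ?thesis using cceq r(1,2) unfolding v(2) e cset_simps cc_def by (auto split: if_splits)
        next
          assume e: "v = 5"
          show ?thesis using cceq r(1,2) unfolding v(2) e cset_simps cc_def by (auto split: if_splits)
        qed
      qed
      then show ?thesis by (auto simp: inj_on_def)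
    qed
  qed
  have col: "colour g (cset v) t = F v t" if v: "v < 6" "t < m (cset v)" for v t
  proof -
    have k: "kap (g (cset v,t,r)) = cc v t r" if "r \<in> cset v" for r
      using g_hex[OF v that] kap_\<nu>[OF cc3[OF v(1)]] by simp
    have "(\<Sum>r\<in>cset v. kap (g (cset v,t,r))) = (\<Sum>r\<in>cset v. cc v t r)" by (intro sum.cong refl k)
    then show ?thesis
      using less_6_cases[OF v(1)] less_3_cases[OF F(1)[OF v(1), of t]]
      by (elim disjE) (simp_all add: colour_def cset_simps cc_def)
  qed
  have "labmon g = M"
  proof (rule poly_mapping_eqI)
    fix z :: "nat \<times> nat" obtain u c where z: "z = (u,c)" by fastforce
    have inner: "(\<Sum>t<m (cset v). lookup (single (v, colour g (cset v) t) 1) z)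
        = (if v = u then \<Sum>t<m (cset u). if F u t = c then 1 else 0 else 0)" if "v < 6" for v
    proof -
      have "(\<Sum>t<m (cset v). lookup (single (v, colour g (cset v) t) 1) z)
          = (\<Sum>t<m (cset v). if v = u then if F u t = c then 1 else 0 else 0)"
        by (intro sum.cong refl) (use col that in \<open>auto simp: z lookup_single when_def\<close>)
      also have "\<dots> = (if v = u then \<Sum>t<m (cset u). if F u t = c then 1 else 0 else 0)" by simp
      finally show ?thesis .
    qed
    have "lookup (labmon g) z = (\<Sum>v<6. if v = u then \<Sum>t<m (cset u). if F u t = c then 1 else 0 else 0)"
      unfolding labmon_def lookup_sum by (intro sum.cong refl inner) simp
    also have "\<dots> = (if u < 6 then \<Sum>t<m (cset u). if F u t = c then 1 else 0 else 0)" by simp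
    also have "\<dots> = lookup M z"
    proof (cases "u < 6 \<and> c < 3")
      case True then show ?thesis using F(2)[of u c] by (simp add: z)
    next
      case False
      then have "lookup M z = 0" using box_lookup[OF M(1)] by (simp add: z)
      moreover have "(\<Sum>t<m (cset u). if F u t = c then 1 else 0) = (0::nat)" if "u < 6"
        using False that F(1)[OF that] by (intro sum.neutral) auto
      ultimately show ?thesis by auto
    qed
    finally show "lookup (labmon g) z = lookup M z" .
  qed
  then show ?thesis using lab inj by blast
qed

text \<open>Rows of the matrix of \<open>\<beta>\<alpha>\<close> correspond to the products of minors \<open>colpol\<close>, so a basis of the row
  space is indexed by the standard monomials.\<close>
theorem label_char_three:
  "label_char x m V = e3 ^ m {1,2,3} * (\<Sum>j\<in>std_mons (\<lambda>v. m (cset v)). mprod yw j)"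
proof -
  let ?d = "\<lambda>v. m (cset v)"
  let ?J = "std_mons ?d"
  have "\<forall>j\<in>?J. \<exists>g\<in>labs V m. colinj g \<and> labmon g = j"
    using labmon_surj by (simp add: std_mons_def)
  from bchoice[OF this[unfolded Bex_def]] obtain rep
    where "\<forall>j\<in>?J. rep j \<in> labs V m \<and> colinj (rep j) \<and> labmon (rep j) = j" by blast
  then have rep: "\<And>j. j \<in> ?J \<Longrightarrow> rep j \<in> labs V m" "\<And>j. j \<in> ?J \<Longrightarrow> colinj (rep j)"
    "\<And>j. j \<in> ?J \<Longrightarrow> labmon (rep j) = j" by blast+
  have "\<forall>g\<in>{g\<in>labs V m. colinj g}. \<exists>\<epsilon>\<in>{1,-1::int}. colpol g = of_int \<epsilon> * (mprod phi (labmon g) * det3 ^ m {1,2,3})"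
    using colpol_colinj(1) by blast
  from bchoice[OF this[unfolded Bex_def]] obtain eps
    where "\<forall>g\<in>{g\<in>labs V m. colinj g}. eps g \<in> {1,-1::int} \<and> colpol g = of_int (eps g) * (mprod phi (labmon g) * det3 ^ m {1,2,3})"
    by blast
  then have eps: "\<And>g. g \<in> labs V m \<Longrightarrow> colinj g \<Longrightarrow> eps g \<in> {1,-1::int}"
    "\<And>g. g \<in> labs V m \<Longrightarrow> colinj g \<Longrightarrow> colpol g = of_int (eps g) * (mprod phi (labmon g) * det3 ^ m {1,2,3})"
    by blast+
  have ex: "\<exists>c. mprod phi (labmon g) = (\<Sum>j\<in>?J. single 0 (c j) * mprod phi j)
      \<and> (\<forall>j\<in>?J. c j \<noteq> 0 \<longrightarrow> mprod yw j = mprod yw (labmon g))" if g: "g \<in> labs V m" "colinj g" for g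
  proof -
    obtain F c where F: "finite F" "F \<subseteq> {j. box j \<and> hstd j \<and> has_degree ?d j \<and> mprod yw j = mprod yw (labmon g)}"
      "mprod phi (labmon g) = (\<Sum>j\<in>F. single 0 (c j) * mprod phi j)"
      using hexagon_spanning[of yw e3 "labmon g" ?d, OF yw_edge colpol_colinj(2)[OF g] colpol_colinj(3)[OF g]]
      unfolding scal_span_def by blast
    have "(\<Sum>j\<in>F. single 0 (c j) * mprod phi j) = (\<Sum>j\<in>?J. single 0 (if j \<in> F then c j else 0) * mprod phi j)"
      using F(2) by (intro sum.mono_neutral_cong_left finite_std_mons) (auto simp: std_mons_def)
    then show ?thesis using F by (intro exI[of _ "\<lambda>j. if j \<in> F then c j else 0"]) auto
  qed
  define c where "c g = (SOME c. mprod phi (labmon g) = (\<Sum>j\<in>?J. single 0 (c j) * mprod phi j)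
      \<and> (\<forall>j\<in>?J. c j \<noteq> 0 \<longrightarrow> mprod yw j = mprod yw (labmon g)))" for g
  have c: "mprod phi (labmon g) = (\<Sum>j\<in>?J. single 0 (c g j) * mprod phi j)"
    "\<And>j. j \<in> ?J \<Longrightarrow> c g j \<noteq> 0 \<Longrightarrow> mprod yw j = mprod yw (labmon g)" if "g \<in> labs V m" "colinj g" for g
    using someI_ex[OF ex[OF that]] unfolding c_def by blast+
  \<comment> \<open>Both signs are absorbed into the coefficient; a labeling with a repeated letter
    in a column gives the zero row.\<close>
  define C where "C g j = (if colinj g then of_int (eps g) * c g j * of_int (eps (rep j)) else 0)" for g j
  have sq: "of_int (eps (rep j)) * of_int (eps (rep j)) = (1::hpol)" if "j \<in> ?J" for j
    using eps(1)[OF rep(1)[OF that] rep(2)[OF that]] by auto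
  have sc: "single 0 (of_int k) = (of_int k :: hpol)" for k by (rule single_of_int)
  have rep_pol: "colpol (rep j) = of_int (eps (rep j)) * (mprod phi j * det3 ^ m {1,2,3})" if "j \<in> ?J" for j
    using eps(2)[OF rep(1)[OF that] rep(2)[OF that]] rep(3)[OF that] by simp
  have C_eq: "colpol g = (\<Sum>j\<in>?J. single 0 (C g j) * colpol (rep j))" if g: "g \<in> labs V m" for g
  proof (cases "colinj g")
    case True
    have "(\<Sum>j\<in>?J. single 0 (C g j) * colpol (rep j))
        = (\<Sum>j\<in>?J. of_int (eps g) * (single 0 (c g j) * mprod phi j) * det3 ^ m {1,2,3})"
    proof (intro sum.cong refl)
      fix j assume j: "j \<in> ?J"
      have "single 0 (C g j) = of_int (eps g) * single 0 (c g j) * (of_int (eps (rep j)) :: hpol)"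
        using True by (simp add: C_def sc[symmetric] single_scalar_mult del: single_of_int)
      then have "single 0 (C g j) * colpol (rep j) = of_int (eps g) * (single 0 (c g j) * mprod phi j) * det3 ^ m {1,2,3}
          * (of_int (eps (rep j)) * of_int (eps (rep j)))"
        unfolding rep_pol[OF j] by (simp only: mult_ac)
      then show "single 0 (C g j) * colpol (rep j) = of_int (eps g) * (single 0 (c g j) * mprod phi j) * det3 ^ m {1,2,3}"
        unfolding sq[OF j] by simp
    qed
    also have "\<dots> = of_int (eps g) * (mprod phi (labmon g) * det3 ^ m {1,2,3})"
      unfolding c(1)[OF g True] by (simp add: sum_distrib_left sum_distrib_right mult.assoc)
    finally show ?thesis using eps(2)[OF g True] by simp
  next
    case False
    then show ?thesis using colpol_not_colinj[OF g] by (simp add: C_def)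
  qed
  have diag: "diag_eigen x m (rep j) = mprod yw j * e3 ^ m {1,2,3}" if "j \<in> ?J" for j
    using colpol_colinj(4)[OF rep(1)[OF that] rep(2)[OF that]] rep(3)[OF that] by simp
  have "label_char x m V = (\<Sum>j\<in>?J. diag_eigen x m (rep j))"
  proof (rule label_char_basis[where C = C])
    show "finite V" by (rule finite_V)
    show "finite ?J" by (rule finite_std_mons)
    show "rep j \<in> labs V m" if "j \<in> ?J" for j using rep(1)[OF that] .
    show "BAk m g f = (\<Sum>j\<in>?J. C g j * BAk m (rep j) f)" if g: "g \<in> labs V m" and f: "f \<in> labs V m" for g f
    proof -
      \<comment> \<open>The expansion of one row is put as a relation, with \<open>None\<close> for
        the row of \<open>g\<close> itself and \<open>Some j\<close> for the representatives, so
        that \<open>row_relation_iff\<close> carries it from polynomials to the matrix.\<close>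
      define a where "a = (\<lambda>i. case i of None \<Rightarrow> 1 | Some j \<Rightarrow> - C g j)"
      define h where "h = (\<lambda>i. case i of None \<Rightarrow> g | Some j \<Rightarrow> rep j)"
      let ?I = "insert None (Some ` ?J)"
      have fin: "finite (Some ` ?J)" by (simp add: finite_std_mons)
      have s: "(\<Sum>i\<in>?I. G i) = G None + (\<Sum>j\<in>?J. G (Some j))" for G :: "_ \<Rightarrow> 'b::comm_monoid_add"
        using fin by (subst sum.insert) (auto simp: sum.reindex)
      have "(\<Sum>i\<in>?I. single 0 (a i) * colpol (h i)) = 0"
        unfolding s using C_eq[OF g] by (simp add: a_def h_def single_uminus sum_negf)
      moreover have "h i \<in> labs V m" if "i \<in> ?I" for i using that g rep(1) by (auto simp: h_def)
      ultimately have "(\<Sum>i\<in>?I. a i * BAk m (h i) f) = 0"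
        using row_relation_iff[of ?I h a] f by blast
      then show ?thesis unfolding s by (simp add: a_def h_def sum_negf)
    qed
    show "diag_eigen x m g = diag_eigen x m (rep j)" if "g \<in> labs V m" "j \<in> ?J" "C g j \<noteq> 0" for g j
    proof -
      have "colinj g" "c g j \<noteq> 0" using that(3) by (auto simp: C_def split: if_splits)
      then show ?thesis using c(2)[OF that(1) \<open>colinj g\<close> that(2)] colpol_colinj(4)[OF that(1)] diag[OF that(2)] by simp
    qed
    show "a j = 0" if rel: "\<And>f. f \<in> labs V m \<Longrightarrow> (\<Sum>j\<in>?J. a j * BAk m (rep j) f) = 0" and j: "j \<in> ?J" for a j
    proof -
      have "(\<Sum>j\<in>?J. single 0 (a j) * colpol (rep j)) = 0"
        using row_relation_iff[of ?J rep a] rep(1) rel by blast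
      moreover have "(\<Sum>j\<in>?J. single 0 (a j) * colpol (rep j))
          = (\<Sum>j\<in>?J. single 0 (a j * of_int (eps (rep j))) * mprod phi j) * det3 ^ m {1,2,3}"
        unfolding sum_distrib_right
      proof (intro sum.cong refl)
        fix j assume j: "j \<in> ?J"
        have "single 0 (a j * of_int (eps (rep j))) = single 0 (a j) * (of_int (eps (rep j)) :: hpol)"
          by (simp add: sc[symmetric] single_scalar_mult del: single_of_int)
        then show "single 0 (a j) * colpol (rep j) = single 0 (a j * of_int (eps (rep j))) * mprod phi j * det3 ^ m {1,2,3}"
          unfolding rep_pol[OF j] by (simp only: mult_ac)
      qed
      \<comment> \<open>The power of the determinant is common to all terms and nonzero, hence
        cancels in the polynomial ring.\<close>
      ultimately have "(\<Sum>j\<in>?J. single 0 (a j * of_int (eps (rep j))) * mprod phi j) = 0"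
        using det3_nonzero by simp
      then have "a j * of_int (eps (rep j)) = 0"
        by (rule hexagon_independent[OF finite_std_mons _ _ j, where d = ?d, rotated]) (auto simp: std_mons_def)
      then show ?thesis using eps(1)[OF rep(1)[OF j] rep(2)[OF j]] by auto
    qed
  qed
  also have "\<dots> = e3 ^ m {1,2,3} * (\<Sum>j\<in>?J. mprod yw j)"
    by (simp add: diag sum_distrib_right mult.commute[of "e3 ^ _"])
  finally show ?thesis .
qed

end

section \<open>Labels at the fixed points and tabloids\<close>

text \<open>The weight of a line (\<open>v\<close> even) or of a plane (\<open>v\<close> odd), the tangent
  weights at the fixed points of the projective plane on the letters \<open>V\<close> and of its dual, and the incidence
  relations, all in terms of a choice \<open>b\<close> of one letter of \<open>V\<close> per vertex of the hexagon (a plane is labelled by the letter of \<open>V\<close> that it misses).\<close>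
definition zf :: "(nat \<Rightarrow> complex) \<Rightarrow> nat \<Rightarrow> nat \<Rightarrow> complex" where
  "zf x a c = 1 - x c / x a"

definition vwt :: "(nat \<Rightarrow> complex) \<Rightarrow> nat set \<Rightarrow> nat \<Rightarrow> nat \<Rightarrow> complex" where
  "vwt x V v l = (if even v then x l else \<Prod>c\<in>V - {l}. x c)"

definition vloc :: "(nat \<Rightarrow> complex) \<Rightarrow> nat set \<Rightarrow> nat \<Rightarrow> nat \<Rightarrow> complex" where
  "vloc x V v l = (\<Prod>c\<in>V - {l}. 1 / (if even v then zf x l c else zf x c l))"

definition eloc :: "(nat \<Rightarrow> complex) \<Rightarrow> (nat \<Rightarrow> nat) \<Rightarrow> nat \<Rightarrow> complex" where
  "eloc x b e = (if even e then zf x (b e) (b (nxt e)) else zf x (b (nxt e)) (b e))"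

lemma even_nxt: assumes "e < 6" shows "even (nxt e) \<longleftrightarrow> odd e"
  using less_6_cases[OF assms] by (elim disjE) (simp_all add: nxt_simps)

lemma quotient_dual:
  "a \<noteq> 0 \<Longrightarrow> c \<noteq> 0 \<Longrightarrow> w \<noteq> 0 \<Longrightarrow> a \<noteq> c \<Longrightarrow> (w / a) / (w / a - w / c) = 1 / (1 - a / (c::complex))"
  by (simp add: field_simps)

text \<open>The weight of a plane is \<open>e3\<close> divided by the weight of its missing letter.
  Hence the local factors at odd vertices are those at even ones with the two letters exchanged, and
  an edge factor is 1 - \<open>x l' / x l\<close>, with \<open>l\<close> the letter of the line and
  \<open>l'\<close> the one missing from the plane.\<close>

theorem label_char_hexagon:
  assumes V: "card V = 3" and x: "\<And>l. l \<in> V \<Longrightarrow> x l \<noteq> 0" "inj_on x V"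
  shows "label_char x m V = (\<Sum>b\<in>PiE {..<6} (\<lambda>_. V).
     (\<Prod>v<6. vwt x V v (b v) ^ m (cset v)) * (\<Prod>l\<in>V. x l) ^ m {1,2,3} *
     ((\<Prod>v<6. vloc x V v (b v)) * (\<Prod>e<6. eloc x b e)))"
proof -
  have "finite V" using V card.infinite by fastforce
  then obtain \<nu> where nu: "bij_betw \<nu> {0..<card V} V" using ex_bij_betw_nat_finite by blast
  then have bij: "bij_betw \<nu> {..<3} V" using V by (simp add: atLeast0LessThan)
  have "inj_on \<nu> {..<3}" using bij by (simp add: bij_betw_def)
  then interpret three_letters \<nu> m x by (rule three_letters.intro)
  have V_eq: "three_letters.V \<nu> = V" using bij by (simp add: V_def bij_betw_def)
  have nuV: "\<nu> c \<in> V" if "c < 3" for c using bij that by (auto simp: bij_betw_def)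
  have V3: "V = {\<nu> 0, \<nu> 1, \<nu> 2}" using bij by (auto simp: bij_betw_def lessThan_3)
  have ne: "\<nu> 0 \<noteq> \<nu> 1" "\<nu> 0 \<noteq> \<nu> 2" "\<nu> 1 \<noteq> \<nu> 2" by (simp_all add: inj_on_eq_iff[OF inj_\<nu>])
  have x0: "x (\<nu> 0) \<noteq> 0" "x (\<nu> 1) \<noteq> 0" "x (\<nu> 2) \<noteq> 0" using x(1) nuV by auto
  have xne: "x (\<nu> 0) \<noteq> x (\<nu> 1)" "x (\<nu> 0) \<noteq> x (\<nu> 2)" "x (\<nu> 1) \<noteq> x (\<nu> 2)"
    using ne nuV by (simp_all add: inj_on_eq_iff[OF x(2)])
  have xinj: "inj_on (\<lambda>c. x (\<nu> c)) {..<3}"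
    using comp_inj_on[OF inj_\<nu>, of x] x(2) bij by (simp add: bij_betw_def comp_def)
  have rem: "V - {\<nu> 0} = {\<nu> 1, \<nu> 2}" "V - {\<nu> 1} = {\<nu> 0, \<nu> 2}" "V - {\<nu> 2} = {\<nu> 0, \<nu> 1}"
    using ne by (auto simp: V3)
  have e3V: "e3 = (\<Prod>l\<in>V. x l)" using ne by (simp add: e3_def V3)
  have e3_0: "e3 \<noteq> 0" using x0 by (simp add: e3_def)
  have yw_odd: "yw v c = e3 / x (\<nu> c)" if "c < 3" "odd v" for v c
    using less_3_cases[OF that(1)] that(2) x0 by (elim disjE) (simp_all add: yw_def e3_def)
  have yw0: "yw v c \<noteq> 0" if "c < 3" for v c
    using yw_odd[OF that, of v] e3_0 x(1)[OF nuV[OF that]] by (cases "even v") (simp_all add: yw_def)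
  have yw_inj: "inj_on (yw v) {..<3}" for v
  proof (cases "even v")
    case True
    then show ?thesis using xinj by (simp add: yw_def inj_on_def)
  next
    case False
    show ?thesis
    proof (rule inj_onI)
      fix c c' assume c: "c \<in> {..<3::nat}" "c' \<in> {..<3}" "yw v c = yw v c'"
      then have "x (\<nu> c) = x (\<nu> c')"
        using yw_odd[of c v] yw_odd[of c' v] False e3_0 x(1)[OF nuV, of c] x(1)[OF nuV, of c'] by (simp add: field_simps)
      then show "c = c'" using xinj c by (auto dest: inj_onD)
    qed
  qed
  have vwt_yw: "yw v c = vwt x V v (\<nu> c)" if "c < 3" for v c
    using less_3_cases[OF that] ne by (elim disjE) (simp_all add: yw_def vwt_def rem)
  have diff: "V - {\<nu> c} = \<nu> ` ({..<3} - {c})" if "c < 3" for c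
    using bij that by (auto simp: bij_betw_def inj_on_def)
  have lag_vloc: "lag (yw v) c = vloc x V v (\<nu> c)" if c: "c < 3" for v c
  proof -
    have "lag (yw v) c = (\<Prod>d\<in>{..<3} - {c}. 1 / (if even v then zf x (\<nu> c) (\<nu> d) else zf x (\<nu> d) (\<nu> c)))"
      unfolding lag_def
    proof (rule prod.cong[OF refl])
      fix d assume "d \<in> {..<3} - {c}"
      then have d: "d < 3" "d \<noteq> c" by auto
      have n0: "x (\<nu> c) \<noteq> 0" "x (\<nu> d) \<noteq> 0" using x(1) nuV c d by auto
      have "x (\<nu> c) \<noteq> x (\<nu> d)" using xinj c d by (auto dest: inj_onD)
      then show "yw v c / (yw v c - yw v d) = 1 / (if even v then zf x (\<nu> c) (\<nu> d) else zf x (\<nu> d) (\<nu> c))"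
      proof (cases "even v")
        case True
        then show ?thesis using n0 \<open>x (\<nu> c) \<noteq> x (\<nu> d)\<close> by (simp add: yw_def zf_def field_simps)
      next
        case False
        have "(e3 / x (\<nu> c)) / (e3 / x (\<nu> c) - e3 / x (\<nu> d)) = 1 / (1 - x (\<nu> c) / x (\<nu> d))"
          using n0 e3_0 \<open>x (\<nu> c) \<noteq> x (\<nu> d)\<close> by (rule quotient_dual)
        then show ?thesis using False by (simp only: yw_odd[OF c False] yw_odd[OF d(1) False] zf_def if_False)
      qed
    qed
    also have "\<dots> = (\<Prod>l\<in>\<nu> ` ({..<3} - {c}). 1 / (if even v then zf x (\<nu> c) l else zf x l (\<nu> c)))"
      using inj_\<nu> by (subst prod.reindex) (auto intro: inj_on_subset)
    finally show ?thesis by (simp only: vloc_def diff[OF c])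
  qed
  have edge: "1 - e3 / (yw e (a e) * yw (nxt e) (a (nxt e))) = eloc x (\<lambda>v. \<nu> (a v)) e"
    if e: "e < 6" and a: "a \<in> PiE {..<6} (\<lambda>_. {..<3})" for e a
  proof -
    have a3: "a e < 3" "a (nxt e) < 3" using a e nxt_less[of e] by (auto simp: PiE_iff)
    have n0: "x (\<nu> (a e)) \<noteq> 0" "x (\<nu> (a (nxt e))) \<noteq> 0" using x(1) nuV a3 by auto
    show ?thesis
      using n0 e3_0 yw_odd[OF a3(1), of e] yw_odd[OF a3(2), of "nxt e"] even_nxt[OF e]
      by (cases "even e") (simp_all add: yw_def eloc_def zf_def)
  qed
  have bijP: "bij_betw (\<lambda>a. \<lambda>v\<in>{..<6::nat}. \<nu> (a v)) (PiE {..<6::nat} (\<lambda>_. {..<3})) (PiE {..<6::nat} (\<lambda>_. V))"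
  proof (rule bij_betwI[where g = "\<lambda>b. \<lambda>v\<in>{..<6::nat}. kap (b v)"])
    show "(\<lambda>a. \<lambda>v\<in>{..<6::nat}. \<nu> (a v)) \<in> (PiE {..<6::nat} (\<lambda>_. {..<3})) \<rightarrow> (PiE {..<6::nat} (\<lambda>_. V))"
      using nuV by (auto simp: PiE_iff)
    show "(\<lambda>b. \<lambda>v\<in>{..<6::nat}. kap (b v)) \<in> (PiE {..<6::nat} (\<lambda>_. V)) \<rightarrow> (PiE {..<6::nat} (\<lambda>_. {..<3}))"
      using \<nu>_kap(2) V_eq by (auto simp: PiE_iff)
    show "(\<lambda>v\<in>{..<6::nat}. kap ((\<lambda>v\<in>{..<6::nat}. \<nu> (a v)) v)) = a" if "a \<in> PiE {..<6::nat} (\<lambda>_. {..<3})" for a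
      using that by (auto simp: fun_eq_iff restrict_def PiE_iff extensional_def kap_\<nu>)
    show "(\<lambda>v\<in>{..<6::nat}. \<nu> ((\<lambda>v\<in>{..<6::nat}. kap (b v)) v)) = b" if "b \<in> PiE {..<6::nat} (\<lambda>_. V)" for b
      using that \<nu>_kap(1) V_eq by (auto simp: fun_eq_iff restrict_def PiE_iff extensional_def)
  qed
  have "label_char x m V = e3 ^ m {1,2,3} * (\<Sum>a\<in>PiE {..<6} (\<lambda>_. {..<3}).
     (\<Prod>v<6. yw v (a v) ^ m (cset v) * lag (yw v) (a v)) * (\<Prod>e<6. 1 - e3 / (yw e (a e) * yw (nxt e) (a (nxt e)))))"
    using label_char_three std_mons_sum[of yw e3 "\<lambda>v. m (cset v)", OF yw_inj yw0 yw_edge] V_eq by simp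
  also have "\<dots> = (\<Sum>a\<in>PiE {..<6} (\<lambda>_. {..<3}). (\<lambda>b. (\<Prod>v<6. vwt x V v (b v) ^ m (cset v)) * (\<Prod>l\<in>V. x l) ^ m {1,2,3} *
     ((\<Prod>v<6. vloc x V v (b v)) * (\<Prod>e<6. eloc x b e))) (\<lambda>v\<in>{..<6}. \<nu> (a v)))"
    unfolding sum_distrib_left
  proof (rule sum.cong[OF refl])
    fix a assume a: "a \<in> PiE {..<6::nat} (\<lambda>_. {..<3::nat})"
    let ?b = "\<lambda>v\<in>{..<6}. \<nu> (a v)"
    have "(\<Prod>v<6. yw v (a v) ^ m (cset v) * lag (yw v) (a v)) = (\<Prod>v<6. vwt x V v (?b v) ^ m (cset v) * vloc x V v (?b v))"
    proof (rule prod.cong[OF refl])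
      fix v assume v: "v \<in> {..<6::nat}"
      then have "a v < 3" using a by (auto simp: PiE_iff)
      then show "yw v (a v) ^ m (cset v) * lag (yw v) (a v) = vwt x V v (?b v) ^ m (cset v) * vloc x V v (?b v)"
        using v by (simp add: vwt_yw lag_vloc)
    qed
    moreover have "(\<Prod>e<6. 1 - e3 / (yw e (a e) * yw (nxt e) (a (nxt e)))) = (\<Prod>e<6. eloc x ?b e)"
    proof (rule prod.cong[OF refl])
      fix e assume e: "e \<in> {..<6::nat}"
      then show "1 - e3 / (yw e (a e) * yw (nxt e) (a (nxt e))) = eloc x ?b e"
        using edge[OF _ a, of e] nxt_less[of e] by (simp add: eloc_def)
    qed
    ultimately show "e3 ^ m {1,2,3} * ((\<Prod>v<6. yw v (a v) ^ m (cset v) * lag (yw v) (a v)) * (\<Prod>e<6. 1 - e3 / (yw e (a e) * yw (nxt e) (a (nxt e)))))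
      = (\<lambda>b. (\<Prod>v<6. vwt x V v (b v) ^ m (cset v)) * (\<Prod>l\<in>V. x l) ^ m {1,2,3} *
     ((\<Prod>v<6. vloc x V v (b v)) * (\<Prod>e<6. eloc x b e))) ?b"
      by (simp add: prod.distrib e3V mult_ac)
  qed
  also have "\<dots> = (\<Sum>b\<in>PiE {..<6} (\<lambda>_. V). (\<Prod>v<6. vwt x V v (b v) ^ m (cset v)) * (\<Prod>l\<in>V. x l) ^ m {1,2,3} *
     ((\<Prod>v<6. vloc x V v (b v)) * (\<Prod>e<6. eloc x b e)))"
    by (rule sum.reindex_bij_betw[OF bijP])
  finally show ?thesis .
qed

section \<open>Tabloids as labelings of the hexagon\<close>

definition tab :: "nat set \<Rightarrow> (nat \<Rightarrow> nat) \<Rightarrow> nat set \<Rightarrow> nat set" where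
  "tab V b C = (if C = {1,2,3} then V else if C \<in> Subs then
     (let v = inv_into {..<6} cset C in if even v then {b v} else V - {b v}) else {})"

lemma tab_cset: "v < 6 \<Longrightarrow> tab V b (cset v) = (if even v then {b v} else V - {b v})"
  using full_not_cset cset_Subs[of v] by (auto simp: tab_def inv_into_f_f[OF inj_cset])

lemma tab_full: "tab V b {1,2,3} = V" by (simp add: tab_def)

lemma tab_outside: "C \<notin> Subs \<Longrightarrow> tab V b C = {}" by (auto simp: tab_def Subs_eq)

lemma cset_psubset_iff:
  assumes "u < 6" "v < 6"
  shows "cset u \<subset> cset v \<longleftrightarrow> even u \<and> odd v \<and> (nxt u = v \<or> nxt v = u)"
  using less_6_cases[OF assms(1)] less_6_cases[OF assms(2)]
  by (elim disjE) (simp_all add: cset_simps nxt_simps psubset_eq)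

lemma cset_psubset_full: assumes "v < 6" shows "cset v \<subset> {1,2,3}"
proof -
  have "cset v \<subseteq> {1,2,3}" using less_6_cases[OF assms] by (elim disjE) (simp_all add: cset_simps)
  moreover have "cset v \<noteq> {1,2,3}" using full_not_cset assms by (metis imageI lessThan_iff)
  ultimately show ?thesis by blast
qed

lemma card_cset: assumes "v < 6" shows "card (cset v) = (if even v then 1 else 2)"
  using less_6_cases[OF assms] by (elim disjE) (simp_all add: cset_simps)

text \<open>Different labels along an edge mean that the line at the even end lies in the plane at
  the odd end.\<close>

definition hex_labels :: "nat set \<Rightarrow> (nat \<Rightarrow> nat) set" where
  "hex_labels V = {b\<in>PiE {..<6} (\<lambda>_. V). \<forall>e<6. b e \<noteq> b (nxt e)}"

lemma Subs_cases:
  assumes "C \<in> Subs" obtains "C = {1,2,3}" | v where "v < 6" "C = cset v"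
  using assms by (auto simp: Subs_eq)

lemma tab_std:
  assumes V: "V \<subseteq> {1..n}" "card V = 3" and b: "b \<in> hex_labels V"
  shows "tab V b \<in> std_tabloids n"
proof -
  have finV: "finite V" using V(2) card.infinite by fastforce
  have bV: "b v \<in> V" if "v < 6" for v using b that by (auto simp: hex_labels_def)
  have sub: "tab V b C \<subseteq> V" for C
    by (cases "C \<in> Subs") (auto elim!: Subs_cases simp: tab_full tab_cset tab_outside bV split: if_splits)
  have card: "card (tab V b C) = card C" if "C \<in> Subs" for C
    using that
  proof (cases rule: Subs_cases)
    case 1 then show ?thesis using V by (simp add: tab_full)
  next
    case (2 v) then show ?thesis using V bV[of v] finV by (simp add: tab_cset card_cset)
  qed
  have strict: "tab V b C \<subset> tab V b C'" if C: "C \<in> Subs" "C' \<in> Subs" "C \<subset> C'" for C C'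
    using C(1)
  proof (cases rule: Subs_cases)
    case 1 then show ?thesis using C by (auto simp: Subs_def)
  next
    case (2 u)
    show ?thesis using C(2)
    proof (cases rule: Subs_cases)
      case 1
      have "card (tab V b C) < card V" using card[OF C(1)] 2 V by (simp add: card_cset)
      then show ?thesis using sub[of C] 1 by (auto simp: tab_full)
    next
      case (2 v)
      then have uv: "even u" "odd v" "nxt u = v \<or> nxt v = u"
        using C(3) \<open>u < 6\<close> \<open>C = cset u\<close> cset_psubset_iff by auto
      then have "b u \<noteq> b v" using b \<open>u < 6\<close> \<open>v < 6\<close> by (auto simp: hex_labels_def)
      then have "tab V b C \<subseteq> tab V b C'"
        using uv \<open>u < 6\<close> \<open>C = cset u\<close> 2 bV by (simp add: tab_cset)
      moreover have "card (tab V b C) \<noteq> card (tab V b C')"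
        using card[OF C(1)] card[OF C(2)] uv \<open>u < 6\<close> \<open>C = cset u\<close> 2 by (simp add: card_cset)
      ultimately show ?thesis by auto
    qed
  qed
  show ?thesis
    unfolding std_tabloids_def
  proof (intro CollectI conjI ballI allI impI)
    fix C assume "C \<in> Subs"
    then show "tab V b C \<subseteq> {1..n}" "card (tab V b C) = card C" using sub[of C] V(1) card[of C] by blast+
  next
    fix C C' assume "C \<in> Subs" "C' \<in> Subs" "C \<subset> C'"
    then show "tab V b C \<subset> tab V b C'" by (rule strict)
  next
    fix C assume "C \<notin> Subs" then show "tab V b C = {}" by (rule tab_outside)
  qed
qed

lemma tab_surj:
  assumes t: "\<tau> \<in> std_tabloids n" "\<tau> {1,2,3} = V"
  shows "\<exists>b\<in>hex_labels V. tab V b = \<tau>"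
proof -
  have S: "{1,2,3} \<in> Subs" by (simp add: Subs_eq)
  have tc: "card (\<tau> C) = card C" if "C \<in> Subs" for C using t that by (simp add: std_tabloids_def)
  have ts: "\<tau> C \<subset> \<tau> C'" if "C \<in> Subs" "C' \<in> Subs" "C \<subset> C'" for C C' using t that by (simp add: std_tabloids_def)
  have V3: "card V = 3" using tc[OF S] t by simp
  then have finV: "finite V" using card.infinite by fastforce
  have tV: "\<tau> (cset v) \<subset> V" if "v < 6" for v
    using ts[OF cset_Subs[OF that] S cset_psubset_full[OF that]] t(2) by simp
  have "\<exists>l. l \<in> V \<and> \<tau> (cset v) = (if even v then {l} else V - {l})" if v: "v < 6" for v
  proof (cases "even v")
    case True
    then have "card (\<tau> (cset v)) = 1" using tc[OF cset_Subs[OF v]] v by (simp add: card_cset)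
    then obtain l where "\<tau> (cset v) = {l}" by (rule card_1_singletonE)
    then show ?thesis using True tV[OF v] by auto
  next
    case False
    then have "card (\<tau> (cset v)) = 2" using tc[OF cset_Subs[OF v]] v by (simp add: card_cset)
    then have "card (V - \<tau> (cset v)) = 1" using tV[OF v] finV V3
      by (subst card_Diff_subset) (auto intro: finite_subset)
    then obtain l where "V - \<tau> (cset v) = {l}" by (rule card_1_singletonE)
    then have "l \<in> V" "\<tau> (cset v) = V - {l}" using tV[OF v] by auto
    then show ?thesis using False by auto
  qed
  then have "\<forall>v\<in>{..<6}. \<exists>l. l \<in> V \<and> \<tau> (cset v) = (if even v then {l} else V - {l})" by simp
  from bchoice[OF this] obtain b0 where b0: "\<forall>v\<in>{..<6}. b0 v \<in> V \<and> \<tau> (cset v) = (if even v then {b0 v} else V - {b0 v})" by blast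
  define b where "b = restrict b0 {..<6}"
  have b: "b v \<in> V" "\<tau> (cset v) = (if even v then {b v} else V - {b v})" if "v < 6" for v
    using b0 that by (simp_all add: b_def)
  have "b e \<noteq> b (nxt e)" if e: "e < 6" for e
  proof -
    have "\<exists>u v. {u,v} = {e, nxt e} \<and> even u \<and> odd v" using even_nxt[OF e] by (cases "even e") blast+
    then obtain u v where uv: "{u,v} = {e, nxt e}" "even u" "odd v" by blast
    have u6: "u < 6" "v < 6" using uv(1) e nxt_less[of e] by (auto simp: doubleton_eq_iff)
    have "nxt u = v \<or> nxt v = u" using uv(1) by (auto simp: doubleton_eq_iff)
    then have "cset u \<subset> cset v" using uv u6 by (simp add: cset_psubset_iff)
    then have "\<tau> (cset u) \<subset> \<tau> (cset v)" using u6 by (intro ts cset_Subs)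
    then have "b u \<noteq> b v" using b(2)[OF u6(1)] b(2)[OF u6(2)] uv by auto
    then show ?thesis using uv(1) by (auto simp: doubleton_eq_iff)
  qed
  then have "b \<in> hex_labels V" using b(1) by (auto simp: hex_labels_def b_def)
  moreover have "tab V b = \<tau>"
  proof
    fix C show "tab V b C = \<tau> C"
    proof (cases "C \<in> Subs")
      case True
      then show ?thesis by (cases rule: Subs_cases) (simp_all add: tab_full tab_cset b t)
    next
      case False
      then show ?thesis using t by (simp add: tab_outside std_tabloids_def)
    qed
  qed
  ultimately show ?thesis by blast
qed

lemma tab_inj: "inj_on (tab V) (hex_labels V)"
proof (rule inj_onI)
  fix b b' assume b: "b \<in> hex_labels V" "b' \<in> hex_labels V" "tab V b = tab V b'"
  have "b v = b' v" if v: "v < 6" for v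
  proof -
    have "b v \<in> V" "b' v \<in> V" using b v by (auto simp: hex_labels_def)
    moreover have "tab V b (cset v) = tab V b' (cset v)" using b(3) by simp
    ultimately show ?thesis using v by (auto simp: tab_cset split: if_splits)
  qed
  moreover have "b \<in> PiE {..<6} (\<lambda>_. V)" "b' \<in> PiE {..<6} (\<lambda>_. V)" using b by (simp_all add: hex_labels_def)
  ultimately show "b = b'" by (intro PiE_ext) auto
qed

lemma bij_tab:
  assumes "V \<subseteq> {1..n}" "card V = 3"
  shows "bij_betw (tab V) (hex_labels V) {\<tau>\<in>std_tabloids n. \<tau> {1,2,3} = V}"
  unfolding bij_betw_def
proof (intro conjI tab_inj equalityI subsetI)
  fix \<tau> assume "\<tau> \<in> tab V ` hex_labels V"
  then show "\<tau> \<in> {\<tau>\<in>std_tabloids n. \<tau> {1,2,3} = V}" using tab_std[OF assms] tab_full by blast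
next
  fix \<tau> assume "\<tau> \<in> {\<tau>\<in>std_tabloids n. \<tau> {1,2,3} = V}"
  then obtain b where "b \<in> hex_labels V" "tab V b = \<tau>" using tab_surj[of \<tau> n V] by blast
  then show "\<tau> \<in> tab V ` hex_labels V" by blast
qed

section \<open>Components of induced subgraphs of the hexagon\<close>

lemma card_quotient_rep:
  assumes R: "R \<subseteq> A \<times> A" and rep: "\<And>a b. a \<in> A \<Longrightarrow> b \<in> A \<Longrightarrow> (a, b) \<in> R\<^sup>* \<longleftrightarrow> F a = F b"
  shows "card (A // R\<^sup>*) = card (F ` A)"
proof -
  \<comment> \<open>\<open>R\<^sup>*\<close> is reflexive on the whole type, but \<open>R\<close>
    lives on \<open>A\<close>, so the class of an element of \<open>A\<close> does not leave
    \<open>A\<close>.\<close>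
  have stay: "b \<in> A" if "(a, b) \<in> R\<^sup>*" "a \<in> A" for a b
    using that by (induction rule: rtrancl_induct) (use R in auto)
  have cls: "R\<^sup>* `` {a} = {b\<in>A. F b = F a}" if "a \<in> A" for a
  proof (intro set_eqI iffI)
    fix b assume "b \<in> R\<^sup>* `` {a}"
    then have r: "(a, b) \<in> R\<^sup>*" by simp
    have "b \<in> A" using r that by (rule stay)
    then show "b \<in> {b\<in>A. F b = F a}" using rep[OF that, of b] r by simp
  next
    fix b assume "b \<in> {b\<in>A. F b = F a}"
    then show "b \<in> R\<^sup>* `` {a}" using rep[OF that, of b] by simp
  qed
  have "A // R\<^sup>* = (\<lambda>z. {b\<in>A. F b = z}) ` (F ` A)"
    unfolding quotient_def using cls by auto
  moreover have "inj_on (\<lambda>z. {b\<in>A. F b = z}) (F ` A)"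
    by (auto simp: inj_on_def)
  ultimately show ?thesis by (simp add: card_image)
qed

lemma funpow_prv: "v < 6 \<Longrightarrow> (prv ^^ k) v = (v + 5 * k) mod 6"
proof (induction k)
  case (Suc k)
  then have "(prv ^^ Suc k) v = prv ((v + 5 * k) mod 6)" by simp
  also have "\<dots> = (v + 5 * Suc k) mod 6" by (simp add: prv_def mod_simps ac_simps)
  finally show ?case .
qed simp

text \<open>A proper subset of the hexagon induces a union of paths; \<open>run_start\<close> is the first vertex of the path.\<close>
definition run_start :: "nat set \<Rightarrow> nat \<Rightarrow> nat" where
  "run_start W v = (prv ^^ (LEAST k. (prv ^^ Suc k) v \<notin> W)) v"

context
  fixes W :: "nat set"
  assumes W: "W \<subseteq> {..<6}" "W \<noteq> {..<6}"
begin

lemma run_ends: "v \<in> W \<Longrightarrow> \<exists>k. (prv ^^ Suc k) v \<notin> W"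
proof -
  assume v: "v \<in> W"
  obtain z where z: "z < 6" "z \<notin> W" using W by auto
  have v6: "v < 6" using v W by auto
  \<comment> \<open>\<open>prv\<close> adds 5, that is, subtracts 1 modulo 6, so
    \<open>v + 6 - z\<close> steps lead from \<open>v\<close> to \<open>z\<close>; the added 6 makes
    the number of steps positive.\<close>
  have "(v + 5 * (v + 6 - z)) mod 6 = z" using less_6_cases[OF v6] less_6_cases[OF z(1)] by (elim disjE) simp_all
  then have "(prv ^^ (v + 6 - z)) v = z" by (simp only: funpow_prv[OF v6])
  moreover have "v + 6 - z = Suc (v + 5 - z)" using z by simp
  ultimately show ?thesis using z by metis
qed

lemma run_chain:
  assumes v: "v \<in> W" and j: "j \<le> (LEAST k. (prv ^^ Suc k) v \<notin> W)"
  shows "(prv ^^ j) v \<in> W"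
proof (cases j)
  case (Suc i)
  then have "i < (LEAST k. (prv ^^ Suc k) v \<notin> W)" using j by simp
  from not_less_Least[OF this] show ?thesis using Suc by simp
qed (use v in simp)

lemma run_start_in: "v \<in> W \<Longrightarrow> run_start W v \<in> W"
  unfolding run_start_def by (rule run_chain) auto

lemma run_start_prv: "v \<in> W \<Longrightarrow> prv (run_start W v) \<notin> W"
  using LeastI_ex[OF run_ends] by (simp add: run_start_def)

lemma run_start_fixed: "prv v \<notin> W \<Longrightarrow> run_start W v = v"
  unfolding run_start_def by (subst Least_equality[of _ 0]) auto

lemma run_start_nxt:
  assumes u: "u \<in> W" "nxt u \<in> W" shows "run_start W (nxt u) = run_start W u"
proof -
  have u6: "u < 6" using u W by auto
  have sw: "(prv ^^ Suc k) (nxt u) = (prv ^^ k) u" for k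
    by (simp add: funpow_swap1 prv_nxt(1)[OF u6])
  obtain k where k: "(prv ^^ Suc k) (nxt u) \<notin> W" using run_ends[OF u(2)] by blast
  have "(LEAST k. (prv ^^ Suc k) (nxt u) \<notin> W) = Suc (LEAST k. (prv ^^ Suc (Suc k)) (nxt u) \<notin> W)"
    by (rule Least_Suc[where P = "\<lambda>k. (prv ^^ Suc k) (nxt u) \<notin> W", OF k]) (use u sw[of 0] in simp)
  also have "\<dots> = Suc (LEAST k. (prv ^^ Suc k) u \<notin> W)" by (simp only: sw)
  finally show ?thesis unfolding run_start_def using sw by simp
qed

text \<open>A component is a path and has exactly one vertex whose predecessor is outside
  \<open>W\<close>; the other vertices are the far ends \<open>nxt e\<close> of the edges. On the
  whole hexagon no vertex starts a path, which is why \<open>W\<close> has to be proper.\<close>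

lemma card_hexagon_components:
  assumes R: "R = {(cset u, cset w) |u w. u \<in> W \<and> w \<in> W \<and> (nxt u = w \<or> nxt w = u)}"
  shows "card ((cset ` W) // R\<^sup>*) + card {e\<in>W. nxt e \<in> W} = card W"
proof -
  have finW: "finite W" using W finite_subset by blast
  define F where "F C = run_start W (inv_into {..<6} cset C)" for C
  have F: "F (cset u) = run_start W u" if "u \<in> W" for u
    using that W by (auto simp: F_def inv_into_f_f[OF inj_cset])
  have symR: "sym R" unfolding R sym_def by blast
  have conn: "(cset v, cset (run_start W v)) \<in> R\<^sup>*" if v: "v \<in> W" for v
  proof -
    have "(cset v, cset ((prv ^^ j) v)) \<in> R\<^sup>*" if "j \<le> (LEAST k. (prv ^^ Suc k) v \<notin> W)" for j
      using that
    proof (induction j)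
      case (Suc j)
      let ?y = "(prv ^^ j) v"
      have y: "?y \<in> W" "prv ?y \<in> W" using run_chain[OF v, of j] run_chain[OF v, of "Suc j"] Suc.prems by auto
      then have "nxt (prv ?y) = ?y" using W prv_nxt(2)[of ?y] by auto
      then have "(cset ?y, cset (prv ?y)) \<in> R" unfolding R using y by blast
      moreover have "(cset v, cset ?y) \<in> R\<^sup>*" using Suc by simp
      ultimately show ?case by (simp add: rtrancl.rtrancl_into_rtrancl)
    qed simp
    then show ?thesis by (simp add: run_start_def)
  qed
  have inv: "F C = F C'" if "(C, C') \<in> R\<^sup>*" for C C'
    using that
  proof (induction rule: rtrancl_induct)
    case (step D D')
    then obtain u w where "D = cset u" "D' = cset w" "u \<in> W" "w \<in> W" "nxt u = w \<or> nxt w = u"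
      unfolding R by blast
    then have "F D = F D'" using run_start_nxt by (auto simp: F)
    then show ?case using step by simp
  qed simp
  have "card ((cset ` W) // R\<^sup>*) = card (F ` cset ` W)"
  proof (rule card_quotient_rep)
    show "R \<subseteq> cset ` W \<times> cset ` W" unfolding R by blast
    fix C C' assume "C \<in> cset ` W" "C' \<in> cset ` W"
    then obtain u w where u: "C = cset u" "C' = cset w" "u \<in> W" "w \<in> W" by blast
    show "(C, C') \<in> R\<^sup>* \<longleftrightarrow> F C = F C'"
    proof
      assume "F C = F C'"
      then have "(C, cset (run_start W w)) \<in> R\<^sup>*" using conn[OF u(3)] u by (simp add: F)
      moreover have "(cset (run_start W w), C') \<in> R\<^sup>*"
        using symD[OF sym_rtrancl[OF symR] conn[OF u(4)]] u by simp
      ultimately show "(C, C') \<in> R\<^sup>*" by (rule rtrancl_trans)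
    qed (rule inv)
  qed
  also have "F ` cset ` W = run_start W ` W" using F by (auto simp: image_iff)
  also have "run_start W ` W = {v\<in>W. prv v \<notin> W}"
  proof (intro equalityI subsetI)
    fix z assume "z \<in> run_start W ` W"
    then show "z \<in> {v\<in>W. prv v \<notin> W}" using run_start_in run_start_prv by blast
  next
    fix z assume z: "z \<in> {v\<in>W. prv v \<notin> W}"
    then have "run_start W z = z" by (simp add: run_start_fixed)
    then show "z \<in> run_start W ` W" using z by (metis (no_types, lifting) image_eqI mem_Collect_eq)
  qed
  finally have q: "card ((cset ` W) // R\<^sup>*) = card {v\<in>W. prv v \<notin> W}" .
  have "bij_betw nxt {e\<in>W. nxt e \<in> W} {v\<in>W. prv v \<in> W}"
    by (rule bij_betwI[where g = prv]) (use W in \<open>auto simp: prv_nxt subset_iff\<close>)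
  then have "card {e\<in>W. nxt e \<in> W} = card {v\<in>W. prv v \<in> W}" by (rule bij_betw_same_card)
  moreover have "card W = card {v\<in>W. prv v \<notin> W} + card {v\<in>W. prv v \<in> W}"
    using finW by (subst card_Un_disjoint[symmetric]) (auto intro!: arg_cong[of _ _ card])
  ultimately show ?thesis using q by simp
qed

end

text \<open>For \<open>a\<close> and \<open>c\<close> in \<open>V\<close>, the vertices whose set
  contains \<open>a\<close> but not \<open>c\<close>; an odd vertex carries its missing letter, so
  there the label has to be \<open>c\<close>.\<close>

definition hexW :: "(nat \<Rightarrow> nat) \<Rightarrow> nat \<Rightarrow> nat \<Rightarrow> nat set" where
  "hexW b a c = {v\<in>{..<6}. b v = (if even v then a else c)}"

lemma d_verts_inner:
  assumes b: "b \<in> hex_labels V" and ac: "a \<in> V" "c \<in> V" "a \<noteq> c"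
  shows "d_verts (tab V b) a c = cset ` hexW b a c"
proof -
  have "a \<in> tab V b (cset v) \<and> c \<notin> tab V b (cset v) \<longleftrightarrow> v \<in> hexW b a c" if "v < 6" for v
    using ac that by (auto simp: tab_cset hexW_def)
  note key = this
  show ?thesis
  proof (intro set_eqI iffI)
    fix C assume C: "C \<in> d_verts (tab V b) a c"
    then have "C \<in> Subs" by (simp add: d_verts_def)
    then show "C \<in> cset ` hexW b a c"
    proof (cases rule: Subs_cases)
      case 1 then show ?thesis using C ac(2) by (simp add: d_verts_def tab_full)
    next
      case (2 v) then show ?thesis using C key[of v] by (auto simp: d_verts_def)
    qed
  next
    fix C assume "C \<in> cset ` hexW b a c"
    then obtain v where v: "C = cset v" "v \<in> hexW b a c" by blast
    then have "v < 6" by (simp add: hexW_def)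
    then show "C \<in> d_verts (tab V b) a c" using v key[of v] cset_Subs[of v] by (simp add: d_verts_def)
  qed
qed

lemma d_ab_inner:
  assumes b: "b \<in> hex_labels V" and ac: "a \<in> V" "c \<in> V" "a \<noteq> c" and ns: "hexW b a c \<noteq> {..<6}"
  shows "d_ab (tab V b) a c + card {e\<in>hexW b a c. nxt e \<in> hexW b a c} = card (hexW b a c)"
proof -
  let ?W = "hexW b a c"
  have W6: "?W \<subseteq> {..<6}" by (auto simp: hexW_def)
  have adj: "cset u \<subset> cset w \<or> cset w \<subset> cset u \<longleftrightarrow> nxt u = w \<or> nxt w = u" if "u \<in> ?W" "w \<in> ?W" for u w
  proof -
    have uw: "u < 6" "w < 6" using that W6 by auto
    have "even u \<longleftrightarrow> odd w" if "nxt u = w \<or> nxt w = u"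
      using that even_nxt uw by auto
    then show ?thesis using uw by (auto simp: cset_psubset_iff)
  qed
  have "d_edges (tab V b) a c = {(cset u, cset w) |u w. u \<in> ?W \<and> w \<in> ?W \<and> (nxt u = w \<or> nxt w = u)}"
    unfolding d_edges_def d_verts_inner[OF b ac] using adj by blast
  from card_hexagon_components[OF W6 ns this] show ?thesis
    by (simp add: d_ab_def d_verts_inner[OF b ac])
qed

lemma tab_subset:
  assumes "b \<in> hex_labels V" shows "tab V b C \<subseteq> V"
proof -
  have "b v \<in> V" if "v < 6" for v using assms that by (auto simp: hex_labels_def)
  then show ?thesis
    by (cases "C \<in> Subs") (auto elim!: Subs_cases simp: tab_full tab_cset tab_outside split: if_splits)
qed

text \<open>The full set is itself a vertex and comparable to all others, so the graph is
  connected.\<close>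

lemma d_ab_boundary:
  assumes b: "b \<in> hex_labels V" and ac: "a \<in> V" "c \<notin> V"
  shows "d_ab (tab V b) a c = 1"
proof -
  let ?A = "d_verts (tab V b) a c" and ?R = "d_edges (tab V b) a c"
  have full: "{1,2,3} \<in> ?A" using ac by (simp add: d_verts_def Subs_eq tab_full)
  have to_full: "(C, {1,2,3}) \<in> ?R\<^sup>* \<and> ({1,2,3}, C) \<in> ?R\<^sup>*" if C: "C \<in> ?A" for C
  proof (cases "C = {1,2,3}")
    case False
    then have "C \<subset> {1,2,3}" using C by (auto simp: d_verts_def Subs_def)
    then have "(C, {1,2,3}) \<in> ?R" "({1,2,3}, C) \<in> ?R" using C full by (simp_all add: d_edges_def)
    then show ?thesis by blast
  qed simp
  have "card (?A // ?R\<^sup>*) = card ((\<lambda>_. 0::nat) ` ?A)"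
  proof (rule card_quotient_rep)
    show "?R \<subseteq> ?A \<times> ?A" by (auto simp: d_edges_def)
    fix C C' assume "C \<in> ?A" "C' \<in> ?A"
    then show "(C, C') \<in> ?R\<^sup>* \<longleftrightarrow> (0::nat) = 0" using to_full by (meson rtrancl_trans)
  qed
  also have "(\<lambda>_. 0::nat) ` ?A = {0}" using full by auto
  finally show ?thesis by (simp add: d_ab_def)
qed

lemma d_ab_outside:
  assumes b: "b \<in> hex_labels V" and a: "a \<notin> V" shows "d_ab (tab V b) a c = 0"
proof -
  have "d_verts (tab V b) a c = {}" using tab_subset[OF b] a by (auto simp: d_verts_def)
  then show ?thesis by (simp add: d_ab_def)
qed

section \<open>Exponents of the local factors\<close>

lemma prod_if_card: "finite A \<Longrightarrow> (\<Prod>v\<in>A. if v \<in> B then z else 1) = (z::complex) ^ card {v\<in>A. v \<in> B}"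
  by (subst prod.inter_filter[symmetric]) simp_all

lemma prod_pairs_swap:
  fixes f :: "nat \<Rightarrow> nat \<Rightarrow> nat \<Rightarrow> complex"
  shows "(\<Prod>v<6. \<Prod>a\<in>V. \<Prod>c\<in>V-{a}. f v a c) = (\<Prod>a\<in>V. \<Prod>c\<in>V-{a}. \<Prod>v<6. f v a c)"
proof -
  have "(\<Prod>v<6. \<Prod>a\<in>V. \<Prod>c\<in>V-{a}. f v a c) = (\<Prod>a\<in>V. \<Prod>v<6. \<Prod>c\<in>V-{a}. f v a c)" by (rule prod.swap)
  also have "\<dots> = (\<Prod>a\<in>V. \<Prod>c\<in>V-{a}. \<Prod>v<6. f v a c)" by (intro prod.cong refl prod.swap)
  finally show ?thesis .
qed

text \<open>The factor \<open>1 / zf x a c\<close> occurs at a vertex exactly if the vertex belongs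
  to \<open>hexW b a c\<close>. Edge factors are collected likewise by edges inside this set, so the
  pair gets the exponent edges minus vertices.\<close>

lemma prod_vloc:
  assumes V: "finite V" and b: "\<And>v. v < 6 \<Longrightarrow> b v \<in> V"
  shows "(\<Prod>v<6. vloc x V v (b v)) = (\<Prod>a\<in>V. \<Prod>c\<in>V-{a}. (1 / zf x a c) ^ card (hexW b a c))"
proof -
  have "vloc x V v (b v) = (\<Prod>a\<in>V. \<Prod>c\<in>V-{a}. if v \<in> hexW b a c then 1 / zf x a c else 1)" if v: "v < 6" for v
  proof (cases "even v")
    case True
    have "(\<Prod>a\<in>V. \<Prod>c\<in>V-{a}. if v \<in> hexW b a c then 1 / zf x a c else 1)
        = (\<Prod>a\<in>V. if a = b v then \<Prod>c\<in>V-{a}. 1 / zf x a c else 1)"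
      using True v by (intro prod.cong refl) (auto simp: hexW_def)
    also have "\<dots> = (\<Prod>c\<in>V-{b v}. 1 / zf x (b v) c)" using V b[OF v] by simp
    finally show ?thesis using True by (simp add: vloc_def)
  next
    case False
    have "(\<Prod>a\<in>V. \<Prod>c\<in>V-{a}. if v \<in> hexW b a c then 1 / zf x a c else 1)
        = (\<Prod>a\<in>V. \<Prod>c\<in>V-{a}. if c = b v then 1 / zf x a c else 1)"
      using False v by (intro prod.cong refl) (auto simp: hexW_def)
    also have "\<dots> = (\<Prod>a\<in>V. if a \<noteq> b v then 1 / zf x a (b v) else 1)"
      using V b[OF v] by (intro prod.cong refl) (auto simp: prod.delta')
    also have "\<dots> = (\<Prod>a\<in>{a\<in>V. a \<noteq> b v}. 1 / zf x a (b v))"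
      by (rule prod.inter_filter[OF V, symmetric])
    also have "{a\<in>V. a \<noteq> b v} = V - {b v}" by auto
    finally show ?thesis using False by (simp add: vloc_def)
  qed
  then have "(\<Prod>v<6. vloc x V v (b v)) = (\<Prod>v<6. \<Prod>a\<in>V. \<Prod>c\<in>V-{a}. if v \<in> hexW b a c then 1 / zf x a c else 1)"
    by (intro prod.cong) auto
  also have "\<dots> = (\<Prod>a\<in>V. \<Prod>c\<in>V-{a}. \<Prod>v<6. if v \<in> hexW b a c then 1 / zf x a c else 1)"
    by (rule prod_pairs_swap)
  also have "\<dots> = (\<Prod>a\<in>V. \<Prod>c\<in>V-{a}. (1 / zf x a c) ^ card (hexW b a c))"
  proof (intro prod.cong refl)
    fix a c
    have "{v\<in>{..<6}. v \<in> hexW b a c} = hexW b a c" by (auto simp: hexW_def)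
    then show "(\<Prod>v<6. if v \<in> hexW b a c then 1 / zf x a c else 1) = (1 / zf x a c) ^ card (hexW b a c)"
      by (simp only: prod_if_card[OF finite_lessThan])
  qed
  finally show ?thesis .
qed

lemma prod_eloc:
  assumes V: "finite V" and b: "b \<in> hex_labels V"
  shows "(\<Prod>e<6. eloc x b e) = (\<Prod>a\<in>V. \<Prod>c\<in>V-{a}. zf x a c ^ card {e\<in>hexW b a c. nxt e \<in> hexW b a c})"
proof -
  let ?E = "\<lambda>a c. {e\<in>hexW b a c. nxt e \<in> hexW b a c}"
  have "eloc x b e = (\<Prod>a\<in>V. \<Prod>c\<in>V-{a}. if e \<in> ?E a c then zf x a c else 1)" if e: "e < 6" for e
  proof -
    define s where "s = (if even e then b e else b (nxt e))"
    define q where "q = (if even e then b (nxt e) else b e)"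
    have sq: "s \<in> V" "q \<in> V" "s \<noteq> q"
      using b e nxt_less[of e] by (auto simp: hex_labels_def s_def q_def PiE_iff)
    have "e \<in> ?E a c \<longleftrightarrow> a = s \<and> c = q" for a c
      using even_nxt[OF e] e nxt_less[of e] by (auto simp: hexW_def s_def q_def)
    then have "(\<Prod>a\<in>V. \<Prod>c\<in>V-{a}. if e \<in> ?E a c then zf x a c else 1)
        = (\<Prod>a\<in>V. if a = s then \<Prod>c\<in>V-{a}. if c = q then zf x a c else 1 else 1)"
      by (intro prod.cong refl) auto
    also have "\<dots> = (\<Prod>c\<in>V-{s}. if c = q then zf x s c else 1)" using V sq by simp
    also have "\<dots> = zf x s q" using V sq by (simp add: prod.delta')
    finally show ?thesis by (simp add: eloc_def s_def q_def)
  qed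
  then have "(\<Prod>e<6. eloc x b e) = (\<Prod>e<6. \<Prod>a\<in>V. \<Prod>c\<in>V-{a}. if e \<in> ?E a c then zf x a c else 1)"
    by (intro prod.cong) auto
  also have "\<dots> = (\<Prod>a\<in>V. \<Prod>c\<in>V-{a}. \<Prod>e<6. if e \<in> ?E a c then zf x a c else 1)"
    by (rule prod_pairs_swap)
  also have "\<dots> = (\<Prod>a\<in>V. \<Prod>c\<in>V-{a}. zf x a c ^ card (?E a c))"
  proof (intro prod.cong refl)
    fix a c
    have "{e\<in>{..<6}. e \<in> ?E a c} = ?E a c" by (auto simp: hexW_def)
    then show "(\<Prod>e<6. if e \<in> ?E a c then zf x a c else 1) = zf x a c ^ card (?E a c)"
      by (simp only: prod_if_card[OF finite_lessThan])
  qed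
  finally show ?thesis .
qed

lemma wt_mono_tab:
  "wt_mono m x (tab V b) = (\<Prod>v<6. vwt x V v (b v) ^ m (cset v)) * (\<Prod>l\<in>V. x l) ^ m {1,2,3}"
proof -
  have "(\<Prod>a\<in>tab V b (cset v). x a ^ m (cset v)) = vwt x V v (b v) ^ m (cset v)" if "v < 6" for v
    using that by (simp add: tab_cset vwt_def prod_power_distrib)
  then show ?thesis
    unfolding wt_mono_def prod_Subs by (simp add: tab_full prod_power_distrib)
qed

lemma singular_of_full:
  assumes V: "V \<subseteq> {1..n}" "card V = 3" and ac: "a \<in> V" "c \<in> V" "a \<noteq> c" and W: "hexW b a c = {..<6}"
  shows "is_singular n (tab V b)"
proof -
  have finV: "finite V" using V(2) card.infinite by fastforce
  have "card (V - {a,c}) = 1" using V ac finV by (simp add: card_Diff_subset)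
  then obtain j where "V - {a,c} = {j}" by (rule card_1_singletonE)
  then have j: "j \<noteq> a" "j \<noteq> c" "V = {a,j,c}" using ac by auto
  have bv: "b v = (if even v then a else c)" if "v < 6" for v
  proof -
    have "v \<in> hexW b a c" using W that by simp
    then show ?thesis by (simp add: hexW_def)
  qed
  have "tab V b = sing_tabloid a j c"
  proof
    fix C show "tab V b C = sing_tabloid a j c C"
    proof (cases "C \<in> Subs")
      case True
      then show ?thesis
      proof (cases rule: Subs_cases)
        case 1
        then show ?thesis using True j by (simp add: tab_full sing_tabloid_def)
      next
        case (2 v)
        then show ?thesis using True j ac bv[of v] by (auto simp: tab_cset sing_tabloid_def card_cset)
      qed
    qed (simp add: tab_outside sing_tabloid_def)
  qed
  then have "sing_triple n (tab V b) (a,j,c)" using j V ac by (auto simp: sing_triple_def)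
  then show ?thesis by (auto simp: is_singular_def)
qed

lemma sing_tabloid_cset:
  "v < 6 \<Longrightarrow> sing_tabloid i j k (cset v) = (if even v then {i} else {i,j})"
  "sing_tabloid i j k {1,2,3} = {i,j,k}"
  by (auto simp: sing_tabloid_def card_cset cset_Subs) (simp_all add: Subs_eq)

lemma sing_triple_unique:
  assumes "sing_triple n \<tau> (i,j,k)" shows "(THE t. sing_triple n \<tau> t) = (i,j,k)"
proof (rule the_equality[where P = "sing_triple n \<tau>", OF assms])
  fix t assume t: "sing_triple n \<tau> t"
  obtain i' j' k' where t': "t = (i',j',k')" by (cases t)
  have eq: "sing_tabloid i j k = sing_tabloid i' j' k'" and d: "distinct [i,j,k]" "distinct [i',j',k']"
    using assms t by (auto simp: sing_triple_def t')
  have "sing_tabloid i j k C = sing_tabloid i' j' k' C" for C using eq by simp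
  from this[of "cset 0"] this[of "cset 1"] this[of "{1,2,3}"]
  have "{i} = {i'}" "{i,j} = {i',j'}" "{i,j,k} = {i',j',k'}" by (simp_all add: sing_tabloid_cset)
  then show "t = (i,j,k)" using d by (auto simp: t' doubleton_eq_iff)
qed

text \<open>Pairs with \<open>a\<close> outside \<open>V\<close> have exponent 0. For
  \<open>a\<close> in \<open>V\<close> and \<open>c\<close> outside it the exponent is 1, which
  gives the weights of the localization; for both in \<open>V\<close> it comes from the
  hexagon.\<close>

lemma contrib_tab:
  assumes V: "V \<subseteq> {1..n}" "card V = 3" and b: "b \<in> hex_labels V"
    and x: "\<And>l. l \<in> {1..n} \<Longrightarrow> x l \<noteq> 0" "inj_on x {1..n}"
  shows "contrib n m x (tab V b) = wt_mono m x (tab V b) * ((\<Prod>v<6. vloc x V v (b v)) * (\<Prod>e<6. eloc x b e))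
    * (\<Prod>v\<in>V. \<Prod>l\<in>{1..n}-V. x v / (x v - x l))"
proof -
  have finV: "finite V" using V(2) card.infinite by fastforce
  have bV: "b v \<in> V" if "v < 6" for v using b that by (auto simp: hex_labels_def)
  have z0: "zf x a c \<noteq> 0" if "a \<in> {1..n}" "c \<in> {1..n}" "a \<noteq> c" for a c
    using x(1)[OF that(1)] inj_on_eq_iff[OF x(2) that(1,2)] that(3) by (auto simp: zf_def)
  have bd: "x v / (x v - x l) = 1 / zf x v l" if "v \<in> {1..n}" for v l
    using x(1)[OF that] by (simp add: zf_def field_simps)
  have bdV: "(\<Prod>v\<in>V. \<Prod>l\<in>{1..n}-V. x v / (x v - x l)) = 1 / (\<Prod>v\<in>V. \<Prod>l\<in>{1..n}-V. zf x v l)"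
  proof -
    have "(\<Prod>v\<in>V. \<Prod>l\<in>{1..n}-V. x v / (x v - x l)) = (\<Prod>v\<in>V. \<Prod>l\<in>{1..n}-V. 1 / zf x v l)"
      using V bd by (intro prod.cong refl) auto
    then show ?thesis by (simp add: prod_dividef)
  qed
  show ?thesis
  proof (cases "is_singular n (tab V b)")
    case False
    then have ns: "hexW b a c \<noteq> {..<6}" if "a \<in> V" "c \<in> V" "a \<noteq> c" for a c
      using singular_of_full[OF V that] by blast
    have "(\<Prod>a\<in>{1..n}. \<Prod>c\<in>{1..n}-{a}. (1 - x c / x a) ^ d_ab (tab V b) a c)
        = (\<Prod>a\<in>V. \<Prod>c\<in>{1..n}-{a}. zf x a c ^ d_ab (tab V b) a c)"
      unfolding zf_def[symmetric]
      by (rule prod.mono_neutral_right) (use V d_ab_outside[OF b] in auto)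
    also have "\<dots> = (\<Prod>a\<in>V. (\<Prod>c\<in>V-{a}. zf x a c ^ d_ab (tab V b) a c) * (\<Prod>l\<in>{1..n}-V. zf x a l))"
    proof (rule prod.cong[OF refl])
      fix a assume a: "a \<in> V"
      have "{1..n} - {a} = (V - {a}) \<union> ({1..n} - V)" using V a by auto
      then have "(\<Prod>c\<in>{1..n}-{a}. zf x a c ^ d_ab (tab V b) a c)
          = (\<Prod>c\<in>V-{a}. zf x a c ^ d_ab (tab V b) a c) * (\<Prod>l\<in>{1..n}-V. zf x a l ^ d_ab (tab V b) a l)"
        using finV by (simp only:) (rule prod.union_disjoint, auto)
      also have "(\<Prod>l\<in>{1..n}-V. zf x a l ^ d_ab (tab V b) a l) = (\<Prod>l\<in>{1..n}-V. zf x a l)"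
        using d_ab_boundary[OF b a] by (intro prod.cong refl) auto
      finally show "(\<Prod>c\<in>{1..n}-{a}. zf x a c ^ d_ab (tab V b) a c)
          = (\<Prod>c\<in>V-{a}. zf x a c ^ d_ab (tab V b) a c) * (\<Prod>l\<in>{1..n}-V. zf x a l)" .
    qed
    finally have den: "(\<Prod>a\<in>{1..n}. \<Prod>c\<in>{1..n}-{a}. (1 - x c / x a) ^ d_ab (tab V b) a c)
        = (\<Prod>a\<in>V. \<Prod>c\<in>V-{a}. zf x a c ^ d_ab (tab V b) a c) * (\<Prod>v\<in>V. \<Prod>l\<in>{1..n}-V. zf x v l)"
      by (simp add: prod.distrib)
    have "(\<Prod>v<6. vloc x V v (b v)) * (\<Prod>e<6. eloc x b e)
        = (\<Prod>a\<in>V. \<Prod>c\<in>V-{a}. (1 / zf x a c) ^ card (hexW b a c) * zf x a c ^ card {e\<in>hexW b a c. nxt e \<in> hexW b a c})"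
      by (simp add: prod_vloc[OF finV bV] prod_eloc[OF finV b] prod.distrib)
    also have "\<dots> = (\<Prod>a\<in>V. \<Prod>c\<in>V-{a}. 1 / zf x a c ^ d_ab (tab V b) a c)"
    proof (intro prod.cong refl)
      fix a c assume ac: "a \<in> V" "c \<in> V - {a}"
      have z: "zf x a c \<noteq> 0" using ac V by (intro z0) auto
      have "card (hexW b a c) = d_ab (tab V b) a c + card {e\<in>hexW b a c. nxt e \<in> hexW b a c}"
        using d_ab_inner[OF b, of a c] ns[of a c] ac by auto
      then show "(1 / zf x a c) ^ card (hexW b a c) * zf x a c ^ card {e\<in>hexW b a c. nxt e \<in> hexW b a c}
          = 1 / zf x a c ^ d_ab (tab V b) a c"
        using z by (simp add: power_add power_one_over)
    qed
    also have "\<dots> = 1 / (\<Prod>a\<in>V. \<Prod>c\<in>V-{a}. zf x a c ^ d_ab (tab V b) a c)" by (simp add: prod_dividef)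
    finally have num: "(\<Prod>v<6. vloc x V v (b v)) * (\<Prod>e<6. eloc x b e)
        = 1 / (\<Prod>a\<in>V. \<Prod>c\<in>V-{a}. zf x a c ^ d_ab (tab V b) a c)" .
    show ?thesis using False unfolding contrib_def num bdV den by simp
  next
    case True
    then obtain i j k where t: "sing_triple n (tab V b) (i,j,k)" by (auto simp: is_singular_def)
    then have tb: "tab V b = sing_tabloid i j k" and d: "distinct [i,j,k]" by (auto simp: sing_triple_def)
    have VV: "V = {i,j,k}" using tab_full[of V b] sing_tabloid_cset(2)[of i j k] tb by simp
    have bi: "b v = i" if "v < 6" "even v" for v
      using tab_cset[OF that(1), of V b] sing_tabloid_cset(1)[OF that(1), of i j k] tb that(2) by auto
    have bk: "b v = k" if "v < 6" "odd v" for v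
    proof -
      have "V - {b v} = {i,j}"
        using tab_cset[OF that(1), of V b] sing_tabloid_cset(1)[OF that(1), of i j k] tb that(2) by simp
      then show ?thesis using VV d bV[OF that(1)] by auto
    qed
    have ijk: "i \<in> {1..n}" "j \<in> {1..n}" "k \<in> {1..n}" using V VV by auto
    have vi: "vloc x V v i = 1 / (zf x i j * zf x i k)" if "even v" for v
    proof -
      have "V - {i} = {j,k}" using VV d by auto
      then show ?thesis using that d by (simp add: vloc_def)
    qed
    have vk: "vloc x V v k = 1 / (zf x i k * zf x j k)" if "odd v" for v
    proof -
      have "V - {k} = {i,j}" using VV d by auto
      then show ?thesis using that d by (simp add: vloc_def)
    qed
    \<comment> \<open>The pair of \<open>i\<close> and \<open>k\<close> holds all six vertices and
      all six edges and cancels completely. The pairs \<open>i\<close>, \<open>j\<close> and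
      \<open>j\<close>, \<open>k\<close> hold the three even and the three odd vertices without any
      edge; this is the origin of the cubes.\<close>
    have "(\<Prod>v<6. vloc x V v (b v)) = (1 / (zf x i j * zf x i k)) ^ 3 * (1 / (zf x i k * zf x j k)) ^ 3"
      by (simp add: lessThan_6 bi bk vi vk power3_eq_cube)
    moreover have "(\<Prod>e<6. eloc x b e) = zf x i k ^ 6"
    proof -
      have "eloc x b e = zf x i k" if "e < 6" for e
        using that even_nxt[OF that] nxt_less[of e] by (simp add: eloc_def bi bk)
      then have "(\<Prod>e<6. eloc x b e) = (\<Prod>e<6::nat. zf x i k)" by (intro prod.cong) auto
      then show ?thesis by simp
    qed
    moreover have "(1 / (zi * zk)) ^ 3 * (1 / (zk * zj)) ^ 3 * zk ^ 6 = 1 / (zi ^ 3 * zj ^ 3)" if "zk \<noteq> 0" for zi zj zk :: complex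
    proof -
      have "zk ^ 6 = zk ^ 3 * zk ^ 3" by (simp add: power_add[symmetric])
      then have "(1 / (zi * zk)) ^ 3 * (1 / (zk * zj)) ^ 3 * zk ^ 6 = (zk ^ 3 * zk ^ 3 * 1) / (zk ^ 3 * zk ^ 3 * (zi ^ 3 * zj ^ 3))"
        by (simp add: power_divide power_mult_distrib ac_simps)
      then show ?thesis using that by (simp only: mult_divide_mult_cancel_left_if) simp
    qed
    ultimately have num: "(\<Prod>v<6. vloc x V v (b v)) * (\<Prod>e<6. eloc x b e) = 1 / (zf x i j ^ 3 * zf x j k ^ 3)"
      using z0[OF ijk(1,3)] d by simp
    have bdp: "(\<Prod>v\<in>V. \<Prod>l\<in>{1..n}-V. zf x v l) = (\<Prod>l\<in>{1..n}-{i,j,k}. zf x i l * zf x j l * zf x k l)"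
    proof -
      have "(\<Prod>v\<in>V. \<Prod>l\<in>{1..n}-V. zf x v l) = (\<Prod>l\<in>{1..n}-V. \<Prod>v\<in>V. zf x v l)" by (rule prod.swap)
      then show ?thesis using d by (simp add: VV mult.assoc)
    qed
    show ?thesis using True
      unfolding contrib_def sing_triple_unique[OF t] num bdV bdp by (simp add: zf_def mult.assoc)
  qed
qed

lemma eloc_zero_outside:
  assumes "b \<in> PiE {..<6} (\<lambda>_. V)" "b \<notin> hex_labels V" "\<And>l. l \<in> V \<Longrightarrow> x l \<noteq> 0"
  shows "(\<Prod>e<6. eloc x b e) = 0"
proof -
  obtain e where e: "e < 6" "b e = b (nxt e)" using assms(1,2) by (auto simp: hex_labels_def)
  have "b e \<in> V" using assms(1) e(1) by (simp add: PiE_iff)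
  then have "x (b e) \<noteq> 0" by (rule assms(3))
  then have "eloc x b e = 0" using e(2)[symmetric] by (simp add: eloc_def zf_def)
  then show ?thesis using e(1) by (intro prod_zero) auto
qed

text \<open>The identity of rational functions is stated at nonzero and pairwise distinct
  \<open>x a\<close>, where no denominator vanishes. Grouping the tabloids by
  \<open>\<tau> {1,2,3}\<close> matches them with the terms of the localization.\<close>

theorem theorem5p4:
  fixes n :: nat and m :: "nat set \<Rightarrow> nat" and x :: "nat \<Rightarrow> complex"
  assumes "n \<ge> 3"
    and "\<forall>a\<in>{1..n}. x a \<noteq> 0"
    and "\<forall>a\<in>{1..n}. \<forall>b\<in>{1..n}. a \<noteq> b \<longrightarrow> x a \<noteq> x b"
  shows "schur_char n m x = (\<Sum>\<tau>\<in>std_tabloids n. contrib n m x \<tau>)"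
proof -
  let ?V = "{V. V \<subseteq> {1..n} \<and> card V = 3}"
  let ?bd = "\<lambda>V. \<Prod>v\<in>V. \<Prod>l\<in>{1..n}-V. x v / (x v - x l)"
  have inj: "inj_on x {1..n}" using assms(3) by (auto simp: inj_on_def)
  have x0: "x l \<noteq> 0" if "l \<in> {1..n}" for l using assms(2) that by blast
  have finV: "finite ?V" by (rule finite_subset[of _ "Pow {1..n}"]) auto
  have local_sum: "label_char x m V * ?bd V = (\<Sum>\<tau>\<in>{\<tau>\<in>std_tabloids n. \<tau> {1,2,3} = V}. contrib n m x \<tau>)"
    if V: "V \<in> ?V" for V
  proof -
    from V have VV: "V \<subseteq> {1..n}" "card V = 3" by auto
    have fV: "finite V" using VV(1) finite_subset by blast
    let ?T = "\<lambda>b. (\<Prod>v<6. vwt x V v (b v) ^ m (cset v)) * (\<Prod>l\<in>V. x l) ^ m {1,2,3} *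
       ((\<Prod>v<6. vloc x V v (b v)) * (\<Prod>e<6. eloc x b e))"
    have xV: "x l \<noteq> 0" if "l \<in> V" for l using x0 that VV by auto
    have "label_char x m V = (\<Sum>b\<in>PiE {..<6} (\<lambda>_. V). ?T b)"
      using xV inj_on_subset[OF inj VV(1)] by (intro label_char_hexagon VV) auto
    also have "\<dots> = (\<Sum>b\<in>hex_labels V. ?T b)"
    proof (rule sum.mono_neutral_right)
      show "finite (PiE {..<6::nat} (\<lambda>_. V))" using fV by (intro finite_PiE) auto
      show "hex_labels V \<subseteq> PiE {..<6} (\<lambda>_. V)" by (auto simp: hex_labels_def)
      show "\<forall>b\<in>PiE {..<6} (\<lambda>_. V) - hex_labels V. ?T b = 0"
      proof
        fix b assume "b \<in> PiE {..<6} (\<lambda>_. V) - hex_labels V"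
        then have "(\<Prod>e<6. eloc x b e) = 0" using xV by (intro eloc_zero_outside[of b V x]) auto
        then show "?T b = 0" by simp
      qed
    qed
    finally have lc: "label_char x m V = (\<Sum>b\<in>hex_labels V. ?T b)" .
    have "label_char x m V * ?bd V = (\<Sum>b\<in>hex_labels V. contrib n m x (tab V b))"
      unfolding lc sum_distrib_right wt_mono_tab[symmetric]
      by (intro sum.cong refl contrib_tab[OF VV _ x0 inj, symmetric])
    then show ?thesis by (simp add: sum.reindex_bij_betw[OF bij_tab[OF VV]])
  qed
  have std_V: "\<tau> {1,2,3} \<in> ?V" if "\<tau> \<in> std_tabloids n" for \<tau>
  proof -
    have "{1,2,3} \<in> Subs" by (simp add: Subs_eq)
    then show ?thesis using that by (auto simp: std_tabloids_def)
  qed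
  have fin_std: "finite (std_tabloids n)"
  proof -
    have un: "std_tabloids n = (\<Union>V\<in>?V. {\<tau>\<in>std_tabloids n. \<tau> {1,2,3} = V})" using std_V by auto
    have "finite {\<tau>\<in>std_tabloids n. \<tau> {1,2,3} = V}" if "V \<in> ?V" for V
    proof -
      have "finite V" using that finite_subset by blast
      then have "finite (PiE {..<6::nat} (\<lambda>_. V))" by (intro finite_PiE) auto
      then have "finite (hex_labels V)" by (rule rev_finite_subset) (auto simp: hex_labels_def)
      moreover have "bij_betw (tab V) (hex_labels V) {\<tau>\<in>std_tabloids n. \<tau> {1,2,3} = V}"
        using that by (intro bij_tab) auto
      ultimately show ?thesis using bij_betw_finite by blast
    qed
    then have "finite (\<Union>V\<in>?V. {\<tau>\<in>std_tabloids n. \<tau> {1,2,3} = V})" using finV by blast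
    then show ?thesis using un by (simp only:)
  qed
  have "schur_char n m x = (\<Sum>V\<in>?V. label_char x m V * ?bd V)"
    unfolding schur_char_eq_label_char by (rule label_char_localization) (use assms(1) inj in auto)
  also have "\<dots> = (\<Sum>V\<in>?V. \<Sum>\<tau>\<in>{\<tau>\<in>std_tabloids n. \<tau> {1,2,3} = V}. contrib n m x \<tau>)"
    by (intro sum.cong refl local_sum)
  also have "\<dots> = (\<Sum>\<tau>\<in>std_tabloids n. contrib n m x \<tau>)"
    by (rule sum.group[OF fin_std finV]) (use std_V in auto)
  finally show ?thesis .
qed

end
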